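(* Let $\mathcal{Q}$ be a small Girard quantaloid. Then for any $\mathcal{Q}$-distributor $\phi$, the following statements are equivalent: (i) $\phi$ is regular. (ii) $\mathcal{K}\phi$ is (ccd). (iii) $\mathcal{K}\phi$ is $^{\mathrm{op}}$(ccd).
   Context: A quantaloid is a category whose hom-sets are complete lattices and whose composition preserves arbitrary joins in each variable; it is small if it has a set of objects. For arrows $f:X\to Y$, $g:Y\to Z$, $h:X\to Z$ the residuals $h\swarrow f:Y\to Z$ and $g\searrow h:X\to Y$ are determined by $g\circ f\le h\iff g\le h\swarrow f\iff f\le g\searrow h$. A Girard quantaloid is a quantaloid $\mathcal{Q}$ equipped with a family $\{d_X:X\to X\}_{X\in\mathrm{ob}\,\mathcal{Q}}$ that is cyclic ($d_X\swarrow f=f\searrow d_Y$ for all $f:X\to Y$) and dualizing ($(d_X\swarrow f)\searrow d_X=f=d_Y\swarrow(f\searrow d_Y)$ for all $f:X\to Y$). A (small) $\mathcal{Q}$-category $\mathbb{A}$ consists of a set $\mathbb{A}_0$ of objects, a type map $t:\mathbb{A}_0\to\mathrm{ob}\,\mathcal{Q}$ and hom-arrows $\mathbb{A}(x,y)\in\mathcal{Q}(tx,ty)$ with $1_{tx}\le\mathbb{A}(x,x)$ and $\mathbb{A}(y,z)\circ\mathbb{A}(x,y)\le\mathbb{A}(x,z)$. Its underlying order: $x\le y$ iff $tx=ty$ and $1_{tx}\le\mathbb{A}(x,y)$. A $\mathcal{Q}$-functor $F:\mathbb{A}\to\mathbb{B}$ is a type-preserving map on objects with $\mathbb{A}(x,y)\le\mathbb{B}(Fx,Fy)$;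 $\mathcal{Q}$-functors are ordered pointwise by the underlying order, giving a 2-category $\mathcal{Q}\text{-}\mathbf{Cat}$ in which adjunctions are taken ($F\dashv G$ iff $1\le GF$ and $FG\le 1$). A $\mathcal{Q}$-distributor $\phi:\mathbb{A}\nrightarrow\mathbb{B}$ assigns to each $(x,y)\in\mathbb{A}_0\times\mathbb{B}_0$ an arrow $\phi(x,y)\in\mathcal{Q}(tx,ty)$ with $\mathbb{B}(y,y')\circ\phi(x,y)\circ\mathbb{A}(x',x)\le\phi(x',y')$. With composition $(\psi\circ\phi)(x,z)=\bigvee_{y}\psi(y,z)\circ\phi(x,y)$, identities given by the hom-arrows, and pointwise order, $\mathcal{Q}$-categories and $\mathcal{Q}$-distributors form a quantaloid $\mathcal{Q}\text{-}\mathbf{Dist}$ (with residuals also denoted $\swarrow,\searrow$). $\phi:\mathbb{A}\nrightarrow\mathbb{B}$ is regular if there is $\psi:\mathbb{B}\nrightarrow\mathbb{A}$ with $\phi\circ\psi\circ\phi=\phi$. For $X\in\mathrm{ob}\,\mathcal{Q}$ let $\star_X$ be the $\mathcal{Q}$-category with a single object of type $X$ and hom-arrow $1_X$. The presheaf $\mathcal{Q}$-category $\mathcal{P}\mathbb{A}$ has as objects of type $X$ the $\mathcal{Q}$-distributors $\mu:\mathbb{A}\nrightarrow\star_X$, with $\mathcal{P}\mathbb{A}(\mu,\mu')=\mu'\swarrow\mu$. The copresheaf $\mathcal{Q}$-category $\mathcal{P}^{\dagger}\mathbb{A}$ has as objects of type $X$ the $\mathcal{Q}$-distributors $\lambda:\star_X\nrightarrow\mathbb{A}$,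 with $\mathcal{P}^{\dagger}\mathbb{A}(\lambda,\lambda')=\lambda'\searrow\lambda$. $\mathbb{A}$ is complete if the Yoneda embedding $\mathbb{A}\to\mathcal{P}\mathbb{A}$, $x\mapsto\mathbb{A}(-,x)$, has a left adjoint $\sup_{\mathbb{A}}$ in $\mathcal{Q}\text{-}\mathbf{Cat}$; equivalently, the co-Yoneda embedding $\mathbb{A}\to\mathcal{P}^{\dagger}\mathbb{A}$, $x\mapsto\mathbb{A}(x,-)$, has a right adjoint $\inf_{\mathbb{A}}:\mathcal{P}^{\dagger}\mathbb{A}\to\mathbb{A}$. $\mathbb{A}$ is (ccd) if it is complete and $\sup_{\mathbb{A}}$ has a left adjoint in $\mathcal{Q}\text{-}\mathbf{Cat}$; it is $^{\mathrm{op}}$(ccd) if it is complete and $\inf_{\mathbb{A}}$ has a right adjoint in $\mathcal{Q}\text{-}\mathbf{Cat}$. For $\phi:\mathbb{A}\nrightarrow\mathbb{B}$ let $\phi^*:\mathcal{P}\mathbb{B}\to\mathcal{P}\mathbb{A}$, $\lambda\mapsto\lambda\circ\phi$, and $\phi_*:\mathcal{P}\mathbb{A}\to\mathcal{P}\mathbb{B}$, $\mu\mapsto\mu\swarrow\phi$. $\mathcal{K}\phi:=\{\lambda\in\mathcal{P}\mathbb{B}\mid\phi_*\phi^*\lambda=\lambda\}$, regarded as a $\mathcal{Q}$-subcategory of $\mathcal{P}\mathbb{B}$. *)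

theory Defs
  imports "HOL-Algebra.Complete_Lattice"
begin

section \<open>Quantaloids\<close>

text \<open>
  Hom-sets for different pairs of objects are not required to be disjoint, so every operation
  carries its objects explicitly: for \<open>f : X \<rightarrow> Y\<close> and \<open>g : Y \<rightarrow> Z\<close>, the composite
  \<open>g \<circ> f : X \<rightarrow> Z\<close> is \<open>qcomp Q X Y Z g f\<close>. Smallness is automatic since the objects form a set.
\<close>

record ('o, 'a) quantaloid_data =
  qob   :: "'o set"
  qhom  :: "'o \<Rightarrow> 'o \<Rightarrow> 'a gorder"
  qcomp :: "'o \<Rightarrow> 'o \<Rightarrow> 'o \<Rightarrow> 'a \<Rightarrow> 'a \<Rightarrow> 'a"
  qid   :: "'o \<Rightarrow> 'a"

locale quantaloid =
  fixes Q :: "('o, 'a) quantaloid_data"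
  assumes hom_complete_lattice:
      "\<lbrakk>X \<in> qob Q; Y \<in> qob Q\<rbrakk> \<Longrightarrow> complete_lattice (qhom Q X Y)"
    and comp_closed:
      "\<lbrakk>X \<in> qob Q; Y \<in> qob Q; Z \<in> qob Q;
        f \<in> carrier (qhom Q X Y); g \<in> carrier (qhom Q Y Z)\<rbrakk>
       \<Longrightarrow> qcomp Q X Y Z g f \<in> carrier (qhom Q X Z)"
    and id_closed:
      "X \<in> qob Q \<Longrightarrow> qid Q X \<in> carrier (qhom Q X X)"
    and comp_assoc:
      "\<lbrakk>W \<in> qob Q; X \<in> qob Q; Y \<in> qob Q; Z \<in> qob Q;
        f \<in> carrier (qhom Q W X); g \<in> carrier (qhom Q X Y); h \<in> carrier (qhom Q Y Z)\<rbrakk>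
       \<Longrightarrow> qcomp Q W Y Z h (qcomp Q W X Y g f) = qcomp Q W X Z (qcomp Q X Y Z h g) f"
    and comp_id_right:
      "\<lbrakk>X \<in> qob Q; Y \<in> qob Q; f \<in> carrier (qhom Q X Y)\<rbrakk>
       \<Longrightarrow> qcomp Q X X Y f (qid Q X) = f"
    and comp_id_left:
      "\<lbrakk>X \<in> qob Q; Y \<in> qob Q; f \<in> carrier (qhom Q X Y)\<rbrakk>
       \<Longrightarrow> qcomp Q X Y Y (qid Q Y) f = f"
    and comp_Sup_left:
      "\<lbrakk>X \<in> qob Q; Y \<in> qob Q; Z \<in> qob Q;
        f \<in> carrier (qhom Q X Y); G \<subseteq> carrier (qhom Q Y Z)\<rbrakk>
       \<Longrightarrow> qcomp Q X Y Z (\<Squnion>\<^bsub>qhom Q Y Z\<^esub> G) f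
           = \<Squnion>\<^bsub>qhom Q X Z\<^esub> ((\<lambda>g. qcomp Q X Y Z g f) ` G)"
    and comp_Sup_right:
      "\<lbrakk>X \<in> qob Q; Y \<in> qob Q; Z \<in> qob Q;
        F \<subseteq> carrier (qhom Q X Y); g \<in> carrier (qhom Q Y Z)\<rbrakk>
       \<Longrightarrow> qcomp Q X Y Z g (\<Squnion>\<^bsub>qhom Q X Y\<^esub> F)
           = \<Squnion>\<^bsub>qhom Q X Z\<^esub> ((\<lambda>f. qcomp Q X Y Z g f) ` F)"

text \<open>
  For \<open>f : X \<rightarrow> Y\<close>, \<open>g : Y \<rightarrow> Z\<close>, \<open>h : X \<rightarrow> Z\<close>: \<open>qext Q X Y Z h f\<close> is
  \<open>h \<swarrow> f : Y \<rightarrow> Z\<close> and \<open>qlift Q X Y Z g h\<close> is \<open>g \<searrow> h : X \<rightarrow> Y\<close>.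
\<close>

definition qext :: "('o, 'a) quantaloid_data \<Rightarrow> 'o \<Rightarrow> 'o \<Rightarrow> 'o \<Rightarrow> 'a \<Rightarrow> 'a \<Rightarrow> 'a" where
  "qext Q X Y Z h f =
    (THE k. k \<in> carrier (qhom Q Y Z) \<and>
      (\<forall>g \<in> carrier (qhom Q Y Z).
         qcomp Q X Y Z g f \<sqsubseteq>\<^bsub>qhom Q X Z\<^esub> h \<longleftrightarrow> g \<sqsubseteq>\<^bsub>qhom Q Y Z\<^esub> k))"

definition qlift :: "('o, 'a) quantaloid_data \<Rightarrow> 'o \<Rightarrow> 'o \<Rightarrow> 'o \<Rightarrow> 'a \<Rightarrow> 'a \<Rightarrow> 'a" where
  "qlift Q X Y Z g h =
    (THE k. k \<in> carrier (qhom Q X Y) \<and>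
      (\<forall>f \<in> carrier (qhom Q X Y).
         qcomp Q X Y Z g f \<sqsubseteq>\<^bsub>qhom Q X Z\<^esub> h \<longleftrightarrow> f \<sqsubseteq>\<^bsub>qhom Q X Y\<^esub> k))"

locale girard_quantaloid = quantaloid Q for Q :: "('o, 'a) quantaloid_data" +
  fixes d :: "'o \<Rightarrow> 'a"
  assumes d_closed: "X \<in> qob Q \<Longrightarrow> d X \<in> carrier (qhom Q X X)"
    and cyclic:
      "\<lbrakk>X \<in> qob Q; Y \<in> qob Q; f \<in> carrier (qhom Q X Y)\<rbrakk>
       \<Longrightarrow> qext Q X Y X (d X) f = qlift Q Y X Y f (d Y)"
    and dualizing_left:
      "\<lbrakk>X \<in> qob Q; Y \<in> qob Q; f \<in> carrier (qhom Q X Y)\<rbrakk>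
       \<Longrightarrow> qlift Q X Y X (qext Q X Y X (d X) f) (d X) = f"
    and dualizing_right:
      "\<lbrakk>X \<in> qob Q; Y \<in> qob Q; f \<in> carrier (qhom Q X Y)\<rbrakk>
       \<Longrightarrow> qext Q Y X Y (d Y) (qlift Q Y X Y f (d Y)) = f"

section \<open>Categories, functors and adjunctions over a quantaloid\<close>

record ('o, 'a, 'x) qcat =
  cob  :: "'x set"
  ctyp :: "'x \<Rightarrow> 'o"
  chom :: "'x \<Rightarrow> 'x \<Rightarrow> 'a"

definition is_qcat :: "('o, 'a) quantaloid_data \<Rightarrow> ('o, 'a, 'x) qcat \<Rightarrow> bool" where
  "is_qcat Q A \<longleftrightarrow>
    (\<forall>x \<in> cob A. ctyp A x \<in> qob Q) \<and>
    (\<forall>x \<in> cob A. \<forall>y \<in> cob A. chom A x y \<in> carrier (qhom Q (ctyp A x) (ctyp A y))) \<and>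
    (\<forall>x \<in> cob A. qid Q (ctyp A x) \<sqsubseteq>\<^bsub>qhom Q (ctyp A x) (ctyp A x)\<^esub> chom A x x) \<and>
    (\<forall>x \<in> cob A. \<forall>y \<in> cob A. \<forall>z \<in> cob A.
       qcomp Q (ctyp A x) (ctyp A y) (ctyp A z) (chom A y z) (chom A x y)
         \<sqsubseteq>\<^bsub>qhom Q (ctyp A x) (ctyp A z)\<^esub> chom A x z)"

definition cle :: "('o, 'a) quantaloid_data \<Rightarrow> ('o, 'a, 'x) qcat \<Rightarrow> 'x \<Rightarrow> 'x \<Rightarrow> bool" where
  "cle Q A x y \<longleftrightarrow>
    ctyp A x = ctyp A y \<and> qid Q (ctyp A x) \<sqsubseteq>\<^bsub>qhom Q (ctyp A x) (ctyp A y)\<^esub> chom A x y"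

definition is_qfunctor ::
    "('o, 'a) quantaloid_data \<Rightarrow> ('o, 'a, 'x) qcat \<Rightarrow> ('o, 'a, 'y) qcat \<Rightarrow> ('x \<Rightarrow> 'y) \<Rightarrow> bool" where
  "is_qfunctor Q A B F \<longleftrightarrow>
    (\<forall>x \<in> cob A. F x \<in> cob B \<and> ctyp B (F x) = ctyp A x) \<and>
    (\<forall>x \<in> cob A. \<forall>y \<in> cob A.
       chom A x y \<sqsubseteq>\<^bsub>qhom Q (ctyp A x) (ctyp A y)\<^esub> chom B (F x) (F y))"

definition qfunctor_le ::
    "('o, 'a) quantaloid_data \<Rightarrow> ('o, 'a, 'x) qcat \<Rightarrow> ('o, 'a, 'y) qcat
      \<Rightarrow> ('x \<Rightarrow> 'y) \<Rightarrow> ('x \<Rightarrow> 'y) \<Rightarrow> bool" where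
  "qfunctor_le Q A B F G \<longleftrightarrow> (\<forall>x \<in> cob A. cle Q B (F x) (G x))"

text \<open>\<open>qadjoint Q A B F G\<close> says that \<open>F : A \<rightarrow> B\<close> is left adjoint to \<open>G : B \<rightarrow> A\<close>.\<close>

definition qadjoint ::
    "('o, 'a) quantaloid_data \<Rightarrow> ('o, 'a, 'x) qcat \<Rightarrow> ('o, 'a, 'y) qcat
      \<Rightarrow> ('x \<Rightarrow> 'y) \<Rightarrow> ('y \<Rightarrow> 'x) \<Rightarrow> bool" where
  "qadjoint Q A B F G \<longleftrightarrow>
    is_qfunctor Q A B F \<and> is_qfunctor Q B A G \<and>
    qfunctor_le Q A A id (G \<circ> F) \<and> qfunctor_le Q B B (F \<circ> G) id"

section \<open>Distributors\<close>

text \<open>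
  Distributors are \<open>undefined\<close> outside the object sets of their domain and codomain, so that
  equality of distributors is equality of HOL functions.
\<close>

definition qdist ::
    "('o, 'a) quantaloid_data \<Rightarrow> ('o, 'a, 'x) qcat \<Rightarrow> ('o, 'a, 'y) qcat \<Rightarrow> ('x \<Rightarrow> 'y \<Rightarrow> 'a) set" where
  "qdist Q A B = {\<phi>.
    (\<forall>x \<in> cob A. \<forall>y \<in> cob B. \<phi> x y \<in> carrier (qhom Q (ctyp A x) (ctyp B y))) \<and>
    (\<forall>x y. x \<notin> cob A \<or> y \<notin> cob B \<longrightarrow> \<phi> x y = undefined) \<and>
    (\<forall>x \<in> cob A. \<forall>x' \<in> cob A. \<forall>y \<in> cob B. \<forall>y' \<in> cob B.
       qcomp Q (ctyp A x') (ctyp B y) (ctyp B y') (chom B y y')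
         (qcomp Q (ctyp A x') (ctyp A x) (ctyp B y) (\<phi> x y) (chom A x' x))
         \<sqsubseteq>\<^bsub>qhom Q (ctyp A x') (ctyp B y')\<^esub> \<phi> x' y')}"

definition dist_le ::
    "('o, 'a) quantaloid_data \<Rightarrow> ('o, 'a, 'x) qcat \<Rightarrow> ('o, 'a, 'y) qcat
      \<Rightarrow> ('x \<Rightarrow> 'y \<Rightarrow> 'a) \<Rightarrow> ('x \<Rightarrow> 'y \<Rightarrow> 'a) \<Rightarrow> bool" where
  "dist_le Q A B \<phi> \<psi> \<longleftrightarrow>
    (\<forall>x \<in> cob A. \<forall>y \<in> cob B. \<phi> x y \<sqsubseteq>\<^bsub>qhom Q (ctyp A x) (ctyp B y)\<^esub> \<psi> x y)"

definition dist_comp ::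
    "('o, 'a) quantaloid_data \<Rightarrow> ('o, 'a, 'x) qcat \<Rightarrow> ('o, 'a, 'y) qcat \<Rightarrow> ('o, 'a, 'z) qcat
      \<Rightarrow> ('y \<Rightarrow> 'z \<Rightarrow> 'a) \<Rightarrow> ('x \<Rightarrow> 'y \<Rightarrow> 'a) \<Rightarrow> ('x \<Rightarrow> 'z \<Rightarrow> 'a)" where
  "dist_comp Q A B C \<psi> \<phi> = (\<lambda>x z.
    if x \<in> cob A \<and> z \<in> cob C
    then \<Squnion>\<^bsub>qhom Q (ctyp A x) (ctyp C z)\<^esub>
           ((\<lambda>y. qcomp Q (ctyp A x) (ctyp B y) (ctyp C z) (\<psi> y z) (\<phi> x y)) ` cob B)
    else undefined)"

text \<open>
  For \<open>\<phi> : A \<rightarrow> B\<close>, \<open>\<psi> : B \<rightarrow> C\<close>, \<open>\<chi> : A \<rightarrow> C\<close>: \<open>dist_ext Q A B C \<chi> \<phi>\<close> is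
  \<open>\<chi> \<swarrow> \<phi> : B \<rightarrow> C\<close> and \<open>dist_lift Q A B C \<psi> \<chi>\<close> is \<open>\<psi> \<searrow> \<chi> : A \<rightarrow> B\<close>.
\<close>

definition dist_ext ::
    "('o, 'a) quantaloid_data \<Rightarrow> ('o, 'a, 'x) qcat \<Rightarrow> ('o, 'a, 'y) qcat \<Rightarrow> ('o, 'a, 'z) qcat
      \<Rightarrow> ('x \<Rightarrow> 'z \<Rightarrow> 'a) \<Rightarrow> ('x \<Rightarrow> 'y \<Rightarrow> 'a) \<Rightarrow> ('y \<Rightarrow> 'z \<Rightarrow> 'a)" where
  "dist_ext Q A B C \<chi> \<phi> =
    (THE \<kappa>. \<kappa> \<in> qdist Q B C \<and>
      (\<forall>\<psi> \<in> qdist Q B C.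
         dist_le Q A C (dist_comp Q A B C \<psi> \<phi>) \<chi> \<longleftrightarrow> dist_le Q B C \<psi> \<kappa>))"

definition dist_lift ::
    "('o, 'a) quantaloid_data \<Rightarrow> ('o, 'a, 'x) qcat \<Rightarrow> ('o, 'a, 'y) qcat \<Rightarrow> ('o, 'a, 'z) qcat
      \<Rightarrow> ('y \<Rightarrow> 'z \<Rightarrow> 'a) \<Rightarrow> ('x \<Rightarrow> 'z \<Rightarrow> 'a) \<Rightarrow> ('x \<Rightarrow> 'y \<Rightarrow> 'a)" where
  "dist_lift Q A B C \<psi> \<chi> =
    (THE \<kappa>. \<kappa> \<in> qdist Q A B \<and>
      (\<forall>\<phi> \<in> qdist Q A B.
         dist_le Q A C (dist_comp Q A B C \<psi> \<phi>) \<chi> \<longleftrightarrow> dist_le Q A B \<phi> \<kappa>))"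

definition regular_dist ::
    "('o, 'a) quantaloid_data \<Rightarrow> ('o, 'a, 'x) qcat \<Rightarrow> ('o, 'a, 'y) qcat \<Rightarrow> ('x \<Rightarrow> 'y \<Rightarrow> 'a) \<Rightarrow> bool" where
  "regular_dist Q A B \<phi> \<longleftrightarrow>
    (\<exists>\<psi> \<in> qdist Q B A. dist_comp Q A A B \<phi> (dist_comp Q A B A \<psi> \<phi>) = \<phi>)"

section \<open>Presheaves, completeness and complete (co)distributivity\<close>

definition qstar :: "('o, 'a) quantaloid_data \<Rightarrow> 'o \<Rightarrow> ('o, 'a, unit) qcat" where
  "qstar Q X = \<lparr>cob = {()}, ctyp = (\<lambda>_. X), chom = (\<lambda>_ _. qid Q X)\<rparr>"

text \<open>
  A (co)presheaf is paired with its type, since a distributor alone does not determine it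
  (e.g. when the category is empty). A distributor from \<open>\<star>\<^sub>X\<close> to \<open>\<star>\<^sub>Y\<close> is identified with the
  arrow \<open>X \<rightarrow> Y\<close> at its only entry.
\<close>

definition presheaf ::
    "('o, 'a) quantaloid_data \<Rightarrow> ('o, 'a, 'x) qcat \<Rightarrow> ('o, 'a, 'o \<times> ('x \<Rightarrow> unit \<Rightarrow> 'a)) qcat" where
  "presheaf Q A =
    \<lparr>cob = {(X, \<mu>). X \<in> qob Q \<and> \<mu> \<in> qdist Q A (qstar Q X)},
     ctyp = fst,
     chom = (\<lambda>(X, \<mu>) (X', \<mu>'). dist_ext Q A (qstar Q X) (qstar Q X') \<mu>' \<mu> () ())\<rparr>"

definition copresheaf ::
    "('o, 'a) quantaloid_data \<Rightarrow> ('o, 'a, 'x) qcat \<Rightarrow> ('o, 'a, 'o \<times> (unit \<Rightarrow> 'x \<Rightarrow> 'a)) qcat" where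
  "copresheaf Q A =
    \<lparr>cob = {(X, l). X \<in> qob Q \<and> l \<in> qdist Q (qstar Q X) A},
     ctyp = fst,
     chom = (\<lambda>(X, l) (X', l'). dist_lift Q (qstar Q X) (qstar Q X') A l' l () ())\<rparr>"

definition yoneda :: "('o, 'a, 'x) qcat \<Rightarrow> 'x \<Rightarrow> 'o \<times> ('x \<Rightarrow> unit \<Rightarrow> 'a)" where
  "yoneda A x = (ctyp A x, \<lambda>x' _. if x' \<in> cob A then chom A x' x else undefined)"

definition coyoneda :: "('o, 'a, 'x) qcat \<Rightarrow> 'x \<Rightarrow> 'o \<times> (unit \<Rightarrow> 'x \<Rightarrow> 'a)" where
  "coyoneda A x = (ctyp A x, \<lambda>_ x'. if x' \<in> cob A then chom A x x' else undefined)"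

text \<open>
  Adjoints are unique only up to isomorphism, so \<open>sup\<close> and \<open>inf\<close> are rendered as relations;
  possession of a further adjoint does not depend on the choice.
\<close>

definition is_sup ::
    "('o, 'a) quantaloid_data \<Rightarrow> ('o, 'a, 'x) qcat \<Rightarrow> ('o \<times> ('x \<Rightarrow> unit \<Rightarrow> 'a) \<Rightarrow> 'x) \<Rightarrow> bool" where
  "is_sup Q A S \<longleftrightarrow> qadjoint Q (presheaf Q A) A S (yoneda A)"

definition is_inf ::
    "('o, 'a) quantaloid_data \<Rightarrow> ('o, 'a, 'x) qcat \<Rightarrow> ('o \<times> (unit \<Rightarrow> 'x \<Rightarrow> 'a) \<Rightarrow> 'x) \<Rightarrow> bool" where
  "is_inf Q A I \<longleftrightarrow> qadjoint Q A (copresheaf Q A) (coyoneda A) I"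

definition complete_qcat :: "('o, 'a) quantaloid_data \<Rightarrow> ('o, 'a, 'x) qcat \<Rightarrow> bool" where
  "complete_qcat Q A \<longleftrightarrow> (\<exists>S. is_sup Q A S)"

definition ccd :: "('o, 'a) quantaloid_data \<Rightarrow> ('o, 'a, 'x) qcat \<Rightarrow> bool" where
  "ccd Q A \<longleftrightarrow> complete_qcat Q A \<and>
    (\<exists>S T. is_sup Q A S \<and> qadjoint Q A (presheaf Q A) T S)"

definition op_ccd :: "('o, 'a) quantaloid_data \<Rightarrow> ('o, 'a, 'x) qcat \<Rightarrow> bool" where
  "op_ccd Q A \<longleftrightarrow> complete_qcat Q A \<and>
    (\<exists>I R. is_inf Q A I \<and> qadjoint Q (copresheaf Q A) A I R)"

section \<open>Fixed points of the Kan adjunction of a distributor\<close>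

definition kan_upper ::
    "('o, 'a) quantaloid_data \<Rightarrow> ('o, 'a, 'x) qcat \<Rightarrow> ('o, 'a, 'y) qcat \<Rightarrow> ('x \<Rightarrow> 'y \<Rightarrow> 'a)
      \<Rightarrow> 'o \<times> ('y \<Rightarrow> unit \<Rightarrow> 'a) \<Rightarrow> 'o \<times> ('x \<Rightarrow> unit \<Rightarrow> 'a)" where
  "kan_upper Q A B \<phi> = (\<lambda>(X, l). (X, dist_comp Q A B (qstar Q X) l \<phi>))"

definition kan_lower ::
    "('o, 'a) quantaloid_data \<Rightarrow> ('o, 'a, 'x) qcat \<Rightarrow> ('o, 'a, 'y) qcat \<Rightarrow> ('x \<Rightarrow> 'y \<Rightarrow> 'a)
      \<Rightarrow> 'o \<times> ('x \<Rightarrow> unit \<Rightarrow> 'a) \<Rightarrow> 'o \<times> ('y \<Rightarrow> unit \<Rightarrow> 'a)" where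
  "kan_lower Q A B \<phi> = (\<lambda>(X, \<mu>). (X, dist_ext Q A B (qstar Q X) \<mu> \<phi>))"

definition KK ::
    "('o, 'a) quantaloid_data \<Rightarrow> ('o, 'a, 'x) qcat \<Rightarrow> ('o, 'a, 'y) qcat \<Rightarrow> ('x \<Rightarrow> 'y \<Rightarrow> 'a)
      \<Rightarrow> ('o, 'a, 'o \<times> ('y \<Rightarrow> unit \<Rightarrow> 'a)) qcat" where
  "KK Q A B \<phi> = (presheaf Q B)
    \<lparr>cob := {l \<in> cob (presheaf Q B). kan_lower Q A B \<phi> (kan_upper Q A B \<phi> l) = l}\<rparr>"

end

theory Submission
  imports Defs
begin

text \<open>
  Negation \<open>\<not>f = d \<swarrow> f\<close> turns \<open>\<K>\<phi>\<close> into the concept lattice of \<open>\<not>\<phi>\<close>: it is generated under suprema by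
  the elements \<open>p b = \<phi>\<^sub>*\<phi>(-, b)\<close> and under infima by \<open>q a = \<not>\<phi>(a, -)\<close>, with
  \<open>\<K>\<phi>(p b, q a) = \<not>\<phi>(a, b)\<close>. This description is self-dual, as is regularity of \<open>\<phi>\<close>, so it is
  enough to show for any such category \<open>C\<close> that complete distributivity amounts to regularity.

  Put \<open>x\<^sup>a = \<not>C(x, q a)\<close>; these arrows preserve suprema in \<open>x\<close> and \<open>(p b)\<^sup>a = \<phi>(a, b)\<close>. If
  \<open>\<phi> \<circ> \<psi> \<circ> \<phi> = \<phi>\<close>, let \<open>w a\<close> be the supremum of the \<open>p b\<close> weighted by \<open>\<psi>(b, a)\<close>; then the presheaf
  \<open>\<Squnion>\<^sub>a x\<^sup>a \<circ> C(-, w a)\<close> provides the left adjoint of \<open>sup\<close> at \<open>x\<close>. Conversely, if \<open>T \<stileturn> sup\<close> and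
  \<open>s b\<close> is the supremum of the presheaf \<open>\<not>C(p b, -)\<close>, then \<open>\<psi>(b, a) = C(s b, q a)\<close> satisfies
  \<open>\<phi> \<circ> \<psi> \<circ> \<phi> = \<phi>\<close>.
\<close>

section \<open>Calculus in a quantaloid\<close>

text \<open>Over the two-element quantale this is Raney's criterion: \<open>\<phi>\<close> relates a
  to b when p b is not below q a, s b is the join of all elements not above p b, and
  \<open>\<psi>\<close> relates b to a when s b lies below q a. In general the presheaf \<not>C(p b,
  -) is the largest one whose value at p b is below d. Testing T(p b) against \<not>C(p b', -),
  whose supremum is s b', gives T(p b)(p b') \<le> \<not>C(p b, s b'), and density of q makes the
  right side the join of the composites \<phi>(a, b) \<circ> \<psi>(b', a). As p b is the supremum
  of T(p b), this yields \<phi> \<le> \<phi> \<circ> \<psi> \<circ> \<phi>; the opposite inequality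
  comes from s b being an upper bound of its presheaf. In the other direction the two halves of
  regularity do separate work: \<phi> \<circ> \<psi> \<circ> \<phi> \<le> \<phi> makes the
  approximating presheaf of x small enough to lie below every \<theta> whose supremum is above x,
  and \<phi> \<le> \<phi> \<circ> \<psi> \<circ> \<phi> makes it large enough for the
  converse.\<close>

definition arr :: "('o, 'a) quantaloid_data \<Rightarrow> 'o \<Rightarrow> 'o \<Rightarrow> 'a set" where
  "arr Q X Y = {f. X \<in> qob Q \<and> Y \<in> qob Q \<and> f \<in> carrier (qhom Q X Y)}"

text \<open>Membership of both arrows, and through \<open>arr\<close> of the objects, is part of the
  relation, so that inequalities chain by \<open>leq_trans\<close> without side conditions.\<close>

definition leq :: "('o, 'a) quantaloid_data \<Rightarrow> 'o \<Rightarrow> 'o \<Rightarrow> 'a \<Rightarrow> 'a \<Rightarrow> bool" where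
  "leq Q X Y f g \<longleftrightarrow> f \<in> arr Q X Y \<and> g \<in> arr Q X Y \<and> f \<sqsubseteq>\<^bsub>qhom Q X Y\<^esub> g"

abbreviation qjoin :: "('o, 'a) quantaloid_data \<Rightarrow> 'o \<Rightarrow> 'o \<Rightarrow> ('i \<Rightarrow> 'a) \<Rightarrow> 'i set \<Rightarrow> 'a" where
  "qjoin Q X Y f I \<equiv> \<Squnion>\<^bsub>qhom Q X Y\<^esub> (f ` I)"

abbreviation qmeet :: "('o, 'a) quantaloid_data \<Rightarrow> 'o \<Rightarrow> 'o \<Rightarrow> ('i \<Rightarrow> 'a) \<Rightarrow> 'i set \<Rightarrow> 'a" where
  "qmeet Q X Y f I \<equiv> \<Sqinter>\<^bsub>qhom Q X Y\<^esub> (f ` I)"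

lemma arr_obD: "f \<in> arr Q X Y \<Longrightarrow> X \<in> qob Q" "f \<in> arr Q X Y \<Longrightarrow> Y \<in> qob Q"
  by (auto simp: arr_def)

lemma leq_arrD: "leq Q X Y f g \<Longrightarrow> f \<in> arr Q X Y" "leq Q X Y f g \<Longrightarrow> g \<in> arr Q X Y"
  by (auto simp: leq_def)

lemma leqI: "\<lbrakk>f \<in> arr Q X Y; g \<in> arr Q X Y; f \<sqsubseteq>\<^bsub>qhom Q X Y\<^esub> g\<rbrakk> \<Longrightarrow> leq Q X Y f g"
  by (auto simp: leq_def)

context quantaloid
begin

lemma comp_arr [simp, intro]:
  "\<lbrakk>f \<in> arr Q X Y; g \<in> arr Q Y Z\<rbrakk> \<Longrightarrow> qcomp Q X Y Z g f \<in> arr Q X Z"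
  by (auto simp: arr_def comp_closed)

lemma id_arr [simp, intro]: "X \<in> qob Q \<Longrightarrow> qid Q X \<in> arr Q X X"
  by (auto simp: arr_def id_closed)

lemma comp_id [simp]:
  assumes "f \<in> arr Q X Y"
  shows "qcomp Q X X Y f (qid Q X) = f" "qcomp Q X Y Y (qid Q Y) f = f"
  using assms by (auto simp: arr_def comp_id_left comp_id_right)

lemma assoc:
  "\<lbrakk>f \<in> arr Q W X; g \<in> arr Q X Y; h \<in> arr Q Y Z\<rbrakk>
   \<Longrightarrow> qcomp Q W X Z (qcomp Q X Y Z h g) f = qcomp Q W Y Z h (qcomp Q W X Y g f)"
  by (auto simp: arr_def comp_assoc)

lemma leq_refl [simp, intro]: "f \<in> arr Q X Y \<Longrightarrow> leq Q X Y f f"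
  using hom_complete_lattice[of X Y] unfolding leq_def arr_def complete_lattice_def partial_order_def
  by (auto intro: weak_partial_order.le_refl)

lemma leq_antisym: "\<lbrakk>leq Q X Y f g; leq Q X Y g f\<rbrakk> \<Longrightarrow> f = g"
  using hom_complete_lattice[of X Y] unfolding leq_def arr_def complete_lattice_def
  by (auto intro: partial_order.le_antisym)

lemma leq_trans [trans]: "\<lbrakk>leq Q X Y f g; leq Q X Y g h\<rbrakk> \<Longrightarrow> leq Q X Y f h"
  using hom_complete_lattice[of X Y] unfolding leq_def arr_def complete_lattice_def partial_order_def
  by (auto intro: weak_partial_order.le_trans)

text \<open>The Yoneda principle in a hom-lattice. Residuals, meets and homs are all specified by
  their lower bounds, so later equations between arrows are proved this way.\<close>

lemma eq_by_lower:
  assumes "f \<in> arr Q X Y" "g \<in> arr Q X Y" "\<And>h. h \<in> arr Q X Y \<Longrightarrow> leq Q X Y h f \<longleftrightarrow> leq Q X Y h g"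
  shows "f = g"
  using assms leq_antisym leq_refl by blast

lemma complete_hom:
  assumes "X \<in> qob Q" "Y \<in> qob Q"
  shows "weak_complete_lattice (qhom Q X Y)"
  using hom_complete_lattice[OF assms] complete_lattice.axioms partial_order.axioms
  by (metis complete_lattice_axioms_def weak_complete_lattice.intro weak_complete_lattice_axioms.intro)

lemma join_arr [simp, intro]:
  assumes "X \<in> qob Q" "Y \<in> qob Q" "\<And>i. i \<in> I \<Longrightarrow> f i \<in> arr Q X Y"
  shows "qjoin Q X Y f I \<in> arr Q X Y"
  using weak_complete_lattice.sup_closed[OF complete_hom[OF assms(1,2)], of "f ` I"] assms
  by (auto simp: arr_def)

lemma join_leq_iff:
  assumes "h \<in> arr Q X Y" "\<And>i. i \<in> I \<Longrightarrow> f i \<in> arr Q X Y"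
  shows "leq Q X Y (qjoin Q X Y f I) h \<longleftrightarrow> (\<forall>i\<in>I. leq Q X Y (f i) h)"
proof -
  interpret weak_complete_lattice "qhom Q X Y"
    using assms(1) complete_hom arr_obD by metis
  have sub: "f ` I \<subseteq> carrier (qhom Q X Y)"
    using assms by (auto simp: arr_def)
  have J: "qjoin Q X Y f I \<in> arr Q X Y"
    using assms arr_obD[OF assms(1)] by (intro join_arr)
  have up: "leq Q X Y (f i) (qjoin Q X Y f I)" if "i \<in> I" for i
    by (rule leqI[OF assms(2)[OF that] J], rule sup_upper[OF sub]) (use that in blast)
  show ?thesis
  proof
    assume *: "\<forall>i\<in>I. leq Q X Y (f i) h"
    show "leq Q X Y (qjoin Q X Y f I) h"
      by (rule leqI[OF J assms(1)], rule sup_least)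
        (use * sub assms(1) in \<open>auto simp: leq_def arr_def Upper_def\<close>)
  qed (use up leq_trans in blast)
qed

lemma join_upper:
  assumes "i \<in> I" "\<And>i. i \<in> I \<Longrightarrow> f i \<in> arr Q X Y"
  shows "leq Q X Y (f i) (qjoin Q X Y f I)"
  using join_leq_iff[of "qjoin Q X Y f I" X Y I f] join_arr[of X Y I f] assms arr_obD by (meson leq_refl)

lemma meet_arr [simp, intro]:
  assumes "X \<in> qob Q" "Y \<in> qob Q" "\<And>i. i \<in> I \<Longrightarrow> f i \<in> arr Q X Y"
  shows "qmeet Q X Y f I \<in> arr Q X Y"
  using weak_complete_lattice.inf_closed[OF complete_hom[OF assms(1,2)], of "f ` I"] assms
  by (auto simp: arr_def)

lemma leq_meet_iff:
  assumes "h \<in> arr Q X Y" "\<And>i. i \<in> I \<Longrightarrow> f i \<in> arr Q X Y"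
  shows "leq Q X Y h (qmeet Q X Y f I) \<longleftrightarrow> (\<forall>i\<in>I. leq Q X Y h (f i))"
proof -
  interpret weak_complete_lattice "qhom Q X Y"
    using assms(1) complete_hom arr_obD by metis
  have sub: "f ` I \<subseteq> carrier (qhom Q X Y)"
    using assms by (auto simp: arr_def)
  have J: "qmeet Q X Y f I \<in> arr Q X Y"
    using assms arr_obD[OF assms(1)] by (intro meet_arr)
  have lo: "leq Q X Y (qmeet Q X Y f I) (f i)" if "i \<in> I" for i
    by (rule leqI[OF J assms(2)[OF that]], rule inf_lower[OF sub]) (use that in blast)
  show ?thesis
  proof
    assume *: "\<forall>i\<in>I. leq Q X Y h (f i)"
    show "leq Q X Y h (qmeet Q X Y f I)"
      by (rule leqI[OF assms(1) J], rule inf_greatest)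
        (use * sub assms(1) in \<open>auto simp: leq_def arr_def Lower_def\<close>)
  qed (use lo leq_trans in blast)
qed

section \<open>Composition, joins and residuals of arrows\<close>

lemma comp_join_left:
  assumes "f \<in> arr Q X Y" "\<And>i. i \<in> I \<Longrightarrow> g i \<in> arr Q Y Z" "Z \<in> qob Q"
  shows "qcomp Q X Y Z (qjoin Q Y Z g I) f = qjoin Q X Z (\<lambda>i. qcomp Q X Y Z (g i) f) I"
  using comp_Sup_left[of X Y Z f "g ` I"] assms by (auto simp: arr_def image_image)

lemma comp_join_right:
  assumes "g \<in> arr Q Y Z" "\<And>i. i \<in> I \<Longrightarrow> f i \<in> arr Q X Y" "X \<in> qob Q"
  shows "qcomp Q X Y Z g (qjoin Q X Y f I) = qjoin Q X Z (\<lambda>i. qcomp Q X Y Z g (f i)) I"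
  using comp_Sup_right[of X Y Z "f ` I" g] assms by (auto simp: arr_def image_image)

lemma comp_join_left_leq_iff:
  assumes "f \<in> arr Q X Y" "\<And>i. i \<in> I \<Longrightarrow> g i \<in> arr Q Y Z" "h \<in> arr Q X Z"
  shows "leq Q X Z (qcomp Q X Y Z (qjoin Q Y Z g I) f) h
     \<longleftrightarrow> (\<forall>i\<in>I. leq Q X Z (qcomp Q X Y Z (g i) f) h)"
  using assms arr_obD[OF assms(3)] by (subst comp_join_left) (auto simp: join_leq_iff)

lemma comp_join_right_leq_iff:
  assumes "g \<in> arr Q Y Z" "\<And>i. i \<in> I \<Longrightarrow> f i \<in> arr Q X Y" "h \<in> arr Q X Z"
  shows "leq Q X Z (qcomp Q X Y Z g (qjoin Q X Y f I)) h
     \<longleftrightarrow> (\<forall>i\<in>I. leq Q X Z (qcomp Q X Y Z g (f i)) h)"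
  using assms arr_obD[OF assms(3)] by (subst comp_join_right) (auto simp: join_leq_iff)

lemma join_pair:
  assumes "leq Q X Y f g"
  shows "\<Squnion>\<^bsub>qhom Q X Y\<^esub> {f, g} = g"
proof (rule leq_antisym)
  note ar = leq_arrD[OF assms]
  show "leq Q X Y (\<Squnion>\<^bsub>qhom Q X Y\<^esub> {f, g}) g"
    using join_leq_iff[of g X Y "{f, g}" "\<lambda>x. x"] ar assms by auto
  show "leq Q X Y g (\<Squnion>\<^bsub>qhom Q X Y\<^esub> {f, g})"
    using join_upper[of g "{f, g}" "\<lambda>x. x" X Y] ar by auto
qed

text \<open>Monotonicity is not an axiom of \<open>quantaloid\<close>: f \<le> f' says that f' is
  the join of the pair, and composition preserves that join in each variable.\<close>

lemma comp_mono:
  assumes "leq Q X Y f f'" "leq Q Y Z g g'"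
  shows "leq Q X Z (qcomp Q X Y Z g f) (qcomp Q X Y Z g' f')"
proof -
  note a = leq_arrD[OF assms(1)] leq_arrD[OF assms(2)]
  have f: "i \<in> arr Q X Y" if "i \<in> {f, f'}" for i using that a by auto
  have g: "i \<in> arr Q Y Z" if "i \<in> {g, g'}" for i using that a by auto
  have "leq Q X Z (qcomp Q X Y Z g f) (qjoin Q X Z (\<lambda>g. qcomp Q X Y Z g f) {g, g'})"
    by (rule join_upper[where f = "\<lambda>g. qcomp Q X Y Z g f"]) (use a g in auto)
  also have "\<dots> = qcomp Q X Y Z (qjoin Q Y Z (\<lambda>g. g) {g, g'}) f"
    by (rule comp_join_left[symmetric]) (use a g arr_obD(2)[OF a(3)] in auto)
  also have "\<dots> = qcomp Q X Y Z g' f"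
    by (simp add: join_pair[OF assms(2)])
  also have "leq Q X Z \<dots> (qjoin Q X Z (\<lambda>f. qcomp Q X Y Z g' f) {f, f'})"
    by (rule join_upper[where f = "\<lambda>f. qcomp Q X Y Z g' f"]) (use a f in auto)
  also have "\<dots> = qcomp Q X Y Z g' (qjoin Q X Y (\<lambda>f. f) {f, f'})"
    by (rule comp_join_right[symmetric]) (use a f arr_obD(1)[OF a(1)] in auto)
  also have "\<dots> = qcomp Q X Y Z g' f'"
    by (simp add: join_pair[OF assms(1)])
  finally show ?thesis .
qed

lemma comp_monoL: "\<lbrakk>f \<in> arr Q X Y; leq Q Y Z g g'\<rbrakk>
   \<Longrightarrow> leq Q X Z (qcomp Q X Y Z g f) (qcomp Q X Y Z g' f)"
  by (rule comp_mono) auto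

lemma comp_monoR: "\<lbrakk>leq Q X Y f f'; g \<in> arr Q Y Z\<rbrakk>
   \<Longrightarrow> leq Q X Z (qcomp Q X Y Z g f) (qcomp Q X Y Z g f')"
  by (rule comp_mono) auto

text \<open>The residual is the join of all \<open>g\<close> with g \<circ> f \<le> h; composition
  preserves this join, so the join is itself such a \<open>g\<close>. Uniqueness of the definite
  description is \<open>eq_by_lower\<close>.\<close>

lemma qext_spec:
  assumes "f \<in> arr Q X Y" "h \<in> arr Q X Z"
  shows "qext Q X Y Z h f \<in> arr Q Y Z \<and>
    (\<forall>g\<in>arr Q Y Z. leq Q X Z (qcomp Q X Y Z g f) h \<longleftrightarrow> leq Q Y Z g (qext Q X Y Z h f))"
proof -
  note ob = arr_obD[OF assms(1)] arr_obD[OF assms(2)]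
  define G where "G = {g \<in> arr Q Y Z. leq Q X Z (qcomp Q X Y Z g f) h}"
  define k where "k = qjoin Q Y Z (\<lambda>g. g) G"
  have k: "k \<in> arr Q Y Z"
    unfolding k_def using ob by (intro join_arr) (auto simp: G_def)
  have kf: "leq Q X Z (qcomp Q X Y Z k f) h"
    unfolding k_def using assms by (subst comp_join_left_leq_iff) (auto simp: G_def)
  have iff: "leq Q X Z (qcomp Q X Y Z g f) h \<longleftrightarrow> leq Q Y Z g k" if "g \<in> arr Q Y Z" for g
  proof
    show "leq Q X Z (qcomp Q X Y Z g f) h \<Longrightarrow> leq Q Y Z g k"
      unfolding k_def by (rule join_upper[where f = "\<lambda>g. g"]) (use that in \<open>auto simp: G_def\<close>)
    show "leq Q Y Z g k \<Longrightarrow> leq Q X Z (qcomp Q X Y Z g f) h"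
      by (rule leq_trans[OF comp_monoL[OF assms(1)] kf])
  qed
  have "qext Q X Y Z h f = k"
    unfolding qext_def
  proof (rule the_equality)
    show eq: "k \<in> carrier (qhom Q Y Z) \<and> (\<forall>g \<in> carrier (qhom Q Y Z).
         qcomp Q X Y Z g f \<sqsubseteq>\<^bsub>qhom Q X Z\<^esub> h \<longleftrightarrow> g \<sqsubseteq>\<^bsub>qhom Q Y Z\<^esub> k)"
      using k iff assms ob comp_closed[of X Y Z f] by (auto simp: leq_def arr_def)
    fix k'
    assume k': "k' \<in> carrier (qhom Q Y Z) \<and> (\<forall>g \<in> carrier (qhom Q Y Z).
         qcomp Q X Y Z g f \<sqsubseteq>\<^bsub>qhom Q X Z\<^esub> h \<longleftrightarrow> g \<sqsubseteq>\<^bsub>qhom Q Y Z\<^esub> k')"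
    have "k' \<in> arr Q Y Z" using k' ob by (simp add: arr_def)
    then show "k' = k"
      using k' eq k by (intro eq_by_lower[where X = Y and Y = Z]) (auto simp: leq_def arr_def)
  qed
  then show ?thesis using k iff by simp
qed

lemma qext_arr [simp, intro]:
  "\<lbrakk>f \<in> arr Q X Y; h \<in> arr Q X Z\<rbrakk> \<Longrightarrow> qext Q X Y Z h f \<in> arr Q Y Z"
  using qext_spec by blast

lemma leq_qext_iff:
  "\<lbrakk>f \<in> arr Q X Y; h \<in> arr Q X Z; g \<in> arr Q Y Z\<rbrakk>
   \<Longrightarrow> leq Q Y Z g (qext Q X Y Z h f) \<longleftrightarrow> leq Q X Z (qcomp Q X Y Z g f) h"
  using qext_spec by blast

end

subsection \<open>The opposite quantaloid\<close>

text \<open>Arrows are reversed but the hom-orders are kept, so joins remain joins and the two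
  residuals trade places.\<close>

definition qop :: "('o, 'a) quantaloid_data \<Rightarrow> ('o, 'a) quantaloid_data" where
  "qop Q = \<lparr>qob = qob Q, qhom = (\<lambda>X Y. qhom Q Y X),
            qcomp = (\<lambda>X Y Z g f. qcomp Q Z Y X f g), qid = qid Q\<rparr>"

lemma qop_simps [simp]:
  "qob (qop Q) = qob Q" "qhom (qop Q) X Y = qhom Q Y X"
  "qcomp (qop Q) X Y Z g f = qcomp Q Z Y X f g" "qid (qop Q) = qid Q"
  by (simp_all add: qop_def)

lemma arr_qop [simp]: "arr (qop Q) X Y = arr Q Y X"
  by (auto simp: arr_def)

lemma leq_qop [simp]: "leq (qop Q) X Y f g = leq Q Y X f g"
  by (auto simp: leq_def)

lemma qext_qop: "qext (qop Q) X Y Z h f = qlift Q Z Y X f h"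
  by (simp add: qext_def qlift_def)

lemma qlift_qop: "qlift (qop Q) X Y Z g h = qext Q Z Y X h g"
  by (simp add: qext_def qlift_def)

lemma (in quantaloid) quantaloid_qop: "quantaloid (qop Q)"
  by (rule quantaloid.intro)
    (simp_all add: hom_complete_lattice comp_closed id_closed comp_assoc comp_id_left comp_id_right
      comp_Sup_left comp_Sup_right)

text \<open>The same family \<open>d\<close> serves: the two dualizing laws trade places, and
  cyclicity is read from right to left.\<close>

lemma (in girard_quantaloid) girard_quantaloid_qop: "girard_quantaloid (qop Q) d"
proof -
  interpret op: quantaloid "qop Q" by (rule quantaloid_qop)
  show ?thesis
    by unfold_locales
      (simp_all add: qext_qop qlift_qop d_closed dualizing_left dualizing_right, simp add: cyclic)
qed

context quantaloid
begin

lemma qlift_arr [simp, intro]: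
  "\<lbrakk>g \<in> arr Q Y Z; h \<in> arr Q X Z\<rbrakk> \<Longrightarrow> qlift Q X Y Z g h \<in> arr Q X Y"
  using quantaloid.qext_arr[OF quantaloid_qop, of g Z Y h X] by (simp add: qext_qop)

lemma leq_qlift_iff:
  "\<lbrakk>g \<in> arr Q Y Z; h \<in> arr Q X Z; f \<in> arr Q X Y\<rbrakk>
   \<Longrightarrow> leq Q X Y f (qlift Q X Y Z g h) \<longleftrightarrow> leq Q X Z (qcomp Q X Y Z g f) h"
  using quantaloid.leq_qext_iff[OF quantaloid_qop, of g Z Y h X f] by (simp add: qext_qop)

end

subsection \<open>Negation in a Girard quantaloid\<close>

context girard_quantaloid
begin

definition neg :: "'o \<Rightarrow> 'o \<Rightarrow> 'a \<Rightarrow> 'a" where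
  "neg X Y f = qext Q X Y X (d X) f"

lemma d_arr [simp, intro]: "X \<in> qob Q \<Longrightarrow> d X \<in> arr Q X X"
  by (simp add: arr_def d_closed)

lemma neg_eq_qlift: "f \<in> arr Q X Y \<Longrightarrow> neg X Y f = qlift Q Y X Y f (d Y)"
  by (simp add: neg_def cyclic arr_def)

lemma neg_arr [simp, intro]: "f \<in> arr Q X Y \<Longrightarrow> neg X Y f \<in> arr Q Y X"
  using arr_obD[of f Q X Y] by (auto simp: neg_def)

lemma leq_neg_iff:
  "\<lbrakk>f \<in> arr Q X Y; g \<in> arr Q Y X\<rbrakk>
   \<Longrightarrow> leq Q Y X g (neg X Y f) \<longleftrightarrow> leq Q X X (qcomp Q X Y X g f) (d X)"
  using arr_obD[of f Q X Y] by (simp add: neg_def leq_qext_iff)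

lemma leq_neg_iff':
  "\<lbrakk>f \<in> arr Q X Y; g \<in> arr Q Y X\<rbrakk>
   \<Longrightarrow> leq Q Y X g (neg X Y f) \<longleftrightarrow> leq Q Y Y (qcomp Q Y X Y f g) (d Y)"
  using arr_obD[of f Q X Y] by (simp add: neg_eq_qlift leq_qlift_iff)

lemma neg_neg [simp]: "f \<in> arr Q X Y \<Longrightarrow> neg Y X (neg X Y f) = f"
  using arr_obD[of f Q X Y] dualizing_left[of X Y f]
  by (simp add: neg_eq_qlift[of "neg X Y f"]) (simp add: neg_def arr_def)

text \<open>Since g = \<not>\<not>g, every inequality turns into the statement that a composite lies
  below \<open>d\<close>.\<close>

lemma leq_iff_neg:
  assumes "f \<in> arr Q X Y" "g \<in> arr Q X Y"
  shows "leq Q X Y f g \<longleftrightarrow> leq Q X X (qcomp Q X Y X (neg X Y g) f) (d X)"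
  using leq_neg_iff'[of "neg X Y g" Y X f] assms by simp

lemma neg_leq_neg_iff:
  assumes "f \<in> arr Q X Y" "g \<in> arr Q X Y"
  shows "leq Q Y X (neg X Y g) (neg X Y f) \<longleftrightarrow> leq Q X Y f g"
  using leq_iff_neg assms leq_neg_iff by simp

lemma neg_leq_swap:
  assumes "f \<in> arr Q X Y" "g \<in> arr Q Y X"
  shows "leq Q Y X (neg X Y f) g \<longleftrightarrow> leq Q X Y (neg Y X g) f"
  using neg_leq_neg_iff[of "neg Y X g" X Y f] assms by auto

text \<open>The inequality \<open>g \<circ> f \<le> h\<close> amounts to \<open>\<not>h \<circ> g \<circ> f \<le> d\<close>, which may be rotated cyclically.\<close>

lemma comp_leq_iff_rotate:
  assumes "f \<in> arr Q X Y" "g \<in> arr Q Y Z" "h \<in> arr Q X Z"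
  shows "leq Q X Z (qcomp Q X Y Z g f) h
      \<longleftrightarrow> leq Q Y X (qcomp Q Y Z X (neg X Z h) g) (neg X Y f)"
  using assms by (simp add: leq_iff_neg[of _ X Z] leq_neg_iff assoc)

text \<open>One more turn of the same cycle, applied to \<open>g\<close>, \<open>neg X Z h\<close>
  and \<open>neg X Y f\<close>.\<close>

lemma comp_leq_iff_rotate':
  assumes "f \<in> arr Q X Y" "g \<in> arr Q Y Z" "h \<in> arr Q X Z"
  shows "leq Q X Z (qcomp Q X Y Z g f) h
      \<longleftrightarrow> leq Q Z Y (qcomp Q Z X Y f (neg X Z h)) (neg Y Z g)"
  using comp_leq_iff_rotate[OF assms] comp_leq_iff_rotate[of "g" Y Z "neg X Z h" X "neg X Y f"]
    assms by simp

end

section \<open>Categories over a quantaloid\<close>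

text \<open>Presheaves as bare families of arrows, without the \<open>unit\<close> argument and the
  convention on undefined values that distributors carry.\<close>

definition psh :: "('o, 'a) quantaloid_data \<Rightarrow> ('o, 'a, 'x) qcat \<Rightarrow> 'o \<Rightarrow> ('x \<Rightarrow> 'a) \<Rightarrow> bool" where
  "psh Q C X \<theta> \<longleftrightarrow> X \<in> qob Q \<and> (\<forall>x\<in>cob C. \<theta> x \<in> arr Q (ctyp C x) X) \<and>
    (\<forall>x\<in>cob C. \<forall>y\<in>cob C.
       leq Q (ctyp C x) X (qcomp Q (ctyp C x) (ctyp C y) X (\<theta> y) (chom C x y)) (\<theta> x))"

text \<open>The colimit weighted by \<open>\<theta>\<close>: C(s, y) is the residual of the
  representable presheaf at \<open>y\<close> by \<open>\<theta>\<close>, described by its lower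
  bounds \<open>h\<close>.\<close>

definition sup_of ::
    "('o, 'a) quantaloid_data \<Rightarrow> ('o, 'a, 'x) qcat \<Rightarrow> 'o \<Rightarrow> ('x \<Rightarrow> 'a) \<Rightarrow> 'x \<Rightarrow> bool" where
  "sup_of Q C X \<theta> s \<longleftrightarrow> s \<in> cob C \<and> ctyp C s = X \<and>
    (\<forall>y\<in>cob C. \<forall>h\<in>arr Q X (ctyp C y).
       leq Q X (ctyp C y) h (chom C s y) \<longleftrightarrow>
       (\<forall>x\<in>cob C. leq Q (ctyp C x) (ctyp C y) (qcomp Q (ctyp C x) X (ctyp C y) h (\<theta> x)) (chom C x y)))"

definition has_sups :: "('o, 'a) quantaloid_data \<Rightarrow> ('o, 'a, 'x) qcat \<Rightarrow> bool" where
  "has_sups Q C \<longleftrightarrow> (\<forall>X \<theta>. psh Q C X \<theta> \<longrightarrow> (\<exists>s. sup_of Q C X \<theta> s))"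

text \<open>\<open>t x\<close> is the presheaf of elements totally below \<open>x\<close>: the least presheaf whose supremum is
  above \<open>x\<close>.\<close>

definition has_approximation :: "('o, 'a) quantaloid_data \<Rightarrow> ('o, 'a, 'x) qcat \<Rightarrow> bool" where
  "has_approximation Q C \<longleftrightarrow> (\<exists>t. (\<forall>x\<in>cob C. psh Q C (ctyp C x) (t x)) \<and>
    (\<forall>X \<theta>. psh Q C X \<theta> \<longrightarrow> (\<exists>s. sup_of Q C X \<theta> s \<and>
      (\<forall>x\<in>cob C. \<forall>h\<in>arr Q (ctyp C x) X.
         leq Q (ctyp C x) X h (chom C x s) \<longleftrightarrow>
         (\<forall>y\<in>cob C. leq Q (ctyp C y) X (qcomp Q (ctyp C y) (ctyp C x) X h (t x y)) (\<theta> y))))))"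

text \<open>What it takes for \<open>P\<close> to serve as the presheaf category of
  \<open>C\<close>, with \<open>ev\<close> reading off entries. Such freedom is needed because the
  opposite of \<open>copresheaf Q C\<close> is not literally a presheaf category: its distributors
  have their arguments transposed.\<close>

definition represents_psh ::
    "('o, 'a) quantaloid_data \<Rightarrow> ('o, 'a, 'x) qcat \<Rightarrow> ('o, 'a, 'p) qcat \<Rightarrow> ('p \<Rightarrow> 'x \<Rightarrow> 'a) \<Rightarrow> bool" where
  "represents_psh Q C P ev \<longleftrightarrow>
    (\<forall>p\<in>cob P. psh Q C (ctyp P p) (ev p)) \<and>
    (\<forall>X \<theta>. psh Q C X \<theta> \<longrightarrow> (\<exists>p\<in>cob P. ctyp P p = X \<and> (\<forall>x\<in>cob C. ev p x = \<theta> x))) \<and>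
    (\<forall>p\<in>cob P. \<forall>p'\<in>cob P. chom P p p' \<in> arr Q (ctyp P p) (ctyp P p') \<and>
      (\<forall>h\<in>arr Q (ctyp P p) (ctyp P p').
         leq Q (ctyp P p) (ctyp P p') h (chom P p p') \<longleftrightarrow>
         (\<forall>x\<in>cob C. leq Q (ctyp C x) (ctyp P p')
            (qcomp Q (ctyp C x) (ctyp P p) (ctyp P p') h (ev p x)) (ev p' x))))"

lemma sup_ofD:
  assumes "sup_of Q C X \<theta> s"
  shows "s \<in> cob C" "ctyp C s = X"
    "\<lbrakk>y \<in> cob C; h \<in> arr Q X (ctyp C y)\<rbrakk> \<Longrightarrow> leq Q X (ctyp C y) h (chom C s y) \<longleftrightarrow>
       (\<forall>x\<in>cob C. leq Q (ctyp C x) (ctyp C y) (qcomp Q (ctyp C x) X (ctyp C y) h (\<theta> x)) (chom C x y))"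
  using assms by (auto simp: sup_of_def)

lemma pshD:
  assumes "psh Q C X \<theta>"
  shows "X \<in> qob Q" "x \<in> cob C \<Longrightarrow> \<theta> x \<in> arr Q (ctyp C x) X"
    "\<lbrakk>x \<in> cob C; y \<in> cob C\<rbrakk>
     \<Longrightarrow> leq Q (ctyp C x) X (qcomp Q (ctyp C x) (ctyp C y) X (\<theta> y) (chom C x y)) (\<theta> x)"
  using assms by (auto simp: psh_def)

lemma sup_of_cong:
  assumes "\<And>x. x \<in> cob C \<Longrightarrow> \<theta> x = \<theta>' x"
  shows "sup_of Q C X \<theta> s \<longleftrightarrow> sup_of Q C X \<theta>' s"
  using assms by (simp add: sup_of_def cong: ball_cong)

locale qcategory = quantaloid Q for Q :: "('o, 'a) quantaloid_data" +
  fixes C :: "('o, 'a, 'x) qcat"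
  assumes qcat: "is_qcat Q C"
begin

lemma typ_ob [simp, intro]: "x \<in> cob C \<Longrightarrow> ctyp C x \<in> qob Q"
  using qcat by (auto simp: is_qcat_def)

lemma hom_arr [simp, intro]:
  "\<lbrakk>x \<in> cob C; y \<in> cob C\<rbrakk> \<Longrightarrow> chom C x y \<in> arr Q (ctyp C x) (ctyp C y)"
  using qcat by (auto simp: is_qcat_def arr_def)

lemma hom_id: "x \<in> cob C \<Longrightarrow> leq Q (ctyp C x) (ctyp C x) (qid Q (ctyp C x)) (chom C x x)"
  by (rule leqI) (use qcat in \<open>auto simp: is_qcat_def\<close>)

lemma hom_comp: "\<lbrakk>x \<in> cob C; y \<in> cob C; z \<in> cob C\<rbrakk> \<Longrightarrow> leq Q (ctyp C x) (ctyp C z)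
    (qcomp Q (ctyp C x) (ctyp C y) (ctyp C z) (chom C y z) (chom C x y)) (chom C x z)"
  by (rule leqI) (use qcat in \<open>auto simp: is_qcat_def\<close>)

lemma leq_comp_hom:
  assumes "x \<in> cob C" "f \<in> arr Q (ctyp C x) Y"
  shows "leq Q (ctyp C x) Y f (qcomp Q (ctyp C x) (ctyp C x) Y f (chom C x x))"
  using comp_monoR[OF hom_id[OF assms(1)] assms(2)] assms(2) by simp

lemma leq_hom_comp:
  assumes "x \<in> cob C" "f \<in> arr Q X (ctyp C x)"
  shows "leq Q X (ctyp C x) f (qcomp Q X (ctyp C x) (ctyp C x) (chom C x x) f)"
  using comp_monoL[OF assms(2) hom_id[OF assms(1)]] assms(2) by simp

lemma leq_of_id_leq:
  assumes "x \<in> cob C" "g \<in> arr Q X (ctyp C x)" "f \<in> arr Q (ctyp C x) Y" "k \<in> arr Q X Y"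
    and "leq Q X Y (qcomp Q X (ctyp C x) Y (qcomp Q (ctyp C x) (ctyp C x) Y f (chom C x x)) g) k"
  shows "leq Q X Y (qcomp Q X (ctyp C x) Y f g) k"
  using comp_monoL[OF assms(2) leq_comp_hom[OF assms(1,3)]] assms(5) leq_trans by blast

end

section \<open>Adjunctions, and categories that represent presheaves\<close>

lemma (in quantaloid) is_qcatI:
  assumes "\<And>x. x \<in> cob P \<Longrightarrow> ctyp P x \<in> qob Q"
    and "\<And>x y. \<lbrakk>x \<in> cob P; y \<in> cob P\<rbrakk> \<Longrightarrow> chom P x y \<in> arr Q (ctyp P x) (ctyp P y)"
    and "\<And>x. x \<in> cob P \<Longrightarrow> leq Q (ctyp P x) (ctyp P x) (qid Q (ctyp P x)) (chom P x x)"
    and "\<And>x y z. \<lbrakk>x \<in> cob P; y \<in> cob P; z \<in> cob P\<rbrakk> \<Longrightarrow> leq Q (ctyp P x) (ctyp P z)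
      (qcomp Q (ctyp P x) (ctyp P y) (ctyp P z) (chom P y z) (chom P x y)) (chom P x z)"
  shows "is_qcat Q P"
  using assms by (auto simp: is_qcat_def arr_def leq_def)

text \<open>The exchange between unit and counit on one side and equality of homs on the other. The
  right-hand side does not mention functoriality: that F and G preserve homs follows from the
  equality of homs together with the unit and counit derived from it.\<close>

lemma (in quantaloid) qadjoint_iff:
  assumes "is_qcat Q A" "is_qcat Q B"
  shows "qadjoint Q A B F G \<longleftrightarrow>
    (\<forall>x\<in>cob A. F x \<in> cob B \<and> ctyp B (F x) = ctyp A x) \<and>
    (\<forall>y\<in>cob B. G y \<in> cob A \<and> ctyp A (G y) = ctyp B y) \<and>
    (\<forall>x\<in>cob A. \<forall>y\<in>cob B. chom B (F x) y = chom A x (G y))" (is "?adj \<longleftrightarrow> ?iso")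
proof
  interpret A: qcategory Q A by unfold_locales fact
  interpret B: qcategory Q B by unfold_locales fact
  {
    assume ?adj
    then have F: "F x \<in> cob B" "ctyp B (F x) = ctyp A x" if "x \<in> cob A" for x
      using that by (auto simp: qadjoint_def is_qfunctor_def)
    have G: "G y \<in> cob A" "ctyp A (G y) = ctyp B y" if "y \<in> cob B" for y
      using that \<open>?adj\<close> by (auto simp: qadjoint_def is_qfunctor_def)
    have Fh: "leq Q (ctyp A x) (ctyp A x') (chom A x x') (chom B (F x) (F x'))"
      if "x \<in> cob A" "x' \<in> cob A" for x x'
      using that \<open>?adj\<close> B.hom_arr[of "F x" "F x'"] F
      by (intro leqI) (auto simp: qadjoint_def is_qfunctor_def)
    have Gh: "leq Q (ctyp B y) (ctyp B y') (chom B y y') (chom A (G y) (G y'))"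
      if "y \<in> cob B" "y' \<in> cob B" for y y'
      using that \<open>?adj\<close> A.hom_arr[of "G y" "G y'"] G
      by (intro leqI) (auto simp: qadjoint_def is_qfunctor_def)
    have unit: "leq Q (ctyp A x) (ctyp A x) (qid Q (ctyp A x)) (chom A x (G (F x)))"
      if "x \<in> cob A" for x
      using that \<open>?adj\<close> A.hom_arr[of x "G (F x)"] F G
      by (intro leqI) (auto simp: qadjoint_def qfunctor_le_def cle_def)
    have counit: "leq Q (ctyp B y) (ctyp B y) (qid Q (ctyp B y)) (chom B (F (G y)) y)"
      if "y \<in> cob B" for y
      using that \<open>?adj\<close> B.hom_arr[of "F (G y)" y] F G
      by (intro leqI) (auto simp: qadjoint_def qfunctor_le_def cle_def)
    have "chom B (F x) y = chom A x (G y)" if x: "x \<in> cob A" and y: "y \<in> cob B" for x y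
    proof (rule leq_antisym)
      note c = F[OF x] G[OF y] F(1)[OF G(1)[OF y]] G(1)[OF F(1)[OF x]]
        F(2)[OF G(1)[OF y]] G(2)[OF F(1)[OF x]]
      have a: "chom B (F x) y \<in> arr Q (ctyp A x) (ctyp B y)" "chom A x (G y) \<in> arr Q (ctyp A x) (ctyp B y)"
        using B.hom_arr[of "F x" y] A.hom_arr[of x "G y"] c x y by auto
      have "leq Q (ctyp A x) (ctyp B y) (chom B (F x) y)
          (qcomp Q (ctyp A x) (ctyp A x) (ctyp B y) (chom A (G (F x)) (G y)) (chom A x (G (F x))))"
        using comp_mono[OF unit[OF x] Gh[OF c(1) y, unfolded c]] a by simp
      also have "leq Q (ctyp A x) (ctyp B y) \<dots> (chom A x (G y))"
        using A.hom_comp[OF x c(6) c(3)] c by simp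
      finally show "leq Q (ctyp A x) (ctyp B y) (chom B (F x) y) (chom A x (G y))" .
      have "leq Q (ctyp A x) (ctyp B y) (chom A x (G y))
          (qcomp Q (ctyp A x) (ctyp B y) (ctyp B y) (chom B (F (G y)) y) (chom B (F x) (F (G y))))"
        using comp_mono[OF Fh[OF x c(3), unfolded c] counit[OF y]] a by simp
      also have "leq Q (ctyp A x) (ctyp B y) \<dots> (chom B (F x) y)"
        using B.hom_comp[OF c(1) c(5) y] c by simp
      finally show "leq Q (ctyp A x) (ctyp B y) (chom A x (G y)) (chom B (F x) y)" .
    qed
    with F G show ?iso by blast
  }
  {
    assume ?iso
    then have F: "F x \<in> cob B" "ctyp B (F x) = ctyp A x" if "x \<in> cob A" for x
      using that by auto
    have G: "G y \<in> cob A" "ctyp A (G y) = ctyp B y" if "y \<in> cob B" for y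
      using that \<open>?iso\<close> by auto
    have iso: "chom B (F x) y = chom A x (G y)" if "x \<in> cob A" "y \<in> cob B" for x y
      using that \<open>?iso\<close> by auto
    have unit: "leq Q (ctyp A x) (ctyp A x) (qid Q (ctyp A x)) (chom A x (G (F x)))"
      if "x \<in> cob A" for x
      using B.hom_id[OF F(1)[OF that]] that F iso by simp
    have counit: "leq Q (ctyp B y) (ctyp B y) (qid Q (ctyp B y)) (chom B (F (G y)) y)"
      if "y \<in> cob B" for y
      using A.hom_id[OF G(1)[OF that]] that G iso by simp
    have Fh: "leq Q (ctyp A x) (ctyp A x') (chom A x x') (chom B (F x) (F x'))"
      if x: "x \<in> cob A" "x' \<in> cob A" for x x'
    proof -
      have "leq Q (ctyp A x) (ctyp A x') (chom A x x')
        (qcomp Q (ctyp A x) (ctyp A x') (ctyp A x') (chom A x' (G (F x'))) (chom A x x'))"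
        using comp_monoL[OF A.hom_arr[OF x] unit[OF x(2)]] A.hom_arr[OF x] by simp
      also have "leq Q (ctyp A x) (ctyp A x') \<dots> (chom A x (G (F x')))"
        using A.hom_comp[OF x G(1)[OF F(1)[OF x(2)]]] F G x by simp
      finally show ?thesis using iso F x by simp
    qed
    have Gh: "leq Q (ctyp B y) (ctyp B y') (chom B y y') (chom A (G y) (G y'))"
      if y: "y \<in> cob B" "y' \<in> cob B" for y y'
    proof -
      have "leq Q (ctyp B y) (ctyp B y') (chom B y y')
        (qcomp Q (ctyp B y) (ctyp B y) (ctyp B y') (chom B y y') (chom B (F (G y)) y))"
        using comp_monoR[OF counit[OF y(1)] B.hom_arr[OF y]] B.hom_arr[OF y] by simp
      also have "leq Q (ctyp B y) (ctyp B y') \<dots> (chom B (F (G y)) y')"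
        using B.hom_comp[OF F(1)[OF G(1)[OF y(1)]] y] F G y by simp
      finally show ?thesis using iso G y by simp
    qed
    show ?adj
      using F G unit counit Fh Gh
      by (auto simp: qadjoint_def is_qfunctor_def qfunctor_le_def cle_def leq_def)
  }
qed

lemma (in quantaloid) represents_psh_is_qcat:
  assumes R: "represents_psh Q C P ev"
  shows "is_qcat Q P"
proof (rule is_qcatI)
  have ev: "psh Q C (ctyp P p) (ev p)" if "p \<in> cob P" for p
    using R that by (auto simp: represents_psh_def)
  have arr: "chom P p p' \<in> arr Q (ctyp P p) (ctyp P p')" if "p \<in> cob P" "p' \<in> cob P" for p p'
    using R that by (auto simp: represents_psh_def)
  have hom: "leq Q (ctyp P p) (ctyp P p') h (chom P p p') \<longleftrightarrow>
         (\<forall>x\<in>cob C. leq Q (ctyp C x) (ctyp P p')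
            (qcomp Q (ctyp C x) (ctyp P p) (ctyp P p') h (ev p x)) (ev p' x))"
    if "p \<in> cob P" "p' \<in> cob P" "h \<in> arr Q (ctyp P p) (ctyp P p')" for p p' h
    using R that by (auto simp: represents_psh_def)
  fix x y z
  assume x: "x \<in> cob P"
  show "ctyp P x \<in> qob Q" using pshD(1)[OF ev[OF x]] .
  then show "leq Q (ctyp P x) (ctyp P x) (qid Q (ctyp P x)) (chom P x x)"
    using hom[OF x x, of "qid Q (ctyp P x)"] pshD(2)[OF ev[OF x]] by auto
  assume y: "y \<in> cob P"
  show "chom P x y \<in> arr Q (ctyp P x) (ctyp P y)" using arr x y by simp
  assume z: "z \<in> cob P"
  have "leq Q (ctyp C c) (ctyp P z) (qcomp Q (ctyp C c) (ctyp P x) (ctyp P z)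
      (qcomp Q (ctyp P x) (ctyp P y) (ctyp P z) (chom P y z) (chom P x y)) (ev x c)) (ev z c)"
    if c: "c \<in> cob C" for c
  proof -
    have "leq Q (ctyp C c) (ctyp P y) (qcomp Q (ctyp C c) (ctyp P x) (ctyp P y) (chom P x y) (ev x c)) (ev y c)"
      using hom[OF x y arr[OF x y]] arr[OF x y] c by auto
    from comp_monoR[OF this arr[OF y z]]
    have "leq Q (ctyp C c) (ctyp P z) (qcomp Q (ctyp C c) (ctyp P x) (ctyp P z)
      (qcomp Q (ctyp P x) (ctyp P y) (ctyp P z) (chom P y z) (chom P x y)) (ev x c))
      (qcomp Q (ctyp C c) (ctyp P y) (ctyp P z) (chom P y z) (ev y c))"
      using assoc[OF pshD(2)[OF ev[OF x] c] arr[OF x y] arr[OF y z]] by simp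
    also have "leq Q (ctyp C c) (ctyp P z) \<dots> (ev z c)"
      using hom[OF y z arr[OF y z]] arr[OF y z] c by auto
    finally show ?thesis .
  qed
  then show "leq Q (ctyp P x) (ctyp P z)
      (qcomp Q (ctyp P x) (ctyp P y) (ctyp P z) (chom P y z) (chom P x y)) (chom P x z)"
    using hom[OF x z] comp_arr[OF arr[OF x y] arr[OF y z]] by blast
qed

text \<open>Instantiated twice: with the presheaves on \<open>C\<close>, and over
  \<open>qop Q\<close> with the opposite of the copresheaf category. \<open>Y\<close> plays the
  Yoneda embedding.\<close>

locale psh_category = qcategory Q C
  for Q :: "('o, 'a) quantaloid_data" and C :: "('o, 'a, 'x) qcat" +
  fixes P :: "('o, 'a, 'p) qcat" and ev :: "'p \<Rightarrow> 'x \<Rightarrow> 'a" and Y :: "'x \<Rightarrow> 'p"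
  assumes rep: "represents_psh Q C P ev"
    and Y: "\<And>y. y \<in> cob C \<Longrightarrow> Y y \<in> cob P" "\<And>y. y \<in> cob C \<Longrightarrow> ctyp P (Y y) = ctyp C y"
      "\<And>x y. \<lbrakk>x \<in> cob C; y \<in> cob C\<rbrakk> \<Longrightarrow> ev (Y y) x = chom C x y"
begin

lemma psh_ev: "p \<in> cob P \<Longrightarrow> psh Q C (ctyp P p) (ev p)"
  using rep by (auto simp: represents_psh_def)

lemma psh_rep: "psh Q C X \<theta> \<Longrightarrow> \<exists>p\<in>cob P. ctyp P p = X \<and> (\<forall>x\<in>cob C. ev p x = \<theta> x)"
  using rep by (auto simp: represents_psh_def)

lemma leq_homP_iff:
  assumes "p \<in> cob P" "p' \<in> cob P" "h \<in> arr Q (ctyp P p) (ctyp P p')"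
  shows "leq Q (ctyp P p) (ctyp P p') h (chom P p p') \<longleftrightarrow>
         (\<forall>x\<in>cob C. leq Q (ctyp C x) (ctyp P p')
            (qcomp Q (ctyp C x) (ctyp P p) (ctyp P p') h (ev p x)) (ev p' x))"
  using rep assms by (auto simp: represents_psh_def)

sublocale P: qcategory Q P
  by unfold_locales (rule represents_psh_is_qcat[OF rep])

text \<open>As \<open>ev (Y y)\<close> is the representable presheaf at \<open>y\<close>, the lower
  bounds of P(p, Y y) are exactly those in the definition of \<open>sup_of\<close>. A left adjoint
  of \<open>Y\<close> is therefore nothing but a choice of suprema.\<close>

lemma qadjoint_Y_iff:
  "qadjoint Q P C S Y \<longleftrightarrow> (\<forall>p\<in>cob P. sup_of Q C (ctyp P p) (ev p) (S p))" (is "?adj \<longleftrightarrow> ?sup")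
proof
  assume ?adj
  then have S: "S p \<in> cob C" "ctyp C (S p) = ctyp P p"
    and iso: "y \<in> cob C \<Longrightarrow> chom C (S p) y = chom P p (Y y)" if "p \<in> cob P" for p y
    using that by (auto simp: qadjoint_iff[OF P.qcat qcat])
  show ?sup
    unfolding sup_of_def
  proof (intro ballI conjI)
    fix p y h
    assume p: "p \<in> cob P" and y: "y \<in> cob C" and h: "h \<in> arr Q (ctyp P p) (ctyp C y)"
    show "leq Q (ctyp P p) (ctyp C y) h (chom C (S p) y) \<longleftrightarrow>
       (\<forall>x\<in>cob C. leq Q (ctyp C x) (ctyp C y)
          (qcomp Q (ctyp C x) (ctyp P p) (ctyp C y) h (ev p x)) (chom C x y))"
      using leq_homP_iff[of p "Y y" h] p y h Y iso by simp
  qed (use S in auto)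
next
  assume ?sup
  then have S: "S p \<in> cob C" "ctyp C (S p) = ctyp P p" if "p \<in> cob P" for p
    using that by (auto simp: sup_of_def)
  have "chom C (S p) y = chom P p (Y y)" if p: "p \<in> cob P" and y: "y \<in> cob C" for p y
  proof (rule eq_by_lower)
    show "chom C (S p) y \<in> arr Q (ctyp P p) (ctyp C y)"
      using hom_arr[of "S p" y] S[OF p] y by simp
    show "chom P p (Y y) \<in> arr Q (ctyp P p) (ctyp C y)"
      using P.hom_arr[of p "Y y"] p y Y by simp
    show "leq Q (ctyp P p) (ctyp C y) h (chom C (S p) y) \<longleftrightarrow> leq Q (ctyp P p) (ctyp C y) h (chom P p (Y y))"
      if "h \<in> arr Q (ctyp P p) (ctyp C y)" for h
      using \<open>?sup\<close> leq_homP_iff[of p "Y y" h] p y Y that by (simp add: sup_of_def)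
  qed
  with S Y show ?adj by (simp add: qadjoint_iff[OF P.qcat qcat])
qed

lemma ex_qadjoint_Y_iff: "(\<exists>S. qadjoint Q P C S Y) \<longleftrightarrow> has_sups Q C"
proof
  assume "\<exists>S. qadjoint Q P C S Y"
  then obtain S where S: "\<And>p. p \<in> cob P \<Longrightarrow> sup_of Q C (ctyp P p) (ev p) (S p)"
    by (auto simp: qadjoint_Y_iff)
  show "has_sups Q C"
    unfolding has_sups_def
  proof (intro allI impI)
    fix X \<theta> assume "psh Q C X \<theta>"
    then obtain p where "p \<in> cob P" "ctyp P p = X" "\<forall>x\<in>cob C. ev p x = \<theta> x"
      using psh_rep by blast
    then show "\<exists>s. sup_of Q C X \<theta> s"
      using S[of p] sup_of_cong[of C "ev p" \<theta> Q X "S p"] by auto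
  qed
next
  assume "has_sups Q C"
  then have "\<forall>p\<in>cob P. \<exists>s. sup_of Q C (ctyp P p) (ev p) s"
    using psh_ev by (auto simp: has_sups_def)
  then show "\<exists>S. qadjoint Q P C S Y"
    unfolding qadjoint_Y_iff by (rule bchoice)
qed

text \<open>Both sides express P(T x, p) = C(x, S p), read through lower bounds.
  \<open>has_approximation\<close> supplies its witnesses one presheaf and one element at a time, so
  \<open>S\<close> and \<open>T\<close> are recovered by choice.\<close>

lemma ex_qadjoint_triple_iff:
  "(\<exists>S T. qadjoint Q P C S Y \<and> qadjoint Q C P T S) \<longleftrightarrow> has_approximation Q C"
proof
  assume "\<exists>S T. qadjoint Q P C S Y \<and> qadjoint Q C P T S"
  then obtain S T where S: "\<And>p. p \<in> cob P \<Longrightarrow> sup_of Q C (ctyp P p) (ev p) (S p)"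
    and T: "\<And>x. x \<in> cob C \<Longrightarrow> T x \<in> cob P" "\<And>x. x \<in> cob C \<Longrightarrow> ctyp P (T x) = ctyp C x"
    and iso: "\<And>x p. \<lbrakk>x \<in> cob C; p \<in> cob P\<rbrakk> \<Longrightarrow> chom P (T x) p = chom C x (S p)"
    unfolding qadjoint_Y_iff qadjoint_iff[OF qcat P.qcat] by blast
  show "has_approximation Q C"
    unfolding has_approximation_def
  proof (intro exI[of _ "\<lambda>x. ev (T x)"] conjI ballI allI impI)
    show "psh Q C (ctyp C x) (ev (T x))" if "x \<in> cob C" for x
      using psh_ev[of "T x"] T that by simp
    fix X \<theta> assume "psh Q C X \<theta>"
    then obtain p where p: "p \<in> cob P" "ctyp P p = X" "\<forall>x\<in>cob C. ev p x = \<theta> x"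
      using psh_rep by blast
    have "leq Q (ctyp C x) X h (chom C x (S p)) \<longleftrightarrow>
         (\<forall>y\<in>cob C. leq Q (ctyp C y) X (qcomp Q (ctyp C y) (ctyp C x) X h (ev (T x) y)) (\<theta> y))"
      if "x \<in> cob C" "h \<in> arr Q (ctyp C x) X" for x h
      using leq_homP_iff[of "T x" p h] p that T iso[of x p] by simp
    moreover have "sup_of Q C X \<theta> (S p)"
      using S[of p] sup_of_cong[of C "ev p" \<theta> Q X "S p"] p by auto
    ultimately show "\<exists>s. sup_of Q C X \<theta> s \<and>
      (\<forall>x\<in>cob C. \<forall>h\<in>arr Q (ctyp C x) X. leq Q (ctyp C x) X h (chom C x s) \<longleftrightarrow>
         (\<forall>y\<in>cob C. leq Q (ctyp C y) X (qcomp Q (ctyp C y) (ctyp C x) X h (ev (T x) y)) (\<theta> y)))"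
      by blast
  qed
next
  assume "has_approximation Q C"
  then obtain t where t: "\<And>x. x \<in> cob C \<Longrightarrow> psh Q C (ctyp C x) (t x)"
    and tS: "\<And>X \<theta>. psh Q C X \<theta> \<Longrightarrow> \<exists>s. sup_of Q C X \<theta> s \<and>
      (\<forall>x\<in>cob C. \<forall>h\<in>arr Q (ctyp C x) X. leq Q (ctyp C x) X h (chom C x s) \<longleftrightarrow>
         (\<forall>y\<in>cob C. leq Q (ctyp C y) X (qcomp Q (ctyp C y) (ctyp C x) X h (t x y)) (\<theta> y)))"
    unfolding has_approximation_def by blast
  have "\<forall>x\<in>cob C. \<exists>p. p \<in> cob P \<and> ctyp P p = ctyp C x \<and> (\<forall>y\<in>cob C. ev p y = t x y)"
    using t psh_rep by blast
  from bchoice[OF this] obtain T where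
    T: "\<And>x. x \<in> cob C \<Longrightarrow> T x \<in> cob P \<and> ctyp P (T x) = ctyp C x \<and> (\<forall>y\<in>cob C. ev (T x) y = t x y)"
    by blast
  have "\<forall>p\<in>cob P. \<exists>s. sup_of Q C (ctyp P p) (ev p) s \<and>
      (\<forall>x\<in>cob C. \<forall>h\<in>arr Q (ctyp C x) (ctyp P p). leq Q (ctyp C x) (ctyp P p) h (chom C x s) \<longleftrightarrow>
         (\<forall>y\<in>cob C. leq Q (ctyp C y) (ctyp P p) (qcomp Q (ctyp C y) (ctyp C x) (ctyp P p) h (t x y)) (ev p y)))"
    using tS psh_ev by blast
  from bchoice[OF this] obtain S where S: "\<And>p. p \<in> cob P \<Longrightarrow> sup_of Q C (ctyp P p) (ev p) (S p)"
    and iff: "\<And>p x h. \<lbrakk>p \<in> cob P; x \<in> cob C; h \<in> arr Q (ctyp C x) (ctyp P p)\<rbrakk>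
      \<Longrightarrow> leq Q (ctyp C x) (ctyp P p) h (chom C x (S p)) \<longleftrightarrow>
         (\<forall>y\<in>cob C. leq Q (ctyp C y) (ctyp P p) (qcomp Q (ctyp C y) (ctyp C x) (ctyp P p) h (t x y)) (ev p y))"
    by blast
  have Sc: "S p \<in> cob C" "ctyp C (S p) = ctyp P p" if "p \<in> cob P" for p
    using S[OF that] by (auto simp: sup_of_def)
  have iso: "chom P (T x) p = chom C x (S p)" if x: "x \<in> cob C" and p: "p \<in> cob P" for x p
  proof (rule eq_by_lower)
    show "chom P (T x) p \<in> arr Q (ctyp C x) (ctyp P p)"
      using P.hom_arr[of "T x" p] T[OF x] p by simp
    show "chom C x (S p) \<in> arr Q (ctyp C x) (ctyp P p)"
      using hom_arr[of x "S p"] Sc[OF p] x by simp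
    show "leq Q (ctyp C x) (ctyp P p) h (chom P (T x) p) \<longleftrightarrow> leq Q (ctyp C x) (ctyp P p) h (chom C x (S p))"
      if "h \<in> arr Q (ctyp C x) (ctyp P p)" for h
      using leq_homP_iff[of "T x" p h] T[OF x] iff[OF p x that] p that by simp
  qed
  have "qadjoint Q C P T S"
    using T Sc iso by (simp add: qadjoint_iff[OF qcat P.qcat])
  with S show "\<exists>S T. qadjoint Q P C S Y \<and> qadjoint Q C P T S"
    by (auto simp: qadjoint_Y_iff)
qed

end

section \<open>Categories generated by a family of arrows\<close>

text \<open>The equation \<phi> = \<phi> \<circ> \<psi> \<circ> \<phi> for bare families, with the
  join replaced by its upper bounds \<open>k\<close>. Testing against chosen values of
  \<open>k\<close> gives either of the two inequalities.\<close>

definition regular_family ::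
    "('o, 'a) quantaloid_data \<Rightarrow> 'i set \<Rightarrow> ('i \<Rightarrow> 'o) \<Rightarrow> 'j set \<Rightarrow> ('j \<Rightarrow> 'o) \<Rightarrow> ('i \<Rightarrow> 'j \<Rightarrow> 'a) \<Rightarrow> bool" where
  "regular_family Q I u J v \<phi> \<longleftrightarrow> (\<exists>\<psi>. (\<forall>j\<in>J. \<forall>i\<in>I. \<psi> j i \<in> arr Q (v j) (u i)) \<and>
    (\<forall>i\<in>I. \<forall>j\<in>J. \<forall>k\<in>arr Q (u i) (v j). leq Q (u i) (v j) (\<phi> i j) k \<longleftrightarrow>
      (\<forall>i'\<in>I. \<forall>j'\<in>J. leq Q (u i) (v j)
        (qcomp Q (u i) (v j') (v j) (qcomp Q (v j') (u i') (v j) (\<phi> i' j) (\<psi> j' i')) (\<phi> i j')) k)))"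

text \<open>The hypotheses below are invariant under passing to opposites and exchanging \<open>p\<close> with \<open>q\<close>
  and \<open>I\<close> with \<open>J\<close>.\<close>

locale generated_category = girard_quantaloid Q d + qcategory Q C
  for Q :: "('o, 'a) quantaloid_data" and d :: "'o \<Rightarrow> 'a" and C :: "('o, 'a, 'x) qcat" +
  fixes I :: "'i set" and J :: "'j set" and q :: "'i \<Rightarrow> 'x" and p :: "'j \<Rightarrow> 'x"
    and \<phi> :: "'i \<Rightarrow> 'j \<Rightarrow> 'a"
  assumes q_ob [simp, intro]: "i \<in> I \<Longrightarrow> q i \<in> cob C"
    and p_ob [simp, intro]: "j \<in> J \<Longrightarrow> p j \<in> cob C"
    and phi_arr [simp, intro]: "\<lbrakk>i \<in> I; j \<in> J\<rbrakk> \<Longrightarrow> \<phi> i j \<in> arr Q (ctyp C (q i)) (ctyp C (p j))"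
    and hom_p_q: "\<lbrakk>i \<in> I; j \<in> J\<rbrakk> \<Longrightarrow> chom C (p j) (q i) = neg (ctyp C (q i)) (ctyp C (p j)) (\<phi> i j)"
    and p_dense: "\<lbrakk>x \<in> cob C; y \<in> cob C; h \<in> arr Q (ctyp C x) (ctyp C y);
      \<And>j. j \<in> J \<Longrightarrow> leq Q (ctyp C (p j)) (ctyp C y)
        (qcomp Q (ctyp C (p j)) (ctyp C x) (ctyp C y) h (chom C (p j) x)) (chom C (p j) y)\<rbrakk>
      \<Longrightarrow> leq Q (ctyp C x) (ctyp C y) h (chom C x y)"
    and q_dense: "\<lbrakk>x \<in> cob C; y \<in> cob C; h \<in> arr Q (ctyp C x) (ctyp C y);
      \<And>i. i \<in> I \<Longrightarrow> leq Q (ctyp C x) (ctyp C (q i))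
        (qcomp Q (ctyp C x) (ctyp C y) (ctyp C (q i)) (chom C y (q i)) h) (chom C x (q i))\<rbrakk>
      \<Longrightarrow> leq Q (ctyp C x) (ctyp C y) h (chom C x y)"
    and sups: "has_sups Q C"
begin

abbreviation ty :: "'x \<Rightarrow> 'o" where "ty \<equiv> ctyp C"
abbreviation hm :: "'x \<Rightarrow> 'x \<Rightarrow> 'a" where "hm \<equiv> chom C"
abbreviation u :: "'i \<Rightarrow> 'o" where "u i \<equiv> ctyp C (q i)"
abbreviation v :: "'j \<Rightarrow> 'o" where "v j \<equiv> ctyp C (p j)"

text \<open>For \<open>C = \<K>\<phi>\<close> this is the presheaf \<open>\<phi>\<^sup>*x\<close>.\<close>

definition hat :: "'x \<Rightarrow> 'i \<Rightarrow> 'a" where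
  "hat x i = neg (ty x) (u i) (hm x (q i))"

section \<open>The arrows \<open>hat x i\<close> and their behaviour under suprema\<close>

lemma hat_arr [simp, intro]: "\<lbrakk>x \<in> cob C; i \<in> I\<rbrakk> \<Longrightarrow> hat x i \<in> arr Q (u i) (ty x)"
  by (auto simp: hat_def)

lemma hat_p: "\<lbrakk>i \<in> I; j \<in> J\<rbrakk> \<Longrightarrow> hat (p j) i = \<phi> i j"
  by (simp add: hat_def hom_p_q)

lemma comp_hom_q_leq_iff:
  assumes "x \<in> cob C" "y \<in> cob C" "i \<in> I" "h \<in> arr Q (ty x) (ty y)"
  shows "leq Q (ty x) (u i) (qcomp Q (ty x) (ty y) (u i) (hm y (q i)) h) (hm x (q i))
    \<longleftrightarrow> leq Q (u i) (ty y) (qcomp Q (u i) (ty x) (ty y) h (hat x i)) (hat y i)"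
  unfolding hat_def using assms by (intro comp_leq_iff_rotate') auto

lemma comp_hat_leq:
  "\<lbrakk>x \<in> cob C; y \<in> cob C; i \<in> I\<rbrakk>
   \<Longrightarrow> leq Q (u i) (ty y) (qcomp Q (u i) (ty x) (ty y) (hm x y) (hat x i)) (hat y i)"
  using comp_hom_q_leq_iff[of x y i "hm x y"] hom_comp[of x y "q i"] by simp

lemma leq_hom_if_hat:
  assumes "x \<in> cob C" "y \<in> cob C" "h \<in> arr Q (ty x) (ty y)"
    and "\<And>i. i \<in> I \<Longrightarrow> leq Q (u i) (ty y) (qcomp Q (u i) (ty x) (ty y) h (hat x i)) (hat y i)"
  shows "leq Q (ty x) (ty y) h (hm x y)"
proof (rule q_dense[OF assms(1-3)])
  show "leq Q (ty x) (u i) (qcomp Q (ty x) (ty y) (u i) (hm y (q i)) h) (hm x (q i))"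
    if "i \<in> I" for i
    using comp_hom_q_leq_iff[OF assms(1,2) that assms(3)] assms(4)[OF that] by simp
qed

lemma hat_leq_iff_neg:
  assumes "x \<in> cob C" "i \<in> I" "k \<in> arr Q (u i) (ty x)"
  shows "leq Q (u i) (ty x) (hat x i) k \<longleftrightarrow> leq Q (ty x) (u i) (neg (u i) (ty x) k) (hm x (q i))"
  unfolding hat_def using assms by (intro neg_leq_swap) auto

text \<open>This is how \<open>hat\<close> preserves suprema: the defining property of
  \<open>s\<close> is tested at \<open>q i\<close> with the arrow \<open>neg (u i) X k\<close>, and
  each resulting inequality is rotated.\<close>

lemma hat_sup_leq_iff:
  assumes \<theta>: "psh Q C X \<theta>" and s: "sup_of Q C X \<theta> s" and i: "i \<in> I" and k: "k \<in> arr Q (u i) X"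
  shows "leq Q (u i) X (hat s i) k
    \<longleftrightarrow> (\<forall>x\<in>cob C. leq Q (u i) X (qcomp Q (u i) (ty x) X (\<theta> x) (hat x i)) k)"
proof -
  have "leq Q (ty x) (u i) (qcomp Q (ty x) X (u i) (neg (u i) X k) (\<theta> x)) (hm x (q i))
      \<longleftrightarrow> leq Q (u i) X (qcomp Q (u i) (ty x) X (\<theta> x) (hat x i)) k" if "x \<in> cob C" for x
    using comp_leq_iff_rotate'[of "\<theta> x" "ty x" X "neg (u i) X k" "u i" "hm x (q i)"]
      that i k pshD(2)[OF \<theta>] by (simp add: hat_def)
  then show ?thesis
    using hat_leq_iff_neg[of s i k] sup_ofD[OF s] i k by simp
qed

text \<open>By \<open>p_dense\<close>, \<open>z\<close> behaves as the supremum of the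
  \<open>p j\<close> weighted by \<open>hm (p j) z\<close>; correspondingly \<open>hat z i\<close>
  is the join of the composites of these weights with \<open>\<phi> i j\<close>.\<close>

lemma hat_leq_iff:
  assumes z: "z \<in> cob C" and i: "i \<in> I" and k: "k \<in> arr Q (u i) (ty z)"
  shows "leq Q (u i) (ty z) (hat z i) k
    \<longleftrightarrow> (\<forall>j\<in>J. leq Q (u i) (ty z) (qcomp Q (u i) (v j) (ty z) (hm (p j) z) (\<phi> i j)) k)"
proof -
  have "leq Q (ty z) (u i) (neg (u i) (ty z) k) (hm z (q i)) \<longleftrightarrow> (\<forall>j\<in>J. leq Q (v j) (u i)
      (qcomp Q (v j) (ty z) (u i) (neg (u i) (ty z) k) (hm (p j) z)) (hm (p j) (q i)))"
    (is "?l \<longleftrightarrow> ?r")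
  proof
    assume l: ?l
    show ?r
    proof
      fix j assume j: "j \<in> J"
      show "leq Q (v j) (u i) (qcomp Q (v j) (ty z) (u i) (neg (u i) (ty z) k) (hm (p j) z)) (hm (p j) (q i))"
        by (rule leq_trans[OF comp_monoL[OF hom_arr[OF p_ob[OF j] z] l] hom_comp[OF p_ob[OF j] z q_ob[OF i]]])
    qed
  next
    assume ?r
    then show ?l
      by (intro p_dense[OF z q_ob[OF i] neg_arr[OF k]]) blast
  qed
  also have "\<dots> \<longleftrightarrow> (\<forall>j\<in>J. leq Q (u i) (ty z) (qcomp Q (u i) (v j) (ty z) (hm (p j) z) (\<phi> i j)) k)"
  proof (rule ball_cong[OF refl])
    fix j assume j: "j \<in> J"
    show "leq Q (v j) (u i) (qcomp Q (v j) (ty z) (u i) (neg (u i) (ty z) k) (hm (p j) z)) (hm (p j) (q i))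
      \<longleftrightarrow> leq Q (u i) (ty z) (qcomp Q (u i) (v j) (ty z) (hm (p j) z) (\<phi> i j)) k"
      using comp_leq_iff_rotate'[of "hm (p j) z" "v j" "ty z" "neg (u i) (ty z) k" "u i"
        "hm (p j) (q i)"] z i j k by (simp add: hom_p_q)
  qed
  finally show ?thesis using hat_leq_iff_neg[OF assms] by simp
qed

lemma has_approximation_if_regular:
  assumes "regular_family Q I u J v \<phi>"
  shows "has_approximation Q C"
proof -
  obtain \<psi> where \<psi> [simp, intro]: "\<And>j i. \<lbrakk>j \<in> J; i \<in> I\<rbrakk> \<Longrightarrow> \<psi> j i \<in> arr Q (v j) (u i)"
    and reg: "\<And>i j k. \<lbrakk>i \<in> I; j \<in> J; k \<in> arr Q (u i) (v j)\<rbrakk> \<Longrightarrow> leq Q (u i) (v j) (\<phi> i j) k \<longleftrightarrow>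
      (\<forall>i'\<in>I. \<forall>j'\<in>J. leq Q (u i) (v j)
        (qcomp Q (u i) (v j') (v j) (qcomp Q (v j') (u i') (v j) (\<phi> i' j) (\<psi> j' i')) (\<phi> i j')) k)"
    using assms unfolding regular_family_def by blast
  \<comment> \<open>The presheaf generated by giving each \<open>p j\<close> the weight
    \<open>\<psi> j i\<close>; composing with the homs into \<open>p j\<close> makes it a presheaf
    although \<open>\<psi>\<close> is a bare family.\<close>
  define \<theta> where "\<theta> i y = qjoin Q (ty y) (u i) (\<lambda>j. qcomp Q (ty y) (v j) (u i) (\<psi> j i) (hm y (p j))) J"
    for i y
  have \<theta>_arr: "\<theta> i y \<in> arr Q (ty y) (u i)" if "i \<in> I" "y \<in> cob C" for i y
    unfolding \<theta>_def using that by (intro join_arr comp_arr) auto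
  have \<theta>_upper: "leq Q (ty y) (u i) (qcomp Q (ty y) (v j) (u i) (\<psi> j i) (hm y (p j))) (\<theta> i y)"
    if "i \<in> I" "y \<in> cob C" "j \<in> J" for i y j
    unfolding \<theta>_def using that by (intro join_upper[where i = j]) auto
  have \<theta>_psh: "psh Q C (u i) (\<theta> i)" if i: "i \<in> I" for i
    unfolding psh_def
  proof (intro conjI ballI)
    show "u i \<in> qob Q" using i by auto
    fix x y assume x: "x \<in> cob C" and y: "y \<in> cob C"
    show "\<theta> i x \<in> arr Q (ty x) (u i)" using i x by (rule \<theta>_arr)
    have "leq Q (ty x) (u i) (qcomp Q (ty x) (ty y) (u i)
        (qcomp Q (ty y) (v j) (u i) (\<psi> j i) (hm y (p j))) (hm x y)) (\<theta> i x)" if j: "j \<in> J" for j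
      using leq_trans[OF comp_monoR[OF hom_comp[OF x y p_ob[OF j]] \<psi>[OF j i]] \<theta>_upper[OF i x j]]
        x y i j by (simp add: assoc)
    then show "leq Q (ty x) (u i) (qcomp Q (ty x) (ty y) (u i) (\<theta> i y) (hm x y)) (\<theta> i x)"
      unfolding \<theta>_def[of i y] using i x y \<theta>_arr[OF i x]
      by (subst comp_join_left_leq_iff) auto
  qed
  then have "\<forall>i\<in>I. \<exists>w. sup_of Q C (u i) (\<theta> i) w"
    using sups by (auto simp: has_sups_def)
  from bchoice[OF this] obtain w where w_sup: "\<And>i. i \<in> I \<Longrightarrow> sup_of Q C (u i) (\<theta> i) (w i)"
    by blast
  note w [simp, intro] = sup_ofD(1,2)[OF w_sup]
  \<comment> \<open>\<open>hat (w i') i\<close> is the entry of \<psi> \<circ> \<phi> at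
    \<open>i\<close> and \<open>i'\<close>, because \<open>hat\<close> turns the supremum
    \<open>w i'\<close> into a join and \<open>hat (p j) i\<close> is
    \<open>\<phi> i j\<close>.\<close>
  have hat_w: "leq Q (u i) (u i') (hat (w i') i) k \<longleftrightarrow>
      (\<forall>j\<in>J. leq Q (u i) (u i') (qcomp Q (u i) (v j) (u i') (\<psi> j i') (\<phi> i j)) k)" (is "?l \<longleftrightarrow> ?r")
    if i: "i \<in> I" and i': "i' \<in> I" and k: "k \<in> arr Q (u i) (u i')" for i i' k
  proof -
    have "?l \<longleftrightarrow> (\<forall>y\<in>cob C. leq Q (u i) (u i') (qcomp Q (u i) (ty y) (u i') (\<theta> i' y) (hat y i)) k)"
      using hat_sup_leq_iff[OF \<theta>_psh w_sup i k] i' by blast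
    also have "\<dots> \<longleftrightarrow> (\<forall>y\<in>cob C. \<forall>j\<in>J. leq Q (u i) (u i') (qcomp Q (u i) (ty y) (u i')
        (qcomp Q (ty y) (v j) (u i') (\<psi> j i') (hm y (p j))) (hat y i)) k)"
      unfolding \<theta>_def using i i' k by (intro ball_cong refl comp_join_left_leq_iff) auto
    \<comment> \<open>Co-Yoneda: for each \<open>j\<close>, the term at \<open>y = p j\<close>
      bounds the composite of \<open>\<psi> j i'\<close> with \<open>\<phi> i j\<close>, which in
      turn bounds the terms at all \<open>y\<close>.\<close>
    also have "\<dots> \<longleftrightarrow> ?r"
    proof (intro iffI ballI)
      fix j assume j: "j \<in> J"
      assume "\<forall>y\<in>cob C. \<forall>j\<in>J. leq Q (u i) (u i') (qcomp Q (u i) (ty y) (u i')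
        (qcomp Q (ty y) (v j) (u i') (\<psi> j i') (hm y (p j))) (hat y i)) k"
      then have "leq Q (u i) (u i') (qcomp Q (u i) (v j) (u i')
        (qcomp Q (v j) (v j) (u i') (\<psi> j i') (hm (p j) (p j))) (\<phi> i j)) k"
        using j i hat_p by (metis p_ob)
      then show "leq Q (u i) (u i') (qcomp Q (u i) (v j) (u i') (\<psi> j i') (\<phi> i j)) k"
        using leq_of_id_leq[of "p j"] i i' j k by auto
    next
      fix y j assume y: "y \<in> cob C" and j: "j \<in> J" and ?r
      have "leq Q (u i) (u i') (qcomp Q (u i) (v j) (u i') (\<psi> j i') (qcomp Q (u i) (ty y) (v j) (hm y (p j)) (hat y i)))
          (qcomp Q (u i) (v j) (u i') (\<psi> j i') (\<phi> i j))"
        using comp_monoR[OF comp_hat_leq[OF y p_ob[OF j] i] \<psi>[OF j i']] hat_p[OF i j] by simp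
      from leq_trans[OF this] \<open>?r\<close> j
      show "leq Q (u i) (u i') (qcomp Q (u i) (ty y) (u i')
          (qcomp Q (ty y) (v j) (u i') (\<psi> j i') (hm y (p j))) (hat y i)) k"
        using y i i' by (simp add: assoc)
    qed
    finally show ?thesis .
  qed
  text \<open>By \<open>\<phi> \<circ> \<psi> \<circ> \<phi> \<le> \<phi>\<close>, an element containing \<open>i\<close> contains all of \<open>w i\<close>.\<close>
  have hat_leq_hom_w: "leq Q (u i) (ty z) (hat z i) (hm (w i) z)" if i: "i \<in> I" and z: "z \<in> cob C" for i z
  proof -
    have "leq Q (u i) (ty z) (qcomp Q (u i) (v j) (ty z) (hm (p j) z) (\<phi> i j)) (hm (w i) z)"
      if j: "j \<in> J" for j
    proof -
      have aux: "leq Q (u i') (v j) (qcomp Q (u i') (u i) (v j) (\<phi> i j) (hat (w i) i')) (\<phi> i' j)"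
        if i': "i' \<in> I" for i'
      proof -
        \<comment> \<open>Testing \<open>reg\<close> against \<open>\<phi> i' j\<close> itself
          extracts \<phi> \<circ> \<psi> \<circ> \<phi> \<le> \<phi>; residuation by
          \<open>\<phi> i j\<close> then isolates \<psi> \<circ> \<phi>, to which
          \<open>hat_w\<close> applies.\<close>
        have "leq Q (u i') (u i) (qcomp Q (u i') (v j') (u i) (\<psi> j' i) (\<phi> i' j'))
            (qlift Q (u i') (u i) (v j) (\<phi> i j) (\<phi> i' j))" if j': "j' \<in> J" for j'
          using reg[OF i' j, of "\<phi> i' j"] i i' j j' by (simp add: leq_qlift_iff assoc)
        then have "leq Q (u i') (u i) (hat (w i) i') (qlift Q (u i') (u i) (v j) (\<phi> i j) (\<phi> i' j))"
          using hat_w[OF i' i] i i' j by auto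
        then show ?thesis
          using leq_qlift_iff[of "\<phi> i j" "u i" "v j" "\<phi> i' j" "u i'" "hat (w i) i'"]
            hat_arr[of "w i" i'] i i' j by simp
      qed
      have "leq Q (u i') (ty z) (qcomp Q (u i') (u i) (ty z)
          (qcomp Q (u i) (v j) (ty z) (hm (p j) z) (\<phi> i j)) (hat (w i) i')) (hat z i')"
        if i': "i' \<in> I" for i'
      proof -
        have "leq Q (u i') (ty z) (qcomp Q (u i') (v j) (ty z) (hm (p j) z)
            (qcomp Q (u i') (u i) (v j) (\<phi> i j) (hat (w i) i')))
            (qcomp Q (u i') (v j) (ty z) (hm (p j) z) (hat (p j) i'))"
          using comp_monoR[OF aux[OF i'] hom_arr[OF p_ob[OF j] z]] hat_p[OF i' j] by simp
        also have "leq Q (u i') (ty z) \<dots> (hat z i')"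
          using comp_hat_leq[OF p_ob[OF j] z i'] .
        finally show ?thesis
          using hat_arr[of "w i" i'] i i' j z by (simp add: assoc)
      qed
      then show ?thesis
        using leq_hom_if_hat[of "w i" z "qcomp Q (u i) (v j) (ty z) (hm (p j) z) (\<phi> i j)"] i j z
        by auto
    qed
    then show ?thesis
      using hat_leq_iff[OF z i, of "hm (w i) z"] hom_arr[of "w i" z] i z by simp
  qed
  define t where "t x y = qjoin Q (ty y) (ty x) (\<lambda>i. qcomp Q (ty y) (u i) (ty x) (hat x i) (hm y (w i))) I"
    for x y
  have hm_w [simp, intro]: "hm y (w i) \<in> arr Q (ty y) (u i)" if "y \<in> cob C" "i \<in> I" for y i
    using hom_arr[of y "w i"] that by simp
  have t_arr: "t x y \<in> arr Q (ty y) (ty x)" if "x \<in> cob C" "y \<in> cob C" for x y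
    unfolding t_def using that by (intro join_arr comp_arr[where Y = "u i" for i]) auto
  have t_upper: "leq Q (ty y) (ty x) (qcomp Q (ty y) (u i) (ty x) (hat x i) (hm y (w i))) (t x y)"
    if "x \<in> cob C" "y \<in> cob C" "i \<in> I" for x y i
    unfolding t_def
    using that by (intro join_upper[where i = i] comp_arr[where Y = "u i" for i]) auto
  have t_psh: "psh Q C (ty x) (t x)" if x: "x \<in> cob C" for x
    unfolding psh_def
  proof (intro conjI ballI)
    show "ty x \<in> qob Q" using x by auto
    fix z y assume z: "z \<in> cob C" and y: "y \<in> cob C"
    show "t x z \<in> arr Q (ty z) (ty x)" using x z by (rule t_arr)
    have "leq Q (ty z) (ty x) (qcomp Q (ty z) (ty y) (ty x)
        (qcomp Q (ty y) (u i) (ty x) (hat x i) (hm y (w i))) (hm z y)) (t x z)" if i: "i \<in> I" for i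
      using leq_trans[OF comp_monoR[OF hom_comp[OF z y w(1)[OF i], unfolded w(2)[OF i]] hat_arr[OF x i]]
        t_upper[OF x z i]] hm_w[OF y i] x y z i by (simp add: assoc)
    then show "leq Q (ty z) (ty x) (qcomp Q (ty z) (ty y) (ty x) (t x y) (hm z y)) (t x z)"
      unfolding t_def[of x y] using x y z t_arr[OF x z]
      by (subst comp_join_left_leq_iff) auto
  qed
  \<comment> \<open>The adjunction between \<open>t\<close> and suprema. From left to right it rests
    on \<open>hat_leq_hom_w\<close>, hence on \<phi> \<circ> \<psi> \<circ> \<phi> \<le> \<phi>;
    from right to left on \<phi> \<le> \<phi> \<circ> \<psi> \<circ> \<phi>.\<close>
  have approx: "leq Q (ty x) X h (hm x s) \<longleftrightarrow>
      (\<forall>y\<in>cob C. leq Q (ty y) X (qcomp Q (ty y) (ty x) X h (t x y)) (\<tau> y))" (is "?l \<longleftrightarrow> ?r")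
    if \<tau>: "psh Q C X \<tau>" and s: "sup_of Q C X \<tau> s" and x: "x \<in> cob C" and h: "h \<in> arr Q (ty x) X"
    for X \<tau> s x h
  proof
    note s' = sup_ofD(1,2)[OF s]
    assume ?l
    show ?r
    proof
      fix y assume y: "y \<in> cob C"
      have "leq Q (ty y) X (qcomp Q (ty y) (ty x) X h (qcomp Q (ty y) (u i) (ty x) (hat x i) (hm y (w i)))) (\<tau> y)"
        if i: "i \<in> I" for i
      proof -
        have "leq Q (u i) X (qcomp Q (u i) (ty x) X h (hat x i)) (hat s i)"
          by (rule leq_trans[OF comp_monoL[OF hat_arr[OF x i] \<open>?l\<close>] comp_hat_leq[OF x s'(1) i, unfolded s'(2)]])
        \<comment> \<open>\<open>hat s i\<close> is the join of the composites of
          \<open>\<tau> z\<close> with \<open>hat z i\<close>. Since \<open>hat z i\<close> lies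
          below \<open>hm (w i) z\<close>, the presheaf law of \<open>\<tau>\<close> brings each of
          them, composed with \<open>hm y (w i)\<close>, below \<open>\<tau> y\<close>.\<close>
        moreover have "leq Q (u i) X (hat s i) (qext Q (ty y) (u i) X (\<tau> y) (hm y (w i)))"
          unfolding hat_sup_leq_iff[OF \<tau> s i qext_arr[OF hm_w[OF y i] pshD(2)[OF \<tau> y]]]
        proof
          fix z assume z: "z \<in> cob C"
          have "leq Q (ty y) (ty z) (qcomp Q (ty y) (u i) (ty z) (hat z i) (hm y (w i))) (hm y z)"
            by (rule leq_trans[OF comp_monoL[OF hm_w[OF y i] hat_leq_hom_w[OF i z]]
              hom_comp[OF y w(1)[OF i] z, unfolded w(2)[OF i]]])
          from leq_trans[OF comp_monoR[OF this pshD(2)[OF \<tau> z]] pshD(3)[OF \<tau> y z]]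
          have "leq Q (ty y) X (qcomp Q (ty y) (ty z) X (\<tau> z) (qcomp Q (ty y) (u i) (ty z) (hat z i) (hm y (w i)))) (\<tau> y)" .
          then show "leq Q (u i) X (qcomp Q (u i) (ty z) X (\<tau> z) (hat z i)) (qext Q (ty y) (u i) X (\<tau> y) (hm y (w i)))"
            using leq_qext_iff[OF hm_w[OF y i] pshD(2)[OF \<tau> y] comp_arr[OF hat_arr[OF z i] pshD(2)[OF \<tau> z]]]
              assoc[OF hm_w[OF y i] hat_arr[OF z i] pshD(2)[OF \<tau> z]] by simp
        qed
        ultimately have "leq Q (u i) X (qcomp Q (u i) (ty x) X h (hat x i))
            (qext Q (ty y) (u i) X (\<tau> y) (hm y (w i)))"
          using leq_trans by blast
        then show ?thesis
          using leq_qext_iff[OF hm_w[OF y i] pshD(2)[OF \<tau> y] comp_arr[OF hat_arr[OF x i] h]]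
            assoc[OF hm_w[OF y i] hat_arr[OF x i] h] by simp
      qed
      then show "leq Q (ty y) X (qcomp Q (ty y) (ty x) X h (t x y)) (\<tau> y)"
        unfolding t_def using x y h pshD(2)[OF \<tau> y] hm_w
        by (subst comp_join_right_leq_iff) auto
    qed
  next
    note s' = sup_ofD(1,2)[OF s]
    assume ?r
    have "leq Q (u i) X (qcomp Q (u i) (ty x) X h (hat x i)) (hat s i)" if i: "i \<in> I" for i
    proof -
      have hs: "hat s i \<in> arr Q (u i) X" using hat_arr[OF s'(1) i] s'(2) by simp
      \<comment> \<open>The largest arrow whose composite with \<open>h\<close> lies below
        \<open>hat s i\<close>; what remains is to place \<open>hat x i\<close> below it.\<close>
      define m where "m = qlift Q (u i) (ty x) X h (hat s i)"
      have m: "m \<in> arr Q (u i) (ty x)" unfolding m_def using hs h by auto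
      have leq_m: "leq Q (u i) (ty x) f m \<longleftrightarrow> leq Q (u i) X (qcomp Q (u i) (ty x) X h f) (hat s i)"
        if "f \<in> arr Q (u i) (ty x)" for f
        unfolding m_def using leq_qlift_iff[OF h hs that] .
      \<comment> \<open>The hypothesis is used at \<open>y = w i'\<close>, where \<open>t x\<close>
        is at least \<open>hat x i'\<close>; composites of \<open>\<tau> (w i')\<close> with
        \<open>hat (w i') i\<close> lie below \<open>hat s i\<close> because \<open>hat\<close>
        preserves suprema.\<close>
      have step: "leq Q (u i) X (qcomp Q (u i) (ty x) X h (qcomp Q (u i) (u i') (ty x) (hat x i') (hat (w i') i))) (hat s i)"
        if i': "i' \<in> I" for i'
      proof -
        have hw: "hat (w i') i \<in> arr Q (u i) (u i')" using hat_arr[of "w i'" i] i i' by simp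
        have "leq Q (u i') (ty x) (hat x i') (t x (w i'))"
          using leq_trans[OF leq_comp_hom[OF w(1)[OF i'], unfolded w(2)[OF i'], OF hat_arr[OF x i']]
            t_upper[OF x w(1)[OF i'] i', unfolded w(2)[OF i']]] .
        from comp_monoR[OF this h]
        have "leq Q (u i') X (qcomp Q (u i') (ty x) X h (hat x i')) (\<tau> (w i'))"
          by (rule leq_trans) (use \<open>?r\<close> w[OF i'] in auto)
        from comp_monoL[OF hw this]
        have "leq Q (u i) X (qcomp Q (u i) (u i') X (qcomp Q (u i') (ty x) X h (hat x i')) (hat (w i') i))
            (qcomp Q (u i) (u i') X (\<tau> (w i')) (hat (w i') i))" .
        also have "leq Q (u i) X \<dots> (hat s i)"
          using hat_sup_leq_iff[OF \<tau> s i hs] hs w[OF i'] by auto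
        finally show ?thesis
          using assoc[OF hw hat_arr[OF x i'] h] by simp
      qed
      have "leq Q (u i) (ty x) (qcomp Q (u i) (v j) (ty x) (hm (p j) x) (\<phi> i j)) m" if j: "j \<in> J" for j
      proof -
        \<comment> \<open>Here \<open>\<phi> i j\<close> is split into composites of \<phi>, \<psi>
          and \<phi>: the inner pair lies below \<open>hat (w i') i\<close> and the outer \<phi>,
          composed with \<open>hm (p j) x\<close>, below \<open>hat x i'\<close>, so
          \<open>step\<close> applies.\<close>
        have "leq Q (u i) (v j) (\<phi> i j) (qlift Q (u i) (v j) (ty x) (hm (p j) x) m)"
        proof (subst reg[OF i j], goal_cases)
          case 1 then show ?case using j x m by (intro qlift_arr) auto
        next
          case 2
          show ?case
          proof (intro ballI)
            fix i' j' assume i': "i' \<in> I" and j': "j' \<in> J"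
            have hw: "hat (w i') i \<in> arr Q (u i) (u i')" using hat_arr[of "w i'" i] i i' by simp
            have a: "leq Q (u i) (u i') (qcomp Q (u i) (v j') (u i') (\<psi> j' i') (\<phi> i j')) (hat (w i') i)"
              using hat_w[OF i i' hw] hw j' by auto
            have b: "leq Q (u i') (ty x) (qcomp Q (u i') (v j) (ty x) (hm (p j) x) (\<phi> i' j)) (hat x i')"
              using hat_leq_iff[OF x i' hat_arr[OF x i']] x i' j by auto
            have "leq Q (u i) (ty x) (qcomp Q (u i) (u i') (ty x) (hat x i') (hat (w i') i)) m"
              using step[OF i'] leq_m comp_arr[OF hw hat_arr[OF x i']] by blast
            with comp_mono[OF a b] have "leq Q (u i) (ty x)
               (qcomp Q (u i) (u i') (ty x) (qcomp Q (u i') (v j) (ty x) (hm (p j) x) (\<phi> i' j))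
                  (qcomp Q (u i) (v j') (u i') (\<psi> j' i') (\<phi> i j'))) m"
              using leq_trans by blast
            then show "leq Q (u i) (v j) (qcomp Q (u i) (v j') (v j)
                (qcomp Q (v j') (u i') (v j) (\<phi> i' j) (\<psi> j' i')) (\<phi> i j'))
                (qlift Q (u i) (v j) (ty x) (hm (p j) x) m)"
              using i i' j j' x m by (subst leq_qlift_iff) (auto simp: assoc)
          qed
        qed
        then show ?thesis
          using leq_qlift_iff[of "hm (p j) x" "v j" "ty x" m "u i" "\<phi> i j"] i j x m by auto
      qed
      then have "leq Q (u i) (ty x) (hat x i) m"
        using hat_leq_iff[OF x i m] by blast
      then show ?thesis using leq_m x i by auto
    qed
    then show ?l
      using leq_hom_if_hat[of x s h] x h s' by simp
  qed
  show ?thesis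
    unfolding has_approximation_def
  proof (intro exI[of _ t] conjI ballI allI impI t_psh)
    fix X \<tau> assume \<tau>: "psh Q C X \<tau>"
    then obtain s where s: "sup_of Q C X \<tau> s"
      using sups by (auto simp: has_sups_def)
    show "\<exists>s. sup_of Q C X \<tau> s \<and> (\<forall>x\<in>cob C. \<forall>h\<in>arr Q (ty x) X. leq Q (ty x) X h (hm x s) \<longleftrightarrow>
        (\<forall>y\<in>cob C. leq Q (ty y) X (qcomp Q (ty y) (ty x) X h (t x y)) (\<tau> y)))"
      using s approx[OF \<tau> s] by blast
  qed
qed

lemma regular_if_has_approximation:
  assumes "has_approximation Q C"
  shows "regular_family Q I u J v \<phi>"
proof -
  obtain t where t_psh: "\<And>x. x \<in> cob C \<Longrightarrow> psh Q C (ty x) (t x)"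
    and approx: "\<And>X \<theta>. psh Q C X \<theta> \<Longrightarrow> \<exists>s. sup_of Q C X \<theta> s \<and>
      (\<forall>x\<in>cob C. \<forall>h\<in>arr Q (ty x) X. leq Q (ty x) X h (hm x s) \<longleftrightarrow>
         (\<forall>y\<in>cob C. leq Q (ty y) X (qcomp Q (ty y) (ty x) X h (t x y)) (\<theta> y)))"
    using assms unfolding has_approximation_def by blast
  \<comment> \<open>The largest presheaf of type \<open>v j\<close> whose value at
    \<open>p j\<close> is below \<open>d (v j)\<close>; in the two-element case, the elements not
    above \<open>p j\<close>.\<close>
  define \<theta> where "\<theta> j x = neg (v j) (ty x) (hm (p j) x)" for j x
  have \<theta>_arr: "\<theta> j x \<in> arr Q (ty x) (v j)" if "j \<in> J" "x \<in> cob C" for j x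
    using that by (auto simp: \<theta>_def)
  have \<theta>_psh: "psh Q C (v j) (\<theta> j)" if j: "j \<in> J" for j
    unfolding psh_def
  proof (intro conjI ballI)
    fix x y assume x: "x \<in> cob C" and y: "y \<in> cob C"
    show "leq Q (ty x) (v j) (qcomp Q (ty x) (ty y) (v j) (\<theta> j y) (hm x y)) (\<theta> j x)"
      unfolding \<theta>_def
      using comp_leq_iff_rotate[of "hm (p j) x" "v j" "ty x" "hm x y" "ty y" "hm (p j) y"]
        hom_comp[of "p j" x y] x y j by auto
  qed (use j \<theta>_arr in auto)
  have "\<forall>j\<in>J. \<exists>s. sup_of Q C (v j) (\<theta> j) s \<and>
      (\<forall>x\<in>cob C. \<forall>h\<in>arr Q (ty x) (v j). leq Q (ty x) (v j) h (hm x s) \<longleftrightarrow>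
         (\<forall>y\<in>cob C. leq Q (ty y) (v j) (qcomp Q (ty y) (ty x) (v j) h (t x y)) (\<theta> j y)))"
    using approx \<theta>_psh by blast
  from bchoice[OF this] obtain s where s_sup: "\<And>j. j \<in> J \<Longrightarrow> sup_of Q C (v j) (\<theta> j) (s j)"
    and s_approx: "\<And>j x h. \<lbrakk>j \<in> J; x \<in> cob C; h \<in> arr Q (ty x) (v j)\<rbrakk>
      \<Longrightarrow> leq Q (ty x) (v j) h (hm x (s j)) \<longleftrightarrow>
         (\<forall>y\<in>cob C. leq Q (ty y) (v j) (qcomp Q (ty y) (ty x) (v j) h (t x y)) (\<theta> j y))"
    by blast
  note s [simp, intro] = sup_ofD(1,2)[OF s_sup]
  define \<psi> where "\<psi> j i = hm (s j) (q i)" for j i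
  have \<psi> [simp, intro]: "\<psi> j i \<in> arr Q (v j) (u i)" if "j \<in> J" "i \<in> I" for j i
    using hom_arr[of "s j" "q i"] that by (simp add: \<psi>_def)
  \<comment> \<open>\<open>s j'\<close> is an upper bound of its presheaf, so
    \<open>\<psi> j' i\<close> composed with \<open>\<theta> j' (p j)\<close> stays below
    \<open>hm (p j) (q i)\<close>. Both ends are negations, and rotating removes them.\<close>
  have phi_psi: "leq Q (v j') (v j) (qcomp Q (v j') (u i) (v j) (\<phi> i j) (\<psi> j' i)) (hm (p j') (p j))"
    if i: "i \<in> I" and j: "j \<in> J" and j': "j' \<in> J" for i j j'
  proof -
    have "leq Q (v j) (u i) (qcomp Q (v j) (v j') (u i) (\<psi> j' i) (\<theta> j' (p j))) (hm (p j) (q i))"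
      using sup_ofD(3)[OF s_sup[OF j'] q_ob[OF i] \<psi>[OF j' i]] leq_refl[OF \<psi>[OF j' i]] j by (simp add: \<psi>_def)
    then show ?thesis
      using comp_leq_iff_rotate'[of "\<psi> j' i" "v j'" "u i" "\<phi> i j" "v j" "hm (p j') (p j)"] i j j'
      by (simp add: \<theta>_def hom_p_q)
  qed
  \<comment> \<open>The approximation property bounds \<open>t (p j) (p j')\<close> by the negation
    of \<open>hm (p j) (s j')\<close>. By \<open>q_dense\<close> that negation lies below every
    upper bound \<open>m\<close> of the composites of \<open>\<psi> j' i\<close> with
    \<open>\<phi> i j\<close>.\<close>
  have below: "leq Q (v j') (v j) (t (p j) (p j')) m"
    if j: "j \<in> J" and j': "j' \<in> J" and m: "m \<in> arr Q (v j') (v j)"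
      and le: "\<And>i. i \<in> I \<Longrightarrow> leq Q (v j') (v j) (qcomp Q (v j') (u i) (v j) (\<phi> i j) (\<psi> j' i)) m"
    for j j' m
  proof -
    define h where "h = hm (p j) (s j')"
    define T where "T = t (p j) (p j')"
    have h: "h \<in> arr Q (v j) (v j')"
      using hom_arr[of "p j" "s j'"] j j' by (simp add: h_def)
    have T: "T \<in> arr Q (v j') (v j)"
      using pshD(2)[OF t_psh] j j' by (simp add: T_def)
    \<comment> \<open>\<open>s_approx\<close> with \<open>h\<close> as its own lower bound,
      evaluated at \<open>p j'\<close>, where the identity below \<open>hm (p j') (p j')\<close>
      will reduce the bound to \<open>d (v j')\<close>.\<close>
    have "leq Q (v j') (v j') (qcomp Q (v j') (v j) (v j') h T) (neg (v j') (v j') (hm (p j') (p j')))"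
      using s_approx[OF j' _ h] h j j' unfolding T_def \<theta>_def h_def by auto
    then have "leq Q (v j') (v j') (qcomp Q (v j') (v j') (v j')
        (qcomp Q (v j') (v j) (v j') h T) (hm (p j') (p j'))) (d (v j'))"
      using leq_neg_iff[of "hm (p j') (p j')" "v j'" "v j'"] h T j' by auto
    then have "leq Q (v j') (v j') (qcomp Q (v j') (v j) (v j') h T) (d (v j'))"
      using leq_comp_hom[of "p j'" "qcomp Q (v j') (v j) (v j') h T" "v j'"] h T j' leq_trans
      by blast
    then have "leq Q (v j') (v j) T (neg (v j) (v j') h)"
      using leq_neg_iff'[OF h T] by simp
    also have "leq Q (v j') (v j) \<dots> m"
    proof (subst neg_leq_swap[OF h m])
      have "leq Q (v j) (u i) (qcomp Q (v j) (v j') (u i) (\<psi> j' i) (neg (v j') (v j) m)) (hm (p j) (q i))"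
        if i: "i \<in> I" for i
        using comp_leq_iff_rotate'[of "\<psi> j' i" "v j'" "u i" "\<phi> i j" "v j" m] le[OF i] i j j' m
        by (simp add: hom_p_q)
      then show "leq Q (v j) (v j') (neg (v j') (v j) m) h"
        using q_dense[of "p j" "s j'" "neg (v j') (v j) m"] j j' m by (simp add: h_def \<psi>_def)
    qed
    finally show ?thesis by (simp add: T_def)
  qed
  have "leq Q (u i) (v j) (\<phi> i j) k \<longleftrightarrow> (\<forall>i'\<in>I. \<forall>j'\<in>J. leq Q (u i) (v j)
        (qcomp Q (u i) (v j') (v j) (qcomp Q (v j') (u i') (v j) (\<phi> i' j) (\<psi> j' i')) (\<phi> i j')) k)"
    (is "?l \<longleftrightarrow> ?r")
    if i: "i \<in> I" and j: "j \<in> J" and k: "k \<in> arr Q (u i) (v j)" for i j k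
  proof
    assume ?l
    show ?r
    proof (intro ballI)
      fix i' j' assume i': "i' \<in> I" and j': "j' \<in> J"
      have "leq Q (u i) (v j) (qcomp Q (u i) (v j') (v j) (qcomp Q (v j') (u i') (v j) (\<phi> i' j) (\<psi> j' i')) (\<phi> i j'))
          (qcomp Q (u i) (v j') (v j) (hm (p j') (p j)) (hat (p j') i))"
        using comp_monoL[OF phi_arr[OF i j'] phi_psi[OF i' j j']] hat_p[OF i j'] by simp
      also have "leq Q (u i) (v j) \<dots> (\<phi> i j)"
        using comp_hat_leq[of "p j'" "p j" i] hat_p[OF i j] i j j' by simp
      finally show "leq Q (u i) (v j)
        (qcomp Q (u i) (v j') (v j) (qcomp Q (v j') (u i') (v j) (\<phi> i' j) (\<psi> j' i')) (\<phi> i j')) k"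
        using \<open>?l\<close> leq_trans by blast
    qed
  next
    assume ?r
    \<comment> \<open>\<open>p j\<close> lies below the supremum \<open>r\<close> of its own
      approximating presheaf: this is the unit of the adjunction, obtained by comparing
      \<open>t (p j)\<close> with itself. Hence \<open>\<phi> i j\<close> lies below
      \<open>hat r i\<close>, which splits over \<open>t (p j)\<close>.\<close>
    obtain r where r: "sup_of Q C (v j) (t (p j)) r"
      and r_approx: "\<And>h. h \<in> arr Q (v j) (v j) \<Longrightarrow> leq Q (v j) (v j) h (hm (p j) r) \<longleftrightarrow>
         (\<forall>y\<in>cob C. leq Q (ty y) (v j) (qcomp Q (ty y) (v j) (v j) h (t (p j) y)) (t (p j) y))"
      using approx[OF t_psh[OF p_ob[OF j]]] j by auto
    note r' = sup_ofD(1,2)[OF r]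
    note tj = pshD[OF t_psh[OF p_ob[OF j]]]
    have "leq Q (v j) (v j) (qid Q (v j)) (hm (p j) r)"
      using r_approx[of "qid Q (v j)"] tj by auto
    from comp_monoL[OF hat_arr[OF p_ob[OF j] i] this]
    have "leq Q (u i) (v j) (\<phi> i j) (qcomp Q (u i) (v j) (v j) (hm (p j) r) (hat (p j) i))"
      using hat_p[OF i j] i j by simp
    also have "leq Q (u i) (v j) \<dots> (hat r i)"
      using comp_hat_leq[OF p_ob[OF j] r'(1) i] r'(2) by simp
    also have "leq Q (u i) (v j) (hat r i) k"
      unfolding hat_sup_leq_iff[OF t_psh[OF p_ob[OF j]] r i k]
    proof
      fix y assume y: "y \<in> cob C"
      \<comment> \<open>\<open>hat y i\<close> splits further over the generators, and the presheaf
        law moves \<open>hm (p j') y\<close> into \<open>t (p j)\<close>, so only the entries at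
        \<open>p j'\<close> matter, and these are controlled by \<open>below\<close>.\<close>
      have "leq Q (u i) (ty y) (qcomp Q (u i) (v j') (ty y) (hm (p j') y) (\<phi> i j'))
          (qlift Q (u i) (ty y) (v j) (t (p j) y) k)" if j': "j' \<in> J" for j'
      proof -
        have "leq Q (v j') (v j) (t (p j) (p j')) (qext Q (u i) (v j') (v j) k (\<phi> i j'))"
          using \<open>?r\<close> i j j' k by (intro below) (auto simp: leq_qext_iff)
        from leq_trans[OF tj(3)[OF p_ob[OF j'] y] this]
        have "leq Q (u i) (v j) (qcomp Q (u i) (v j') (v j)
            (qcomp Q (v j') (ty y) (v j) (t (p j) y) (hm (p j') y)) (\<phi> i j')) k"
          using leq_qext_iff[of "\<phi> i j'" "u i" "v j'" k "v j"] i j j' y k tj(2) by auto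
        then show ?thesis
          using i j' y k tj(2) by (subst leq_qlift_iff) (auto simp: assoc)
      qed
      then have "leq Q (u i) (ty y) (hat y i) (qlift Q (u i) (ty y) (v j) (t (p j) y) k)"
        using hat_leq_iff[OF y i] qlift_arr[OF tj(2)[OF y] k] by blast
      then show "leq Q (u i) (v j) (qcomp Q (u i) (ty y) (v j) (t (p j) y) (hat y i)) k"
        using leq_qlift_iff[OF tj(2)[OF y] k hat_arr[OF y i]] by simp
    qed
    finally show ?l .
  qed
  then show ?thesis
    unfolding regular_family_def by (intro exI[of _ \<psi>]) auto
qed

theorem has_approximation_iff_regular: "has_approximation Q C \<longleftrightarrow> regular_family Q I u J v \<phi>"
  using has_approximation_if_regular regular_if_has_approximation by blast

end

section \<open>Opposite categories\<close>

definition cop :: "('o, 'a, 'x) qcat \<Rightarrow> ('o, 'a, 'x) qcat" where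
  "cop C = \<lparr>cob = cob C, ctyp = ctyp C, chom = (\<lambda>x y. chom C y x)\<rparr>"

lemma cop_simps [simp]: "cob (cop C) = cob C" "ctyp (cop C) = ctyp C" "chom (cop C) x y = chom C y x"
  by (simp_all add: cop_def)

lemma is_qcat_cop: "is_qcat Q C \<Longrightarrow> is_qcat (qop Q) (cop C)"
  by (simp add: is_qcat_def)

lemma (in qcategory) qcategory_op: "qcategory (qop Q) (cop C)"
  using quantaloid_qop is_qcat_cop[OF qcat] by (simp add: qcategory_def qcategory_axioms_def)

lemma is_qfunctor_op: "is_qfunctor (qop Q) (cop A) (cop B) F \<longleftrightarrow> is_qfunctor Q A B F"
  by (auto simp: is_qfunctor_def)

text \<open>The underlying order of \<open>cop\<close> is reversed, so unit and counit trade
  places.\<close>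

lemma qadjoint_op: "qadjoint (qop Q) (cop B) (cop A) G F \<longleftrightarrow> qadjoint Q A B F G"
  by (auto simp: qadjoint_def is_qfunctor_op qfunctor_le_def cle_def)

text \<open>An infimum is the supremum of the presheaf of lower bounds.\<close>

lemma (in qcategory) has_sups_op:
  assumes "has_sups Q C"
  shows "has_sups (qop Q) (cop C)"
  unfolding has_sups_def
proof (intro allI impI)
  fix X l assume l: "psh (qop Q) (cop C) X l"
  have X: "X \<in> qob Q" and la [simp, intro]: "\<And>x. x \<in> cob C \<Longrightarrow> l x \<in> arr Q X (ctyp C x)"
    using l by (auto simp: psh_def)
  define \<theta> where "\<theta> x = qmeet Q (ctyp C x) X (\<lambda>y. qlift Q (ctyp C x) X (ctyp C y) (l y) (chom C x y)) (cob C)"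
    for x
  have \<theta>_arr: "\<theta> x \<in> arr Q (ctyp C x) X" if "x \<in> cob C" for x
    unfolding \<theta>_def using that X by (intro meet_arr qlift_arr) auto
  have leq_\<theta>: "leq Q (ctyp C x) X h (\<theta> x) \<longleftrightarrow>
      (\<forall>y\<in>cob C. leq Q (ctyp C x) (ctyp C y) (qcomp Q (ctyp C x) X (ctyp C y) (l y) h) (chom C x y))"
    if x: "x \<in> cob C" and h: "h \<in> arr Q (ctyp C x) X" for x h
    unfolding \<theta>_def using leq_meet_iff[OF h, of "cob C" "\<lambda>y. qlift Q (ctyp C x) X (ctyp C y) (l y) (chom C x y)"]
      qlift_arr[OF la hom_arr[OF x]] leq_qlift_iff[OF la hom_arr[OF x] h] by auto
  have l_\<theta>: "leq Q (ctyp C x) (ctyp C y) (qcomp Q (ctyp C x) X (ctyp C y) (l y) (\<theta> x)) (chom C x y)"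
    if "x \<in> cob C" "y \<in> cob C" for x y
    using leq_\<theta>[of x "\<theta> x"] \<theta>_arr that by auto
  have "psh Q C X \<theta>"
    unfolding psh_def
  proof (intro conjI ballI X \<theta>_arr)
    fix x y assume x: "x \<in> cob C" and y: "y \<in> cob C"
    have "leq Q (ctyp C x) (ctyp C z) (qcomp Q (ctyp C x) X (ctyp C z) (l z)
        (qcomp Q (ctyp C x) (ctyp C y) X (\<theta> y) (chom C x y))) (chom C x z)" if z: "z \<in> cob C" for z
      using leq_trans[OF comp_monoL[OF hom_arr[OF x y] l_\<theta>[OF y z]] hom_comp[OF x y z]]
        assoc[OF hom_arr[OF x y] \<theta>_arr[OF y] la[OF z]] by simp
    then show "leq Q (ctyp C x) X (qcomp Q (ctyp C x) (ctyp C y) X (\<theta> y) (chom C x y)) (\<theta> x)"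
      using leq_\<theta>[OF x] comp_arr[OF hom_arr[OF x y] \<theta>_arr[OF y]] by simp
  qed
  then obtain s where s: "sup_of Q C X \<theta> s" using assms by (auto simp: has_sups_def)
  note s' = sup_ofD(1,2)[OF s]
  \<comment> \<open>Each \<open>l y\<close> makes \<open>y\<close> an upper bound of
    \<open>\<theta>\<close>, so the supremum of the lower bounds is itself a lower bound.\<close>
  have l_s: "leq Q X (ctyp C y) (l y) (chom C s y)" if y: "y \<in> cob C" for y
    using sup_ofD(3)[OF s y la[OF y]] l_\<theta>[OF _ y] by simp
  have "leq Q (ctyp C x) X h (chom C x s) \<longleftrightarrow>
      (\<forall>y\<in>cob C. leq Q (ctyp C x) (ctyp C y) (qcomp Q (ctyp C x) X (ctyp C y) (l y) h) (chom C x y))"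
    (is "?l \<longleftrightarrow> ?r") if x: "x \<in> cob C" and h: "h \<in> arr Q (ctyp C x) X" for x h
  proof
    assume l: ?l
    show ?r
    proof
      fix y assume y: "y \<in> cob C"
      show "leq Q (ctyp C x) (ctyp C y) (qcomp Q (ctyp C x) X (ctyp C y) (l y) h) (chom C x y)"
        by (rule leq_trans[OF comp_mono[OF l l_s[OF y]] hom_comp[OF x s'(1) y, unfolded s'(2)]])
    qed
  next
    assume ?r
    then have "leq Q (ctyp C x) X h (\<theta> x)" using leq_\<theta>[OF x h] by blast
    moreover have "leq Q (ctyp C x) X (\<theta> x) (chom C x s)"
    proof -
      have "chom C s s \<in> arr Q X X" "leq Q X X (qid Q X) (chom C s s)"
        using hom_arr[of s s] hom_id[of s] s' by auto
      then have "\<forall>x\<in>cob C. leq Q (ctyp C x) X (qcomp Q (ctyp C x) X X (qid Q X) (\<theta> x)) (chom C x s)"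
        using sup_ofD(3)[OF s s'(1), of "qid Q X"] s' X by simp
      from bspec[OF this x] show ?thesis using \<theta>_arr[OF x] by simp
    qed
    ultimately show ?l by (rule leq_trans)
  qed
  then show "\<exists>s. sup_of (qop Q) (cop C) X l s"
    using s' by (intro exI[of _ s]) (auto simp: sup_of_def)
qed

context generated_category
begin

lemma generated_category_op: "generated_category (qop Q) d (cop C) J I p q (\<lambda>j i. \<phi> i j)"
proof -
  interpret op: girard_quantaloid "qop Q" d by (rule girard_quantaloid_qop)
  interpret op: qcategory "qop Q" "cop C" by (rule qcategory_op)
  show ?thesis
  proof (unfold_locales, goal_cases)
    \<comment> \<open>Negation in the opposite quantaloid is the residual on the other side;
      cyclicity identifies the two.\<close>
    case (4 j i)
    then show ?case
      by (simp add: op.neg_def qext_qop hom_p_q neg_eq_qlift)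
  qed (auto intro: p_dense q_dense has_sups_op[OF sups])
qed

text \<open>The opposite brackets the triple composite the other way. Associativity requires \<psi>
  to consist of arrows, so the comparison is prepared for a given \<psi> before the witness is
  transferred.\<close>

lemma regular_family_op:
  "regular_family (qop Q) J v I u (\<lambda>j i. \<phi> i j) \<longleftrightarrow> regular_family Q I u J v \<phi>"
proof -
  have eq: "qcomp Q (u i) (v j') (v j) (qcomp Q (v j') (u i') (v j) (\<phi> i' j) (\<psi> j' i')) (\<phi> i j')
    = qcomp Q (u i) (u i') (v j) (\<phi> i' j) (qcomp Q (u i) (v j') (u i') (\<psi> j' i') (\<phi> i j'))"
    if "\<forall>j\<in>J. \<forall>i\<in>I. \<psi> j i \<in> arr Q (v j) (u i)" "i \<in> I" "j \<in> J" "i' \<in> I" "j' \<in> J" for \<psi> i j i' j'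
    using that by (intro assoc) auto
  have inner: "(\<forall>j'\<in>J. \<forall>i'\<in>I. leq Q (u i) (v j)
          (qcomp Q (u i) (u i') (v j) (\<phi> i' j) (qcomp Q (u i) (v j') (u i') (\<psi> j' i') (\<phi> i j'))) k)
      \<longleftrightarrow> (\<forall>i'\<in>I. \<forall>j'\<in>J. leq Q (u i) (v j)
          (qcomp Q (u i) (v j') (v j) (qcomp Q (v j') (u i') (v j) (\<phi> i' j) (\<psi> j' i')) (\<phi> i j')) k)"
    if "\<forall>j\<in>J. \<forall>i\<in>I. \<psi> j i \<in> arr Q (v j) (u i)" "i \<in> I" "j \<in> J" for \<psi> i j k
    using eq[OF that] by auto
  show ?thesis
  proof
    assume "regular_family (qop Q) J v I u (\<lambda>j i. \<phi> i j)"
    then obtain \<psi> where \<psi>: "\<forall>j\<in>J. \<forall>i\<in>I. \<psi> i j \<in> arr Q (v j) (u i)"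
      and reg: "\<And>i j k. \<lbrakk>i \<in> I; j \<in> J; k \<in> arr Q (u i) (v j)\<rbrakk> \<Longrightarrow> leq Q (u i) (v j) (\<phi> i j) k \<longleftrightarrow>
        (\<forall>j'\<in>J. \<forall>i'\<in>I. leq Q (u i) (v j)
          (qcomp Q (u i) (u i') (v j) (\<phi> i' j) (qcomp Q (u i) (v j') (u i') (\<psi> i' j') (\<phi> i j'))) k)"
      unfolding regular_family_def qop_simps arr_qop leq_qop by blast
    show "regular_family Q I u J v \<phi>"
      unfolding regular_family_def
      using \<psi> inner[of "\<lambda>j i. \<psi> i j", OF \<psi>] reg by (intro exI[of _ "\<lambda>j i. \<psi> i j"]) simp
  next
    assume "regular_family Q I u J v \<phi>"
    then obtain \<psi> where \<psi>: "\<forall>j\<in>J. \<forall>i\<in>I. \<psi> j i \<in> arr Q (v j) (u i)"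
      and reg: "\<And>i j k. \<lbrakk>i \<in> I; j \<in> J; k \<in> arr Q (u i) (v j)\<rbrakk> \<Longrightarrow> leq Q (u i) (v j) (\<phi> i j) k \<longleftrightarrow>
        (\<forall>i'\<in>I. \<forall>j'\<in>J. leq Q (u i) (v j)
          (qcomp Q (u i) (v j') (v j) (qcomp Q (v j') (u i') (v j) (\<phi> i' j) (\<psi> j' i')) (\<phi> i j')) k)"
      unfolding regular_family_def by blast
    show "regular_family (qop Q) J v I u (\<lambda>j i. \<phi> i j)"
      unfolding regular_family_def qop_simps arr_qop leq_qop
      using \<psi> inner[OF \<psi>] reg by (intro exI[of _ "\<lambda>i j. \<psi> j i"]) simp
  qed
qed

theorem has_approximation_op_iff: "has_approximation (qop Q) (cop C) \<longleftrightarrow> has_approximation Q C"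
  using generated_category.has_approximation_iff_regular[OF generated_category_op]
    has_approximation_iff_regular regular_family_op by simp

end

section \<open>Distributors\<close>

text \<open>The law in \<open>qdist\<close> applies the action of A first and that of B second; the
  opposite reverses this, and associativity closes the gap.\<close>

lemma qdist_op: "(\<lambda>y x. f x y) \<in> qdist (qop Q) (cop B) (cop A) \<longleftrightarrow> f \<in> qdist Q A B"
  if "quantaloid Q" "is_qcat Q A" "is_qcat Q B"
proof -
  interpret quantaloid Q by fact
  interpret A: qcategory Q A by unfold_locales fact
  interpret B: qcategory Q B by unfold_locales fact
  have "qcomp Q (ctyp A x') (ctyp B y) (ctyp B y') (chom B y y')
         (qcomp Q (ctyp A x') (ctyp A x) (ctyp B y) (f x y) (chom A x' x))
      = qcomp Q (ctyp A x') (ctyp A x) (ctyp B y') (qcomp Q (ctyp A x) (ctyp B y) (ctyp B y') (chom B y y') (f x y))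
          (chom A x' x)"
    if "x \<in> cob A" "x' \<in> cob A" "y \<in> cob B" "y' \<in> cob B"
      "f x y \<in> carrier (qhom Q (ctyp A x) (ctyp B y))" for x x' y y'
    using that assoc[of "chom A x' x" "ctyp A x'" "ctyp A x" "f x y" "ctyp B y" "chom B y y'" "ctyp B y'"]
    by (simp add: arr_def[of _ "ctyp A x" "ctyp B y"])
  then show ?thesis
    unfolding qdist_def by (auto 4 3)
qed

lemma dist_le_op: "dist_le (qop Q) (cop B) (cop A) (\<lambda>y x. f x y) (\<lambda>y x. g x y) \<longleftrightarrow> dist_le Q A B f g"
  by (auto simp: dist_le_def)

lemma dist_comp_op: "dist_comp (qop Q) (cop C) (cop B) (cop A) (\<lambda>y x. f x y) (\<lambda>z y. g y z)
    = (\<lambda>z x. dist_comp Q A B C g f x z)"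
  by (auto simp: dist_comp_def fun_eq_iff)

lemma is_qcat_star: "quantaloid Q \<Longrightarrow> X \<in> qob Q \<Longrightarrow> is_qcat Q (qstar Q X)"
  using quantaloid.is_qcatI[of Q "qstar Q X"] by (simp add: qstar_def quantaloid.id_arr
    quantaloid.leq_refl quantaloid.comp_id)

lemma qstar_simps [simp]: "cob (qstar Q X) = {()}" "ctyp (qstar Q X) x = X" "chom (qstar Q X) x y = qid Q X"
  by (simp_all add: qstar_def)

lemma cop_qstar: "cop (qstar Q X) = qstar (qop Q) X"
  by (simp add: cop_def qstar_def)

context quantaloid
begin

section \<open>One-sided actions and the order on distributors\<close>

lemma qdist_arr:
  assumes "is_qcat Q A" "is_qcat Q B" "f \<in> qdist Q A B" "x \<in> cob A" "y \<in> cob B"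
  shows "f x y \<in> arr Q (ctyp A x) (ctyp B y)"
  using assms by (auto simp: qdist_def arr_def is_qcat_def)

text \<open>The two-sided law yields the action of A alone by inserting the identity below
  \<open>chom B y y\<close> on the other side.\<close>

lemma qdist_right:
  assumes "is_qcat Q A" "is_qcat Q B" "f \<in> qdist Q A B" "x \<in> cob A" "x' \<in> cob A" "y \<in> cob B"
  shows "leq Q (ctyp A x') (ctyp B y) (qcomp Q (ctyp A x') (ctyp A x) (ctyp B y) (f x y) (chom A x' x)) (f x' y)"
proof -
  interpret A: qcategory Q A by unfold_locales fact
  interpret B: qcategory Q B by unfold_locales fact
  note f = qdist_arr[OF assms(1-3)]
  have "leq Q (ctyp A x') (ctyp B y) (qcomp Q (ctyp A x') (ctyp A x) (ctyp B y) (f x y) (chom A x' x))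
    (qcomp Q (ctyp A x') (ctyp B y) (ctyp B y) (chom B y y)
         (qcomp Q (ctyp A x') (ctyp A x) (ctyp B y) (f x y) (chom A x' x)))"
    using B.leq_hom_comp[OF assms(6)] f assms by auto
  also have "leq Q (ctyp A x') (ctyp B y) \<dots> (f x' y)"
  proof (rule leqI)
    show "qcomp Q (ctyp A x') (ctyp B y) (ctyp B y) (chom B y y)
         (qcomp Q (ctyp A x') (ctyp A x) (ctyp B y) (f x y) (chom A x' x)) \<in> arr Q (ctyp A x') (ctyp B y)"
      using f assms by auto
  qed (use f assms in \<open>auto simp: qdist_def\<close>)
  finally show ?thesis .
qed

lemma qdist_left:
  assumes "is_qcat Q A" "is_qcat Q B" "f \<in> qdist Q A B" "x \<in> cob A" "y \<in> cob B" "y' \<in> cob B"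
  shows "leq Q (ctyp A x) (ctyp B y') (qcomp Q (ctyp A x) (ctyp B y) (ctyp B y') (chom B y y') (f x y)) (f x y')"
  using quantaloid.qdist_right[OF quantaloid_qop is_qcat_cop[OF assms(2)] is_qcat_cop[OF assms(1)],
      of "\<lambda>y x. f x y" y y' x] assms qdist_op[OF quantaloid_axioms assms(1,2)] by simp

lemma qdistI:
  assumes "is_qcat Q A" "is_qcat Q B"
    and arr: "\<And>x y. \<lbrakk>x \<in> cob A; y \<in> cob B\<rbrakk> \<Longrightarrow> f x y \<in> arr Q (ctyp A x) (ctyp B y)"
    and "\<And>x y. x \<notin> cob A \<or> y \<notin> cob B \<Longrightarrow> f x y = undefined"
    and right: "\<And>x x' y. \<lbrakk>x \<in> cob A; x' \<in> cob A; y \<in> cob B\<rbrakk> \<Longrightarrow> leq Q (ctyp A x') (ctyp B y)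
      (qcomp Q (ctyp A x') (ctyp A x) (ctyp B y) (f x y) (chom A x' x)) (f x' y)"
    and left: "\<And>x y y'. \<lbrakk>x \<in> cob A; y \<in> cob B; y' \<in> cob B\<rbrakk> \<Longrightarrow> leq Q (ctyp A x) (ctyp B y')
      (qcomp Q (ctyp A x) (ctyp B y) (ctyp B y') (chom B y y') (f x y)) (f x y')"
  shows "f \<in> qdist Q A B"
proof -
  interpret A: qcategory Q A by unfold_locales fact
  interpret B: qcategory Q B by unfold_locales fact
  have "leq Q (ctyp A x') (ctyp B y') (qcomp Q (ctyp A x') (ctyp B y) (ctyp B y') (chom B y y')
         (qcomp Q (ctyp A x') (ctyp A x) (ctyp B y) (f x y) (chom A x' x))) (f x' y')"
    if x: "x \<in> cob A" and x': "x' \<in> cob A" and y: "y \<in> cob B" and y': "y' \<in> cob B" for x x' y y'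
    by (rule leq_trans[OF comp_monoR[OF right[OF x x' y] B.hom_arr[OF y y']] left[OF x' y y']])
  then show ?thesis
    using arr assms(4) by (auto simp: qdist_def arr_def leq_def)
qed

lemma qdist_eqI:
  assumes "is_qcat Q A" "is_qcat Q B" "f \<in> qdist Q A B" "g \<in> qdist Q A B"
    and "\<And>x y. \<lbrakk>x \<in> cob A; y \<in> cob B\<rbrakk> \<Longrightarrow> leq Q (ctyp A x) (ctyp B y) (f x y) (g x y)"
    and "\<And>x y. \<lbrakk>x \<in> cob A; y \<in> cob B\<rbrakk> \<Longrightarrow> leq Q (ctyp A x) (ctyp B y) (g x y) (f x y)"
  shows "f = g"
proof (intro ext)
  fix x y show "f x y = g x y"
  proof (cases "x \<in> cob A \<and> y \<in> cob B")
    case True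
    then show ?thesis using leq_antisym[OF assms(5,6)] by blast
  next
    case False
    then show ?thesis using assms(3,4) by (simp add: qdist_def)
  qed
qed

lemma dist_le_iff:
  assumes "is_qcat Q A" "is_qcat Q B" "f \<in> qdist Q A B" "g \<in> qdist Q A B"
  shows "dist_le Q A B f g \<longleftrightarrow> (\<forall>x\<in>cob A. \<forall>y\<in>cob B. leq Q (ctyp A x) (ctyp B y) (f x y) (g x y))"
  using qdist_arr[OF assms(1,2)] assms by (auto simp: dist_le_def leq_def)

lemma dist_le_refl: "\<lbrakk>is_qcat Q A; is_qcat Q B; f \<in> qdist Q A B\<rbrakk> \<Longrightarrow> dist_le Q A B f f"
  by (simp add: dist_le_iff qdist_arr)

lemma dist_le_antisym:
  assumes "is_qcat Q A" "is_qcat Q B" "f \<in> qdist Q A B" "g \<in> qdist Q A B"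
    and "dist_le Q A B f g" "dist_le Q A B g f"
  shows "f = g"
  using assms(5,6) unfolding dist_le_iff[OF assms(1-4)] dist_le_iff[OF assms(1,2,4,3)]
  by (intro qdist_eqI[OF assms(1-4)]) auto

section \<open>Composites and residuals of distributors, entry by entry\<close>

context
  fixes A :: "('o, 'a, 'x) qcat" and B :: "('o, 'a, 'y) qcat" and C :: "('o, 'a, 'z) qcat"
  assumes A: "is_qcat Q A" and B: "is_qcat Q B" and C: "is_qcat Q C"
begin

interpretation A: qcategory Q A by unfold_locales (rule A)
interpretation B: qcategory Q B by unfold_locales (rule B)
interpretation C: qcategory Q C by unfold_locales (rule C)

lemma dist_comp_leq_iff:
  assumes "f \<in> qdist Q A B" "g \<in> qdist Q B C" "x \<in> cob A" "z \<in> cob C" "k \<in> arr Q (ctyp A x) (ctyp C z)"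
  shows "leq Q (ctyp A x) (ctyp C z) (dist_comp Q A B C g f x z) k \<longleftrightarrow>
    (\<forall>y\<in>cob B. leq Q (ctyp A x) (ctyp C z) (qcomp Q (ctyp A x) (ctyp B y) (ctyp C z) (g y z) (f x y)) k)"
  unfolding dist_comp_def using assms qdist_arr[OF A B] qdist_arr[OF B C]
  by (simp add: join_leq_iff comp_arr[where Y = "ctyp B y" for y])

lemma dist_comp_arr:
  assumes "f \<in> qdist Q A B" "g \<in> qdist Q B C" "x \<in> cob A" "z \<in> cob C"
  shows "dist_comp Q A B C g f x z \<in> arr Q (ctyp A x) (ctyp C z)"
  unfolding dist_comp_def using assms qdist_arr[OF A B] qdist_arr[OF B C]
  by (simp add: join_arr comp_arr[where Y = "ctyp B y" for y])

lemma comp_leq_dist_comp: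
  assumes "f \<in> qdist Q A B" "g \<in> qdist Q B C" "x \<in> cob A" "y \<in> cob B" "z \<in> cob C"
  shows "leq Q (ctyp A x) (ctyp C z) (qcomp Q (ctyp A x) (ctyp B y) (ctyp C z) (g y z) (f x y))
    (dist_comp Q A B C g f x z)"
  using dist_comp_leq_iff[OF assms(1-3,5) dist_comp_arr[OF assms(1-3,5)]] assms
    dist_comp_arr[OF assms(1-3,5)] by auto

lemma dist_comp_right:
  assumes f: "f \<in> qdist Q A B" and g: "g \<in> qdist Q B C"
    and x: "x \<in> cob A" and x': "x' \<in> cob A" and z: "z \<in> cob C"
  shows "leq Q (ctyp A x') (ctyp C z)
    (qcomp Q (ctyp A x') (ctyp A x) (ctyp C z) (dist_comp Q A B C g f x z) (chom A x' x))
    (dist_comp Q A B C g f x' z)"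
proof -
  note fa = qdist_arr[OF A B f] and ga = qdist_arr[OF B C g]
  have "leq Q (ctyp A x') (ctyp C z) (qcomp Q (ctyp A x') (ctyp A x) (ctyp C z)
      (qcomp Q (ctyp A x) (ctyp B y) (ctyp C z) (g y z) (f x y)) (chom A x' x)) (dist_comp Q A B C g f x' z)"
    if y: "y \<in> cob B" for y
    using leq_trans[OF comp_monoR[OF qdist_right[OF A B f x x' y] ga[OF y z]] comp_leq_dist_comp[OF f g x' y z]]
      assoc[OF A.hom_arr[OF x' x] fa[OF x y] ga[OF y z]] by simp
  then show ?thesis
    unfolding dist_comp_def[of Q A B C g f] using x x' z fa ga dist_comp_arr[OF f g x' z]
    by (simp add: dist_comp_def comp_join_left_leq_iff comp_arr[where Y = "ctyp B y" for y])
qed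

text \<open>The residual is a meet of residuals of arrows in each entry. This candidate is shown to
  be a distributor with the universal property; antisymmetry then identifies it with the definite
  description.\<close>

lemma dist_ext_props:
  assumes f: "f \<in> qdist Q A B" and h: "h \<in> qdist Q A C"
  shows "dist_ext Q A B C h f \<in> qdist Q B C"
    and "\<forall>g\<in>qdist Q B C. dist_le Q A C (dist_comp Q A B C g f) h \<longleftrightarrow> dist_le Q B C g (dist_ext Q A B C h f)"
    and "\<lbrakk>y \<in> cob B; z \<in> cob C; k \<in> arr Q (ctyp B y) (ctyp C z)\<rbrakk> \<Longrightarrow>
      leq Q (ctyp B y) (ctyp C z) k (dist_ext Q A B C h f y z) \<longleftrightarrow>
      (\<forall>x\<in>cob A. leq Q (ctyp A x) (ctyp C z) (qcomp Q (ctyp A x) (ctyp B y) (ctyp C z) k (f x y)) (h x z))"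
proof -
  note fa = qdist_arr[OF A B f] and ha = qdist_arr[OF A C h]
  define e where "e y z = (if y \<in> cob B \<and> z \<in> cob C then qmeet Q (ctyp B y) (ctyp C z)
      (\<lambda>x. qext Q (ctyp A x) (ctyp B y) (ctyp C z) (h x z) (f x y)) (cob A) else undefined)" for y z
  have ea: "e y z \<in> arr Q (ctyp B y) (ctyp C z)" if "y \<in> cob B" "z \<in> cob C" for y z
    using that fa ha by (simp add: e_def meet_arr)
  have e_iff: "leq Q (ctyp B y) (ctyp C z) k (e y z) \<longleftrightarrow>
      (\<forall>x\<in>cob A. leq Q (ctyp A x) (ctyp C z) (qcomp Q (ctyp A x) (ctyp B y) (ctyp C z) k (f x y)) (h x z))"
    if "y \<in> cob B" "z \<in> cob C" "k \<in> arr Q (ctyp B y) (ctyp C z)" for y z k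
    using that fa ha by (simp add: e_def leq_meet_iff leq_qext_iff)
  have e_f: "leq Q (ctyp A x) (ctyp C z) (qcomp Q (ctyp A x) (ctyp B y) (ctyp C z) (e y z) (f x y)) (h x z)"
    if "x \<in> cob A" "y \<in> cob B" "z \<in> cob C" for x y z
    using e_iff[OF that(2,3) ea] that ea by auto
  have e: "e \<in> qdist Q B C"
  proof (rule qdistI[OF B C])
    fix y y' z assume y: "y \<in> cob B" and y': "y' \<in> cob B" and z: "z \<in> cob C"
    have "leq Q (ctyp A x) (ctyp C z) (qcomp Q (ctyp A x) (ctyp B y') (ctyp C z)
        (qcomp Q (ctyp B y') (ctyp B y) (ctyp C z) (e y z) (chom B y' y)) (f x y')) (h x z)"
      if x: "x \<in> cob A" for x
      using leq_trans[OF comp_monoR[OF qdist_left[OF A B f x y' y] ea[OF y z]] e_f[OF x y z]]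
        assoc[OF fa[OF x y'] B.hom_arr[OF y' y] ea[OF y z]] by simp
    then show "leq Q (ctyp B y') (ctyp C z) (qcomp Q (ctyp B y') (ctyp B y) (ctyp C z) (e y z) (chom B y' y)) (e y' z)"
      using e_iff[OF y' z comp_arr[OF B.hom_arr[OF y' y] ea[OF y z]]] by blast
  next
    fix y z z' assume y: "y \<in> cob B" and z: "z \<in> cob C" and z': "z' \<in> cob C"
    have "leq Q (ctyp A x) (ctyp C z') (qcomp Q (ctyp A x) (ctyp B y) (ctyp C z')
        (qcomp Q (ctyp B y) (ctyp C z) (ctyp C z') (chom C z z') (e y z)) (f x y)) (h x z')"
      if x: "x \<in> cob A" for x
      using leq_trans[OF comp_monoR[OF e_f[OF x y z] C.hom_arr[OF z z']] qdist_left[OF A C h x z z']]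
        assoc[OF fa[OF x y] ea[OF y z] C.hom_arr[OF z z']] by simp
    then show "leq Q (ctyp B y) (ctyp C z') (qcomp Q (ctyp B y) (ctyp C z) (ctyp C z') (chom C z z') (e y z)) (e y z')"
      using e_iff[OF y z' comp_arr[OF ea[OF y z] C.hom_arr[OF z z']]] by blast
  qed (auto simp: ea, auto simp: e_def)
  have adj: "dist_le Q A C (dist_comp Q A B C g f) h \<longleftrightarrow> dist_le Q B C g e" if g: "g \<in> qdist Q B C" for g
  proof -
    have "dist_le Q A C (dist_comp Q A B C g f) h \<longleftrightarrow>
      (\<forall>x\<in>cob A. \<forall>z\<in>cob C. leq Q (ctyp A x) (ctyp C z) (dist_comp Q A B C g f x z) (h x z))"
      using dist_comp_arr[OF f g] ha by (auto simp: dist_le_def leq_def)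
    also have "\<dots> \<longleftrightarrow> (\<forall>y\<in>cob B. \<forall>z\<in>cob C. leq Q (ctyp B y) (ctyp C z) (g y z) (e y z))"
      using dist_comp_leq_iff[OF f g _ _ ha] e_iff qdist_arr[OF B C g] by auto
    finally show ?thesis using dist_le_iff[OF B C g e] by simp
  qed
  have "dist_ext Q A B C h f = e"
    unfolding dist_ext_def
  proof (rule the_equality)
    fix e' assume e': "e' \<in> qdist Q B C \<and>
      (\<forall>g\<in>qdist Q B C. dist_le Q A C (dist_comp Q A B C g f) h \<longleftrightarrow> dist_le Q B C g e')"
    have "dist_le Q B C e' e'" "dist_le Q B C e e"
      using dist_le_refl[OF B C] e e' by auto
    then have "dist_le Q B C e' e" "dist_le Q B C e e'"
      using adj e e' by auto
    then show "e' = e"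
      using e e' by (intro dist_le_antisym[OF B C]) auto
  qed (use e adj in blast)
  with e adj e_iff show "dist_ext Q A B C h f \<in> qdist Q B C"
    "\<forall>g\<in>qdist Q B C. dist_le Q A C (dist_comp Q A B C g f) h \<longleftrightarrow> dist_le Q B C g (dist_ext Q A B C h f)"
    "\<lbrakk>y \<in> cob B; z \<in> cob C; k \<in> arr Q (ctyp B y) (ctyp C z)\<rbrakk> \<Longrightarrow>
      leq Q (ctyp B y) (ctyp C z) k (dist_ext Q A B C h f y z) \<longleftrightarrow>
      (\<forall>x\<in>cob A. leq Q (ctyp A x) (ctyp C z) (qcomp Q (ctyp A x) (ctyp B y) (ctyp C z) k (f x y)) (h x z))"
    by auto
qed

end

text \<open>The left action is the right action of the opposite composite. That exchanges A and C
  together with their object types, which is why the lemma stands outside the context that fixes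
  them.\<close>

lemma dist_comp_qdist:
  assumes A: "is_qcat Q A" and B: "is_qcat Q B" and C: "is_qcat Q C"
    and f: "f \<in> qdist Q A B" and g: "g \<in> qdist Q B C"
  shows "dist_comp Q A B C g f \<in> qdist Q A C"
proof (rule qdistI[OF A C])
  fix x z z' assume x: "x \<in> cob A" and z: "z \<in> cob C" and z': "z' \<in> cob C"
  show "leq Q (ctyp A x) (ctyp C z')
    (qcomp Q (ctyp A x) (ctyp C z) (ctyp C z') (chom C z z') (dist_comp Q A B C g f x z))
    (dist_comp Q A B C g f x z')"
    using quantaloid.dist_comp_right[OF quantaloid_qop is_qcat_cop[OF C] is_qcat_cop[OF B] is_qcat_cop[OF A],
      of "\<lambda>z y. g y z" "\<lambda>y x. f x y" z z' x] x z z' f g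
    by (simp add: dist_comp_op qdist_op[OF quantaloid_axioms] A B C)
next
  show "dist_comp Q A B C g f x z = undefined" if "x \<notin> cob A \<or> z \<notin> cob C" for x z
    using that by (auto simp: dist_comp_def)
qed (use dist_comp_right[OF A B C f g] dist_comp_arr[OF A B C f g] in blast)+

text \<open>Transposition preserves composites and order, so the extension over \<open>qop Q\<close>
  has the universal property that defines the lifting.\<close>

lemma dist_lift_eq:
  assumes A: "is_qcat Q A" and B: "is_qcat Q B" and C: "is_qcat Q C"
    and g: "g \<in> qdist Q B C" and h: "h \<in> qdist Q A C"
  shows "dist_lift Q A B C g h
    = (\<lambda>x y. dist_ext (qop Q) (cop C) (cop B) (cop A) (\<lambda>z x. h x z) (\<lambda>z y. g y z) y x)"
proof -
  let ?e = "dist_ext (qop Q) (cop C) (cop B) (cop A) (\<lambda>z x. h x z) (\<lambda>z y. g y z)"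
  note op = qdist_op[OF quantaloid_axioms]
  have e: "?e \<in> qdist (qop Q) (cop B) (cop A)"
    and adj: "\<forall>f\<in>qdist (qop Q) (cop B) (cop A). dist_le (qop Q) (cop C) (cop A)
      (dist_comp (qop Q) (cop C) (cop B) (cop A) f (\<lambda>z y. g y z)) (\<lambda>z x. h x z)
      \<longleftrightarrow> dist_le (qop Q) (cop B) (cop A) f ?e"
    using quantaloid.dist_ext_props(1,2)[OF quantaloid_qop is_qcat_cop[OF C] is_qcat_cop[OF B] is_qcat_cop[OF A],
      of "\<lambda>z y. g y z" "\<lambda>z x. h x z"] g h by (simp_all add: op A B C)
  have e': "(\<lambda>x y. ?e y x) \<in> qdist Q A B"
    using e op[OF A B, of "\<lambda>x y. ?e y x"] by simp
  have adj': "dist_le Q A C (dist_comp Q A B C g f) h \<longleftrightarrow> dist_le Q A B f (\<lambda>x y. ?e y x)"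
    if "f \<in> qdist Q A B" for f
    using adj[rule_format, of "\<lambda>y x. f x y"] that dist_le_op[of Q B A f "\<lambda>x y. ?e y x"]
    by (simp add: op A B dist_comp_op dist_le_op)
  show ?thesis
    unfolding dist_lift_def
  proof (rule the_equality)
    fix k assume k: "k \<in> qdist Q A B \<and>
      (\<forall>f\<in>qdist Q A B. dist_le Q A C (dist_comp Q A B C g f) h \<longleftrightarrow> dist_le Q A B f k)"
    have "dist_le Q A B k k" "dist_le Q A B (\<lambda>x y. ?e y x) (\<lambda>x y. ?e y x)"
      using dist_le_refl[OF A B e'] dist_le_refl[OF A B] k by auto
    then have "dist_le Q A B k (\<lambda>x y. ?e y x)" "dist_le Q A B (\<lambda>x y. ?e y x) k"
      using adj' e' k by auto
    then show "k = (\<lambda>x y. ?e y x)"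
      using e' k by (intro dist_le_antisym[OF A B]) auto
  qed (use e' adj' in blast)
qed

lemma dist_lift_props:
  assumes A: "is_qcat Q A" and B: "is_qcat Q B" and C: "is_qcat Q C"
    and g: "g \<in> qdist Q B C" and h: "h \<in> qdist Q A C"
  shows "dist_lift Q A B C g h \<in> qdist Q A B"
    and "\<lbrakk>x \<in> cob A; y \<in> cob B; k \<in> arr Q (ctyp A x) (ctyp B y)\<rbrakk> \<Longrightarrow>
      leq Q (ctyp A x) (ctyp B y) k (dist_lift Q A B C g h x y) \<longleftrightarrow>
      (\<forall>z\<in>cob C. leq Q (ctyp A x) (ctyp C z) (qcomp Q (ctyp A x) (ctyp B y) (ctyp C z) (g y z) k) (h x z))"
  using quantaloid.dist_ext_props(1,3)[OF quantaloid_qop is_qcat_cop[OF C] is_qcat_cop[OF B] is_qcat_cop[OF A],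
      of "\<lambda>z y. g y z" "\<lambda>z x. h x z"] g h
    qdist_op[OF quantaloid_axioms A B, of "dist_lift Q A B C g h"]
  by (simp_all add: qdist_op[OF quantaloid_axioms] A B C dist_lift_eq[OF assms])

lemma regular_dist_iff:
  assumes A: "is_qcat Q A" and B: "is_qcat Q B" and f: "f \<in> qdist Q A B"
  shows "regular_dist Q A B f \<longleftrightarrow> regular_family Q (cob A) (ctyp A) (cob B) (ctyp B) f"
proof -
  interpret A: qcategory Q A by unfold_locales (rule A)
  interpret B: qcategory Q B by unfold_locales (rule B)
  note fa = qdist_arr[OF A B f]
  have comp_iff: "leq Q (ctyp A x) (ctyp B y) (dist_comp Q A A B f (dist_comp Q A B A g f) x y) k \<longleftrightarrow>
    (\<forall>x'\<in>cob A. \<forall>y'\<in>cob B. leq Q (ctyp A x) (ctyp B y) (qcomp Q (ctyp A x) (ctyp B y') (ctyp B y)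
        (qcomp Q (ctyp B y') (ctyp A x') (ctyp B y) (f x' y) (g y' x')) (f x y')) k)"
    if g: "g \<in> qdist Q B A" and x: "x \<in> cob A" and y: "y \<in> cob B" and k: "k \<in> arr Q (ctyp A x) (ctyp B y)"
    for g x y k
  proof -
    note ga = qdist_arr[OF B A g]
    have "leq Q (ctyp A x) (ctyp B y) (dist_comp Q A A B f (dist_comp Q A B A g f) x y) k \<longleftrightarrow>
      (\<forall>x'\<in>cob A. leq Q (ctyp A x) (ctyp B y)
        (qcomp Q (ctyp A x) (ctyp A x') (ctyp B y) (f x' y) (dist_comp Q A B A g f x x')) k)"
      using dist_comp_leq_iff[OF A A B dist_comp_qdist[OF A B A f g] f x y k] .
    \<comment> \<open>Residuation by \<open>f x' y\<close> exposes the inner composite, so that its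
      join can be unfolded too.\<close>
    also have "\<dots> \<longleftrightarrow> (\<forall>x'\<in>cob A. leq Q (ctyp A x) (ctyp A x') (dist_comp Q A B A g f x x')
        (qlift Q (ctyp A x) (ctyp A x') (ctyp B y) (f x' y) k))"
      using leq_qlift_iff[OF fa[OF _ y] k dist_comp_arr[OF A B A f g x]] by simp
    also have "\<dots> \<longleftrightarrow> (\<forall>x'\<in>cob A. \<forall>y'\<in>cob B. leq Q (ctyp A x) (ctyp A x')
        (qcomp Q (ctyp A x) (ctyp B y') (ctyp A x') (g y' x') (f x y'))
        (qlift Q (ctyp A x) (ctyp A x') (ctyp B y) (f x' y) k))"
      using dist_comp_leq_iff[OF A B A f g x _ qlift_arr[OF fa[OF _ y] k]] by simp
    also have "\<dots> \<longleftrightarrow> (\<forall>x'\<in>cob A. \<forall>y'\<in>cob B. leq Q (ctyp A x) (ctyp B y) (qcomp Q (ctyp A x) (ctyp B y') (ctyp B y)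
        (qcomp Q (ctyp B y') (ctyp A x') (ctyp B y) (f x' y) (g y' x')) (f x y')) k)"
    proof (intro ball_cong refl)
      fix x' y' assume x': "x' \<in> cob A" and y': "y' \<in> cob B"
      show "leq Q (ctyp A x) (ctyp A x')
        (qcomp Q (ctyp A x) (ctyp B y') (ctyp A x') (g y' x') (f x y'))
        (qlift Q (ctyp A x) (ctyp A x') (ctyp B y) (f x' y) k) \<longleftrightarrow>
        leq Q (ctyp A x) (ctyp B y) (qcomp Q (ctyp A x) (ctyp B y') (ctyp B y)
        (qcomp Q (ctyp B y') (ctyp A x') (ctyp B y) (f x' y) (g y' x')) (f x y')) k"
        using leq_qlift_iff[OF fa[OF x' y] k comp_arr[OF fa[OF x y'] ga[OF y' x']]]
          assoc[OF fa[OF x y'] ga[OF y' x'] fa[OF x' y]] by simp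
    qed
    finally show ?thesis .
  qed
  show ?thesis
  proof
    assume "regular_dist Q A B f"
    then obtain g where g: "g \<in> qdist Q B A"
      and eq: "dist_comp Q A A B f (dist_comp Q A B A g f) = f"
      by (auto simp: regular_dist_def)
    show "regular_family Q (cob A) (ctyp A) (cob B) (ctyp B) f"
      unfolding regular_family_def
      using comp_iff[OF g, unfolded eq] qdist_arr[OF B A g] by blast
  next
    assume "regular_family Q (cob A) (ctyp A) (cob B) (ctyp B) f"
    then obtain g where ga: "\<And>x y. \<lbrakk>x \<in> cob A; y \<in> cob B\<rbrakk> \<Longrightarrow> g y x \<in> arr Q (ctyp B y) (ctyp A x)"
      and reg: "\<And>x y k. \<lbrakk>x \<in> cob A; y \<in> cob B; k \<in> arr Q (ctyp A x) (ctyp B y)\<rbrakk> \<Longrightarrow>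
        leq Q (ctyp A x) (ctyp B y) (f x y) k \<longleftrightarrow> (\<forall>x'\<in>cob A. \<forall>y'\<in>cob B. leq Q (ctyp A x) (ctyp B y)
          (qcomp Q (ctyp A x) (ctyp B y') (ctyp B y)
            (qcomp Q (ctyp B y') (ctyp A x') (ctyp B y) (f x' y) (g y' x')) (f x y')) k)"
      unfolding regular_family_def by blast
    text \<open>\<open>g\<close> need not be a distributor; it is replaced by \<open>(f \<searrow> f) \<swarrow> f\<close>, the largest solution
      of \<open>f \<circ> g \<circ> f \<le> f\<close>.\<close>
    define r where "r = dist_ext Q A B A (dist_lift Q A A B f f) f"
    note lift = dist_lift_props[OF A A B f f]
    have r: "r \<in> qdist Q B A"
      unfolding r_def by (rule dist_ext_props(1)[OF A B A f lift(1)])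
    note ra = qdist_arr[OF B A r]
    have r_iff: "leq Q (ctyp B y') (ctyp A x') k (r y' x') \<longleftrightarrow>
        (\<forall>x\<in>cob A. \<forall>y\<in>cob B. leq Q (ctyp A x) (ctyp B y) (qcomp Q (ctyp A x) (ctyp B y') (ctyp B y)
          (qcomp Q (ctyp B y') (ctyp A x') (ctyp B y) (f x' y) k) (f x y')) (f x y))"
      if x': "x' \<in> cob A" and y': "y' \<in> cob B" and k: "k \<in> arr Q (ctyp B y') (ctyp A x')" for x' y' k
      using dist_ext_props(3)[OF A B A f lift(1) y' x' k] lift(2)[OF _ x' comp_arr[OF fa[OF _ y'] k]]
        assoc[OF fa[OF _ y'] k fa[OF x']] by (simp add: r_def)
    have "dist_comp Q A A B f (dist_comp Q A B A r f) = f"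
    proof (rule qdist_eqI[OF A B dist_comp_qdist[OF A A B dist_comp_qdist[OF A B A f r] f] f])
      fix x y assume x: "x \<in> cob A" and y: "y \<in> cob B"
      show "leq Q (ctyp A x) (ctyp B y) (dist_comp Q A A B f (dist_comp Q A B A r f) x y) (f x y)"
        unfolding comp_iff[OF r x y fa[OF x y]]
        using r_iff[THEN iffD1, OF _ _ _ leq_refl] ra x y by blast
      let ?c = "dist_comp Q A A B f (dist_comp Q A B A r f) x y"
      have c: "?c \<in> arr Q (ctyp A x) (ctyp B y)"
        by (rule dist_comp_arr[OF A A B dist_comp_qdist[OF A B A f r] f x y])
      show "leq Q (ctyp A x) (ctyp B y) (f x y) ?c"
        unfolding reg[OF x y c]
      proof (intro ballI)
        fix x' y' assume x': "x' \<in> cob A" and y': "y' \<in> cob B"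
        have "leq Q (ctyp B y') (ctyp A x') (g y' x') (r y' x')"
          unfolding r_iff[OF x' y' ga[OF x' y']] using reg fa x' y' by blast
        from comp_monoL[OF fa[OF x y'] comp_monoR[OF this fa[OF x' y]]]
        show "leq Q (ctyp A x) (ctyp B y) (qcomp Q (ctyp A x) (ctyp B y') (ctyp B y)
            (qcomp Q (ctyp B y') (ctyp A x') (ctyp B y) (f x' y) (g y' x')) (f x y')) ?c"
          by (rule leq_trans) (use comp_iff[OF r x y c] c x' y' in auto)
      qed
    qed
    with r show "regular_dist Q A B f" by (auto simp: regular_dist_def)
  qed
qed

end

section \<open>Presheaves and complete distributivity\<close>

lemma cob_presheaf: "p \<in> cob (presheaf Q C) \<longleftrightarrow> fst p \<in> qob Q \<and> snd p \<in> qdist Q C (qstar Q (fst p))"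
  by (cases p) (simp add: presheaf_def)

lemma ctyp_presheaf [simp]: "ctyp (presheaf Q C) = fst"
  by (simp add: presheaf_def)

lemma chom_presheaf: "chom (presheaf Q C) p p'
  = dist_ext Q C (qstar Q (fst p)) (qstar Q (fst p')) (snd p') (snd p) () ()"
  by (simp add: presheaf_def split: prod.split)

context qcategory
begin

text \<open>The one-object category acts by an identity, so of the distributor law only the action
  of C remains.\<close>

lemma qdist_star_iff:
  assumes X: "X \<in> qob Q"
  shows "m \<in> qdist Q C (qstar Q X) \<longleftrightarrow>
    psh Q C X (\<lambda>x. m x ()) \<and> (\<forall>x. x \<notin> cob C \<longrightarrow> m x () = undefined)"
proof
  assume m: "m \<in> qdist Q C (qstar Q X)"
  note star = is_qcat_star[OF quantaloid_axioms X]
  have "m x () = undefined" if "x \<notin> cob C" for x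
    using m that by (simp add: qdist_def)
  then show "psh Q C X (\<lambda>x. m x ()) \<and> (\<forall>x. x \<notin> cob C \<longrightarrow> m x () = undefined)"
    using qdist_arr[OF qcat star m] qdist_right[OF qcat star m] X by (auto simp: psh_def)
next
  assume m: "psh Q C X (\<lambda>x. m x ()) \<and> (\<forall>x. x \<notin> cob C \<longrightarrow> m x () = undefined)"
  show "m \<in> qdist Q C (qstar Q X)"
    by (rule qdistI[OF qcat is_qcat_star[OF quantaloid_axioms X]])
      (use m in \<open>auto simp: psh_def\<close>)
qed

lemma leq_chom_presheaf_iff:
  assumes p: "p \<in> cob (presheaf Q C)" and p': "p' \<in> cob (presheaf Q C)"
    and h: "h \<in> arr Q (fst p) (fst p')"
  shows "leq Q (fst p) (fst p') h (chom (presheaf Q C) p p') \<longleftrightarrow>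
    (\<forall>x\<in>cob C. leq Q (ctyp C x) (fst p')
       (qcomp Q (ctyp C x) (fst p) (fst p') h (snd p x ())) (snd p' x ()))"
  using dist_ext_props(3)[OF qcat is_qcat_star is_qcat_star, of "fst p" "fst p'" "snd p" "snd p'" "()" "()" h]
    p p' h by (simp add: chom_presheaf cob_presheaf quantaloid_axioms)

lemma chom_presheaf_arr:
  assumes p: "p \<in> cob (presheaf Q C)" and p': "p' \<in> cob (presheaf Q C)"
  shows "chom (presheaf Q C) p p' \<in> arr Q (fst p) (fst p')"
  using qdist_arr[OF is_qcat_star is_qcat_star, OF quantaloid_axioms _ quantaloid_axioms _
      dist_ext_props(1)[OF qcat is_qcat_star is_qcat_star], of "fst p" "fst p'" "snd p" "snd p'" "()" "()"]
    p p' by (simp add: chom_presheaf cob_presheaf quantaloid_axioms)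

lemma represents_psh_presheaf: "represents_psh Q C (presheaf Q C) (\<lambda>p x. snd p x ())"
  unfolding represents_psh_def ctyp_presheaf
proof (intro conjI ballI allI impI)
  show "psh Q C (fst p) (\<lambda>x. snd p x ())" if "p \<in> cob (presheaf Q C)" for p
    using that qdist_star_iff[of "fst p" "snd p"] by (simp add: cob_presheaf)
  show "\<exists>p\<in>cob (presheaf Q C). fst p = X \<and> (\<forall>x\<in>cob C. snd p x () = \<theta> x)" if \<theta>: "psh Q C X \<theta>" for X \<theta>
  proof (rule bexI[of _ "(X, \<lambda>x _. if x \<in> cob C then \<theta> x else undefined)"])
    show "(X, \<lambda>x _. if x \<in> cob C then \<theta> x else undefined) \<in> cob (presheaf Q C)"
      using \<theta> by (simp add: cob_presheaf qdist_star_iff[OF pshD(1)[OF \<theta>]]) (simp add: psh_def)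
  qed simp
qed (simp_all add: chom_presheaf_arr leq_chom_presheaf_iff)

lemma psh_category_presheaf:
  "psh_category Q C (presheaf Q C) (\<lambda>p x. snd p x ()) (yoneda C)"
proof unfold_locales
  show "yoneda C y \<in> cob (presheaf Q C)" if "y \<in> cob C" for y
    using that by (simp add: cob_presheaf yoneda_def qdist_star_iff) (simp add: psh_def hom_comp)
qed (simp_all add: represents_psh_presheaf yoneda_def)

text \<open>Everything is transported along the transposition \<open>g\<close>, which matches
  copresheaves on \<open>C\<close> with presheaves on \<open>cop C\<close> and reverses
  homs.\<close>

lemma represents_psh_copresheaf:
  "represents_psh (qop Q) (cop C) (cop (copresheaf Q C)) (\<lambda>p x. snd p () x)"
proof -
  interpret op: qcategory "qop Q" "cop C" by (rule qcategory_op)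
  let ?P = "presheaf (qop Q) (cop C)"
  define g where "g = (\<lambda>p :: 'o \<times> (unit \<Rightarrow> 'x \<Rightarrow> 'a). (fst p, \<lambda>x y. snd p y x))"
  note star = is_qcat_star[OF quantaloid_axioms]
  have cob: "p \<in> cob (copresheaf Q C) \<longleftrightarrow> g p \<in> cob ?P" for p
    using qdist_op[OF quantaloid_axioms star qcat, of "fst p" "snd p"]
    by (cases p) (auto simp: cob_presheaf g_def copresheaf_def cop_qstar)
  have ctyp_g: "ctyp ?P (g p) = ctyp (copresheaf Q C) p" for p
    by (simp add: g_def copresheaf_def)
  have hom: "chom (copresheaf Q C) p p' = chom ?P (g p') (g p)"
    if "p \<in> cob (copresheaf Q C)" "p' \<in> cob (copresheaf Q C)" for p p'
    using that dist_lift_eq[OF star star qcat, of "fst p" "fst p'" "snd p'" "snd p"]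
    by (cases p; cases p') (auto simp: chom_presheaf g_def copresheaf_def cop_qstar)
  interpret P: psh_category "qop Q" "cop C" ?P "\<lambda>p x. snd p x ()" "yoneda (cop C)"
    by (rule op.psh_category_presheaf)
  have ev: "snd (g p) x () = snd p () x" for p x
    by (simp add: g_def)
  show ?thesis
    unfolding represents_psh_def
  proof (intro conjI ballI allI impI)
    show "psh (qop Q) (cop C) (ctyp (cop (copresheaf Q C)) p) (\<lambda>x. snd p () x)"
      if "p \<in> cob (cop (copresheaf Q C))" for p
      using P.psh_ev[of "g p"] that cob ctyp_g ev by simp
    show "\<exists>p\<in>cob (cop (copresheaf Q C)). ctyp (cop (copresheaf Q C)) p = X \<and>
        (\<forall>x\<in>cob (cop C). snd p () x = \<theta> x)" if \<theta>: "psh (qop Q) (cop C) X \<theta>" for X \<theta>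
    proof -
      obtain p' where p': "p' \<in> cob ?P" "ctyp ?P p' = X" "\<forall>x\<in>cob (cop C). snd p' x () = \<theta> x"
        using P.psh_rep[OF \<theta>] by blast
      define p where "p = (fst p', \<lambda>y x. snd p' x y)"
      have "g p = p'" by (simp add: p_def g_def)
      with p' show ?thesis
        using cob[of p] ctyp_g[of p] ev[of p] by (intro bexI[of _ p]) auto
    qed
    fix p p' assume p: "p \<in> cob (cop (copresheaf Q C))" "p' \<in> cob (cop (copresheaf Q C))"
    have g: "g p \<in> cob ?P" "g p' \<in> cob ?P" "chom (cop (copresheaf Q C)) p p' = chom ?P (g p) (g p')"
      using p cob hom[of p' p] by auto
    show "chom (cop (copresheaf Q C)) p p'
        \<in> arr (qop Q) (ctyp (cop (copresheaf Q C)) p) (ctyp (cop (copresheaf Q C)) p')"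
      using P.P.hom_arr[OF g(1,2)] g(3) by (simp only: ctyp_g cop_simps)
    show "leq (qop Q) (ctyp (cop (copresheaf Q C)) p) (ctyp (cop (copresheaf Q C)) p') h
          (chom (cop (copresheaf Q C)) p p') \<longleftrightarrow>
        (\<forall>x\<in>cob (cop C). leq (qop Q) (ctyp (cop C) x) (ctyp (cop (copresheaf Q C)) p')
          (qcomp (qop Q) (ctyp (cop C) x) (ctyp (cop (copresheaf Q C)) p) (ctyp (cop (copresheaf Q C)) p')
            h (snd p () x)) (snd p' () x))"
      if "h \<in> arr (qop Q) (ctyp (cop (copresheaf Q C)) p) (ctyp (cop (copresheaf Q C)) p')" for h
      using P.leq_homP_iff[OF g(1,2), of h] that g(3) by (simp only: ctyp_g cop_simps ev)
  qed
qed

lemma psh_category_copresheaf: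
  "psh_category (qop Q) (cop C) (cop (copresheaf Q C)) (\<lambda>p x. snd p () x) (coyoneda C)"
proof -
  interpret op: qcategory "qop Q" "cop C" by (rule qcategory_op)
  show ?thesis
  proof unfold_locales
    show "coyoneda C y \<in> cob (cop (copresheaf Q C))" if "y \<in> cob (cop C)" for y
    proof -
      have "yoneda (cop C) y \<in> cob (presheaf (qop Q) (cop C))"
        using psh_category.Y(1)[OF op.psh_category_presheaf that] .
      then show ?thesis
        using that qdist_op[OF quantaloid_axioms is_qcat_star[OF quantaloid_axioms] qcat,
            of "ctyp C y" "\<lambda>_ x. if x \<in> cob C then chom C y x else undefined"]
        by (simp add: cob_presheaf yoneda_def coyoneda_def copresheaf_def cop_qstar cong: if_cong)
    qed
  qed (rule represents_psh_copresheaf, simp_all add: coyoneda_def copresheaf_def)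
qed

section \<open>Completeness and distributivity in terms of suprema and approximation\<close>

lemma complete_qcat_iff: "complete_qcat Q C \<longleftrightarrow> has_sups Q C"
  unfolding complete_qcat_def is_sup_def
  by (rule psh_category.ex_qadjoint_Y_iff[OF psh_category_presheaf])

lemma ccd_iff: "ccd Q C \<longleftrightarrow> has_sups Q C \<and> has_approximation Q C"
  unfolding ccd_def complete_qcat_iff is_sup_def
  unfolding psh_category.ex_qadjoint_triple_iff[OF psh_category_presheaf] by blast

text \<open>Passing to opposites reverses the string of adjoints from co-Yoneda through inf to its
  right adjoint. The result is the string for presheaves on \<open>cop C\<close>, with inf in the
  place of sup.\<close>

lemma op_ccd_iff: "op_ccd Q C \<longleftrightarrow> has_sups Q C \<and> has_approximation (qop Q) (cop C)"
proof -
  have 1: "qadjoint Q C (copresheaf Q C) (coyoneda C) I \<longleftrightarrow>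
      qadjoint (qop Q) (cop (copresheaf Q C)) (cop C) I (coyoneda C)" for I
    by (simp add: qadjoint_op)
  have 2: "qadjoint Q (copresheaf Q C) C I R \<longleftrightarrow>
      qadjoint (qop Q) (cop C) (cop (copresheaf Q C)) R I" for I R
    by (simp add: qadjoint_op)
  show ?thesis
    unfolding op_ccd_def complete_qcat_iff is_inf_def 1 2
      psh_category.ex_qadjoint_triple_iff[OF psh_category_copresheaf] ..
qed

end

section \<open>The fixed points of the Kan adjunction\<close>

locale kan = girard_quantaloid Q d + A: qcategory Q A + B: qcategory Q B
  for Q :: "('o, 'a) quantaloid_data" and d :: "'o \<Rightarrow> 'a"
    and A :: "('o, 'a, 'x) qcat" and B :: "('o, 'a, 'y) qcat" +
  fixes \<phi> :: "'x \<Rightarrow> 'y \<Rightarrow> 'a"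
  assumes phi: "\<phi> \<in> qdist Q A B"
begin

abbreviation K :: "('o, 'a, 'o \<times> ('y \<Rightarrow> unit \<Rightarrow> 'a)) qcat" where
  "K \<equiv> KK Q A B \<phi>"

definition ext :: "'o \<times> ('y \<Rightarrow> unit \<Rightarrow> 'a) \<Rightarrow> 'x \<Rightarrow> 'a" where
  "ext k a = dist_comp Q A B (qstar Q (fst k)) (snd k) \<phi> a ()"

text \<open>The entries of \<open>\<phi>\<^sub>*\<close> applied to \<open>m\<close>, for an
  arbitrary family \<open>m\<close> of arrows; fixed points can thus be built directly from
  formulas.\<close>

definition ran :: "'o \<Rightarrow> ('x \<Rightarrow> 'a) \<Rightarrow> 'o \<times> ('y \<Rightarrow> unit \<Rightarrow> 'a)" where
  "ran X m = (X, \<lambda>b _. if b \<in> cob B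
     then qmeet Q (ctyp B b) X (\<lambda>a. qext Q (ctyp A a) (ctyp B b) X (m a) (\<phi> a b)) (cob A) else undefined)"

lemmas phi_arr [simp, intro] = qdist_arr[OF A.qcat B.qcat phi]

lemma fst_ran [simp]: "fst (ran X m) = X"
  by (simp add: ran_def)

lemma ctyp_K [simp]: "ctyp K = fst"
  by (simp add: KK_def)

lemma chom_K: "chom K = chom (presheaf Q B)"
  by (simp add: KK_def)

lemma cob_KD:
  assumes "k \<in> cob K"
  shows "k \<in> cob (presheaf Q B)" "fst k \<in> qob Q" "snd k \<in> qdist Q B (qstar Q (fst k))"
    "psh Q B (fst k) (\<lambda>b. snd k b ())"
  using assms B.qdist_star_iff[of "fst k" "snd k"] by (auto simp: KK_def cob_presheaf)

lemma K_arr [simp, intro]: "\<lbrakk>k \<in> cob K; b \<in> cob B\<rbrakk> \<Longrightarrow> snd k b () \<in> arr Q (ctyp B b) (fst k)"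
  using pshD(2)[OF cob_KD(4)] .

section \<open>Fixed points described by their entries\<close>

context
  fixes k assumes k: "k \<in> cob (presheaf Q B)"
begin

lemma presheafD: "fst k \<in> qob Q" "snd k \<in> qdist Q B (qstar Q (fst k))" "is_qcat Q (qstar Q (fst k))"
  using k is_qcat_star[OF quantaloid_axioms] by (auto simp: cob_presheaf)

lemma ext_arr: "a \<in> cob A \<Longrightarrow> ext k a \<in> arr Q (ctyp A a) (fst k)"
  using dist_comp_arr[OF A.qcat B.qcat presheafD(3) phi presheafD(2)] by (simp add: ext_def)

lemma ext_leq_iff: "\<lbrakk>a \<in> cob A; h \<in> arr Q (ctyp A a) (fst k)\<rbrakk> \<Longrightarrow> leq Q (ctyp A a) (fst k) (ext k a) h \<longleftrightarrow>
    (\<forall>b\<in>cob B. leq Q (ctyp A a) (fst k) (qcomp Q (ctyp A a) (ctyp B b) (fst k) (snd k b ()) (\<phi> a b)) h)"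
  using dist_comp_leq_iff[OF A.qcat B.qcat presheafD(3) phi presheafD(2)] by (simp add: ext_def)

text \<open>Every presheaf lies below its image under \<open>\<phi>\<^sub>*\<phi>\<^sup>*\<close>,
  so being fixed amounts to the reverse inequality, which is tested on lower bounds
  \<open>h\<close>.\<close>

lemma cob_K_iff: "k \<in> cob K \<longleftrightarrow> (\<forall>b\<in>cob B. \<forall>h\<in>arr Q (ctyp B b) (fst k).
    (\<forall>a\<in>cob A. leq Q (ctyp A a) (fst k) (qcomp Q (ctyp A a) (ctyp B b) (fst k) h (\<phi> a b)) (ext k a))
    \<longrightarrow> leq Q (ctyp B b) (fst k) h (snd k b ()))" (is "_ \<longleftrightarrow> ?fix")
proof -
  let ?S = "qstar Q (fst k)"
  let ?u = "dist_comp Q A B ?S (snd k) \<phi>"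
  let ?e = "dist_ext Q A B ?S ?u \<phi>"
  note S = presheafD(3) and l = presheafD(2)
  have u: "?u \<in> qdist Q A ?S" by (rule dist_comp_qdist[OF A.qcat B.qcat S phi l])
  have e: "?e \<in> qdist Q B ?S" by (rule dist_ext_props(1)[OF A.qcat B.qcat S phi u])
  have e_iff: "leq Q (ctyp B b) (fst k) h (?e b ()) \<longleftrightarrow>
    (\<forall>a\<in>cob A. leq Q (ctyp A a) (fst k) (qcomp Q (ctyp A a) (ctyp B b) (fst k) h (\<phi> a b)) (ext k a))"
    if "b \<in> cob B" "h \<in> arr Q (ctyp B b) (fst k)" for b h
    using dist_ext_props(3)[OF A.qcat B.qcat S phi u, of b "()" h] that by (simp add: ext_def)
  have la: "snd k b () \<in> arr Q (ctyp B b) (fst k)" "?e b () \<in> arr Q (ctyp B b) (fst k)" if "b \<in> cob B" for b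
    using qdist_arr[OF B.qcat S] l e that by auto
  have "k \<in> cob K \<longleftrightarrow> ?e = snd k"
    using k by (cases k) (auto simp: KK_def kan_lower_def kan_upper_def)
  also have "\<dots> \<longleftrightarrow> ?fix"
  proof
    assume "?e = snd k" then show ?fix using e_iff by simp
  next
    assume fix_k: ?fix
    have "leq Q (ctyp B b) (fst k) (snd k b ()) (?e b ())" if b: "b \<in> cob B" for b
      using e_iff[OF b la(1)[OF b]] ext_leq_iff[OF _ ext_arr] ext_arr b by auto
    moreover have "leq Q (ctyp B b) (fst k) (?e b ()) (snd k b ())" if b: "b \<in> cob B" for b
      using fix_k e_iff[OF b la(2)[OF b]] la(2)[OF b] b by auto
    ultimately show "?e = snd k"
      by (intro qdist_eqI[OF B.qcat S e l]) auto
  qed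
  finally show ?thesis .
qed

end

lemma comp_leq_ext:
  assumes "k \<in> cob K" "a \<in> cob A" "b \<in> cob B"
  shows "leq Q (ctyp A a) (fst k) (qcomp Q (ctyp A a) (ctyp B b) (fst k) (snd k b ()) (\<phi> a b)) (ext k a)"
  using ext_leq_iff[OF cob_KD(1)[OF assms(1)] assms(2)] ext_arr[OF cob_KD(1)[OF assms(1)] assms(2)] assms
  by auto

lemma leq_if_comp_leq_ext:
  assumes "k \<in> cob K" "b \<in> cob B" "h \<in> arr Q (ctyp B b) (fst k)"
    and "\<And>a. a \<in> cob A \<Longrightarrow> leq Q (ctyp A a) (fst k) (qcomp Q (ctyp A a) (ctyp B b) (fst k) h (\<phi> a b)) (ext k a)"
  shows "leq Q (ctyp B b) (fst k) h (snd k b ())"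
  using cob_K_iff[OF cob_KD(1)[OF assms(1)]] assms by blast

lemma leq_chom_K_iff:
  assumes "k \<in> cob K" "k' \<in> cob K" "h \<in> arr Q (fst k) (fst k')"
  shows "leq Q (fst k) (fst k') h (chom K k k') \<longleftrightarrow>
    (\<forall>b\<in>cob B. leq Q (ctyp B b) (fst k') (qcomp Q (ctyp B b) (fst k) (fst k') h (snd k b ())) (snd k' b ()))"
  unfolding chom_K using B.leq_chom_presheaf_iff[OF cob_KD(1) cob_KD(1)] assms by simp

text \<open>On fixed points \<open>\<phi>\<^sup>*\<close> is fully faithful, so homs may be computed
  on the side of A. This will provide density of \<open>qq\<close>, as \<open>leq_chom_K_iff\<close>
  provides that of \<open>pp\<close>.\<close>

lemma leq_chom_K_iff_ext:
  assumes k: "k \<in> cob K" and k': "k' \<in> cob K" and h: "h \<in> arr Q (fst k) (fst k')"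
  shows "leq Q (fst k) (fst k') h (chom K k k') \<longleftrightarrow>
    (\<forall>a\<in>cob A. leq Q (ctyp A a) (fst k') (qcomp Q (ctyp A a) (fst k) (fst k') h (ext k a)) (ext k' a))"
    (is "?l \<longleftrightarrow> ?r")
proof
  note p = cob_KD(1)[OF k] and p' = cob_KD(1)[OF k']
  assume l: ?l
  show ?r
  proof
    fix a assume a: "a \<in> cob A"
    have "leq Q (ctyp A a) (fst k') (qcomp Q (ctyp A a) (fst k) (fst k') h
        (qcomp Q (ctyp A a) (ctyp B b) (fst k) (snd k b ()) (\<phi> a b))) (ext k' a)" if b: "b \<in> cob B" for b
      using leq_trans[OF comp_monoL[OF phi_arr[OF a b] bspec[OF l[unfolded leq_chom_K_iff[OF assms]] b]]
          comp_leq_ext[OF k' a b]] assoc[OF phi_arr[OF a b] K_arr[OF k b] h] by simp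
    then have "leq Q (ctyp A a) (fst k) (ext k a) (qlift Q (ctyp A a) (fst k) (fst k') h (ext k' a))"
      using leq_qlift_iff[OF h ext_arr[OF p' a] comp_arr[OF phi_arr[OF a] K_arr[OF k]]]
      by (simp add: ext_leq_iff[OF p a qlift_arr[OF h ext_arr[OF p' a]]])
    then show "leq Q (ctyp A a) (fst k') (qcomp Q (ctyp A a) (fst k) (fst k') h (ext k a)) (ext k' a)"
      using leq_qlift_iff[OF h ext_arr[OF p' a] ext_arr[OF p a]] by simp
  qed
next
  note p = cob_KD(1)[OF k] and p' = cob_KD(1)[OF k']
  assume r: ?r
  have "leq Q (ctyp B b) (fst k') (qcomp Q (ctyp B b) (fst k) (fst k') h (snd k b ())) (snd k' b ())"
    if b: "b \<in> cob B" for b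
  proof (rule leq_if_comp_leq_ext[OF k' b comp_arr[OF K_arr[OF k b] h]])
    fix a assume a: "a \<in> cob A"
    show "leq Q (ctyp A a) (fst k') (qcomp Q (ctyp A a) (ctyp B b) (fst k')
        (qcomp Q (ctyp B b) (fst k) (fst k') h (snd k b ())) (\<phi> a b)) (ext k' a)"
      using leq_trans[OF comp_monoR[OF comp_leq_ext[OF k a b] h] bspec[OF r a]]
        assoc[OF phi_arr[OF a b] K_arr[OF k b] h] by simp
  qed
  then show ?l unfolding leq_chom_K_iff[OF assms] by blast
qed

context
  fixes X m
  assumes X: "X \<in> qob Q" and m: "\<And>a. a \<in> cob A \<Longrightarrow> m a \<in> arr Q (ctyp A a) X"
begin

lemma ran_arr: "b \<in> cob B \<Longrightarrow> snd (ran X m) b () \<in> arr Q (ctyp B b) X"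
  using X m by (simp add: ran_def meet_arr)

lemma leq_ran_iff: "\<lbrakk>b \<in> cob B; h \<in> arr Q (ctyp B b) X\<rbrakk> \<Longrightarrow> leq Q (ctyp B b) X h (snd (ran X m) b ()) \<longleftrightarrow>
    (\<forall>a\<in>cob A. leq Q (ctyp A a) X (qcomp Q (ctyp A a) (ctyp B b) X h (\<phi> a b)) (m a))"
  using X m by (simp add: ran_def leq_meet_iff leq_qext_iff)

lemma ran_comp_leq: "\<lbrakk>a \<in> cob A; b \<in> cob B\<rbrakk> \<Longrightarrow>
    leq Q (ctyp A a) X (qcomp Q (ctyp A a) (ctyp B b) X (snd (ran X m) b ()) (\<phi> a b)) (m a)"
  using leq_ran_iff[of b "snd (ran X m) b ()"] ran_arr[of b] by auto

lemma ran_presheaf: "ran X m \<in> cob (presheaf Q B)"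
proof -
  have "leq Q (ctyp B b) X (qcomp Q (ctyp B b) (ctyp B b') X (snd (ran X m) b' ()) (chom B b b'))
      (snd (ran X m) b ())" if b: "b \<in> cob B" and b': "b' \<in> cob B" for b b'
  proof -
    have "leq Q (ctyp A a) X (qcomp Q (ctyp A a) (ctyp B b) X
        (qcomp Q (ctyp B b) (ctyp B b') X (snd (ran X m) b' ()) (chom B b b')) (\<phi> a b)) (m a)"
      if a: "a \<in> cob A" for a
      using leq_trans[OF comp_monoR[OF qdist_left[OF A.qcat B.qcat phi a b b'] ran_arr[OF b']]
          ran_comp_leq[OF a b']] assoc[OF phi_arr[OF a b] B.hom_arr[OF b b'] ran_arr[OF b']] by simp
    then show ?thesis
      using leq_ran_iff[OF b comp_arr[OF B.hom_arr[OF b b'] ran_arr[OF b']]] by blast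
  qed
  moreover have "snd (ran X m) b () = undefined" if "b \<notin> cob B" for b
    using that by (simp add: ran_def)
  ultimately show ?thesis
    using X ran_arr by (simp add: cob_presheaf B.qdist_star_iff psh_def)
qed

lemma ext_ran_leq: "a \<in> cob A \<Longrightarrow> leq Q (ctyp A a) X (ext (ran X m) a) (m a)"
  using ext_leq_iff[OF ran_presheaf] ran_comp_leq m by simp

text \<open>A triangle identity: by the counit \<open>ext_ran_leq\<close>, applying
  \<open>\<phi>\<^sub>*\<phi>\<^sup>*\<close> cannot enlarge \<open>ran X m\<close>.\<close>

lemma ran_K: "ran X m \<in> cob K"
  unfolding cob_K_iff[OF ran_presheaf] fst_ran
  using leq_ran_iff ext_ran_leq leq_trans by blast

end

section \<open>The two generating families of the fixed points\<close>

definition pp :: "'y \<Rightarrow> 'o \<times> ('y \<Rightarrow> unit \<Rightarrow> 'a)" where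
  "pp b = ran (ctyp B b) (\<lambda>a. \<phi> a b)"

text \<open>This is the presheaf \<open>\<not>\<phi>(a, -)\<close> (see \<open>snd_qq\<close>), written so as to be visibly a fixed point.\<close>

definition qq :: "'x \<Rightarrow> 'o \<times> ('y \<Rightarrow> unit \<Rightarrow> 'a)" where
  "qq a = ran (ctyp A a) (\<lambda>a'. neg (ctyp A a) (ctyp A a') (chom A a a'))"

lemma fst_pp [simp]: "fst (pp b) = ctyp B b" and fst_qq [simp]: "fst (qq a) = ctyp A a"
  by (simp_all add: pp_def qq_def)

lemma pp_K [simp, intro]: "b \<in> cob B \<Longrightarrow> pp b \<in> cob K"
  by (simp add: pp_def ran_K)

lemma qq_K [simp, intro]: "a \<in> cob A \<Longrightarrow> qq a \<in> cob K"
  by (simp add: qq_def ran_K)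

lemma chom_K_arr: "\<lbrakk>k \<in> cob K; k' \<in> cob K\<rbrakk> \<Longrightarrow> chom K k k' \<in> arr Q (fst k) (fst k')"
  unfolding chom_K by (intro B.chom_presheaf_arr cob_KD(1))

lemma is_qcat_K: "is_qcat Q K"
proof -
  have "is_qcat Q (presheaf Q B)"
    by (rule represents_psh_is_qcat[OF B.represents_psh_presheaf])
  then show ?thesis
    using cob_KD(1) unfolding is_qcat_def ctyp_K chom_K ctyp_presheaf by blast
qed

sublocale K: qcategory Q K
  by unfold_locales (rule is_qcat_K)

text \<open>Composition with \<open>chom A a a'\<close> moves across the negation, and \<phi>(a', b)
  \<circ> A(a, a') has join \<phi>(a, b) over all a' by the distributor law.\<close>

lemma snd_qq: "\<lbrakk>a \<in> cob A; b \<in> cob B\<rbrakk> \<Longrightarrow> snd (qq a) b () = neg (ctyp A a) (ctyp B b) (\<phi> a b)"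
proof (rule eq_by_lower)
  assume a: "a \<in> cob A" and b: "b \<in> cob B"
  show "snd (qq a) b () \<in> arr Q (ctyp B b) (ctyp A a)" using K_arr[OF qq_K[OF a] b] by simp
  show "neg (ctyp A a) (ctyp B b) (\<phi> a b) \<in> arr Q (ctyp B b) (ctyp A a)" using a b by auto
  fix h assume h: "h \<in> arr Q (ctyp B b) (ctyp A a)"
  have 1: "leq Q (ctyp A a') (ctyp A a) (qcomp Q (ctyp A a') (ctyp B b) (ctyp A a) h (\<phi> a' b))
        (neg (ctyp A a) (ctyp A a') (chom A a a')) \<longleftrightarrow>
      leq Q (ctyp A a) (ctyp A a) (qcomp Q (ctyp A a) (ctyp B b) (ctyp A a) h
        (qcomp Q (ctyp A a) (ctyp A a') (ctyp B b) (\<phi> a' b) (chom A a a'))) (d (ctyp A a))"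
    if a': "a' \<in> cob A" for a'
    using leq_neg_iff[OF A.hom_arr[OF a a'] comp_arr[OF phi_arr[OF a' b] h]]
      assoc[OF A.hom_arr[OF a a'] phi_arr[OF a' b] h] by simp
  have "leq Q (ctyp B b) (ctyp A a) h (snd (qq a) b ()) \<longleftrightarrow>
      (\<forall>a'\<in>cob A. leq Q (ctyp A a) (ctyp A a) (qcomp Q (ctyp A a) (ctyp B b) (ctyp A a) h
        (qcomp Q (ctyp A a) (ctyp A a') (ctyp B b) (\<phi> a' b) (chom A a a'))) (d (ctyp A a)))"
    using leq_ran_iff[of "ctyp A a" "\<lambda>a'. neg (ctyp A a) (ctyp A a') (chom A a a')", OF _ _ b h] a 1
    by (simp add: qq_def)
  also have "\<dots> \<longleftrightarrow> leq Q (ctyp A a) (ctyp A a) (qcomp Q (ctyp A a) (ctyp B b) (ctyp A a) h (\<phi> a b)) (d (ctyp A a))"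
    (is "?l \<longleftrightarrow> ?r")
  proof
    assume l: ?l
    show ?r
      by (rule leq_trans[OF comp_monoR[OF A.leq_comp_hom[OF a phi_arr[OF a b]] h] bspec[OF l a]])
  next
    assume r: ?r
    show ?l
    proof
      fix a' assume a': "a' \<in> cob A"
      show "leq Q (ctyp A a) (ctyp A a) (qcomp Q (ctyp A a) (ctyp B b) (ctyp A a) h
        (qcomp Q (ctyp A a) (ctyp A a') (ctyp B b) (\<phi> a' b) (chom A a a'))) (d (ctyp A a))"
        by (rule leq_trans[OF comp_monoR[OF qdist_right[OF A.qcat B.qcat phi a' a b] h] r])
    qed
  qed
  also have "\<dots> \<longleftrightarrow> leq Q (ctyp B b) (ctyp A a) h (neg (ctyp A a) (ctyp B b) (\<phi> a b))"
    using leq_neg_iff[OF phi_arr[OF a b] h] by simp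
  finally show "leq Q (ctyp B b) (ctyp A a) h (snd (qq a) b ()) \<longleftrightarrow>
    leq Q (ctyp B b) (ctyp A a) h (neg (ctyp A a) (ctyp B b) (\<phi> a b))" .
qed

text \<open>\<open>pp b\<close> is the reflection into K of the representable presheaf at
  \<open>b\<close>, so this is the Yoneda lemma.\<close>

lemma chom_pp:
  assumes b: "b \<in> cob B" and k: "k \<in> cob K"
  shows "chom K (pp b) k = snd k b ()"
proof (rule eq_by_lower)
  show "chom K (pp b) k \<in> arr Q (ctyp B b) (fst k)" using chom_K_arr[of "pp b" k] b k by simp
  show ka: "snd k b () \<in> arr Q (ctyp B b) (fst k)" using k b by auto
  fix h assume h: "h \<in> arr Q (ctyp B b) (fst k)"
  have pb: "leq Q (ctyp A a) (ctyp B b) (ext (pp b) a) (\<phi> a b)" if a: "a \<in> cob A" for a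
    unfolding pp_def using ext_ran_leq[of "ctyp B b" "\<lambda>a. \<phi> a b" a] a b by simp
  have "leq Q (ctyp B b) (ctyp B b) (qid Q (ctyp B b)) (snd (pp b) b ())"
    unfolding pp_def using leq_ran_iff[of "ctyp B b" "\<lambda>a. \<phi> a b" b "qid Q (ctyp B b)"] b by simp
  from comp_monoR[OF this h] have up: "leq Q (ctyp B b) (fst k) h
      (qcomp Q (ctyp B b) (ctyp B b) (fst k) h (snd (pp b) b ()))"
    using h by simp
  have "leq Q (ctyp B b) (fst k) h (chom K (pp b) k)" if hk: "leq Q (ctyp B b) (fst k) h (snd k b ())"
  proof -
    have "leq Q (ctyp A a) (fst k) (qcomp Q (ctyp A a) (ctyp B b) (fst k) h (ext (pp b) a)) (ext k a)"
      if a: "a \<in> cob A" for a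
      by (rule leq_trans[OF comp_mono[OF pb[OF a] hk] comp_leq_ext[OF k a b]])
    then show ?thesis
      using leq_chom_K_iff_ext[OF pp_K[OF b] k, of h] h by simp
  qed
  moreover have "leq Q (ctyp B b) (fst k) h (snd k b ())" if "leq Q (ctyp B b) (fst k) h (chom K (pp b) k)"
    by (rule leq_trans[OF up]) (use leq_chom_K_iff[OF pp_K[OF b] k, of h] h b that in simp)
  ultimately show "leq Q (ctyp B b) (fst k) h (chom K (pp b) k) \<longleftrightarrow> leq Q (ctyp B b) (fst k) h (snd k b ())"
    by blast
qed

text \<open>By \<open>snd_qq\<close> the entries of \<open>qq a\<close> are negations. Rotating the
  condition on \<open>h\<close> at each \<open>b\<close> turns it into a bound on
  \<open>ext k a\<close>, which is the join of the rotated composites.\<close>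

lemma chom_qq:
  assumes a: "a \<in> cob A" and k: "k \<in> cob K"
  shows "chom K k (qq a) = neg (ctyp A a) (fst k) (ext k a)"
proof (rule eq_by_lower)
  note p = cob_KD(1)[OF k]
  note e = ext_arr[OF p a]
  show "chom K k (qq a) \<in> arr Q (fst k) (ctyp A a)" using chom_K_arr[of k "qq a"] a k by simp
  show "neg (ctyp A a) (fst k) (ext k a) \<in> arr Q (fst k) (ctyp A a)" using e by auto
  fix h assume h: "h \<in> arr Q (fst k) (ctyp A a)"
  have nh: "neg (fst k) (ctyp A a) h \<in> arr Q (ctyp A a) (fst k)" using h by auto
  have "leq Q (ctyp B b) (ctyp A a) (qcomp Q (ctyp B b) (fst k) (ctyp A a) h (snd k b ()))
        (neg (ctyp A a) (ctyp B b) (\<phi> a b)) \<longleftrightarrow>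
      leq Q (ctyp A a) (fst k) (qcomp Q (ctyp A a) (ctyp B b) (fst k) (snd k b ()) (\<phi> a b))
        (neg (fst k) (ctyp A a) h)" if b: "b \<in> cob B" for b
    using comp_leq_iff_rotate'[OF K_arr[OF k b] h, of "neg (ctyp A a) (ctyp B b) (\<phi> a b)"] a b by simp
  then have "leq Q (fst k) (ctyp A a) h (chom K k (qq a)) \<longleftrightarrow>
      leq Q (ctyp A a) (fst k) (ext k a) (neg (fst k) (ctyp A a) h)"
    using leq_chom_K_iff[OF k qq_K[OF a], of h] h a by (simp add: snd_qq ext_leq_iff[OF p a nh])
  also have "\<dots> \<longleftrightarrow> leq Q (fst k) (ctyp A a) h (neg (ctyp A a) (fst k) (ext k a))"
    using neg_leq_neg_iff[OF e nh] h by simp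
  finally show "leq Q (fst k) (ctyp A a) h (chom K k (qq a)) \<longleftrightarrow>
    leq Q (fst k) (ctyp A a) h (neg (ctyp A a) (fst k) (ext k a))" .
qed

text \<open>Suprema are formed on the side of A, where they are joins in each entry, and carried
  back by \<open>\<phi>\<^sub>*\<close>, which lands in the fixed points by
  \<open>ran_K\<close>.\<close>

lemma has_sups_K: "has_sups Q K"
  unfolding has_sups_def
proof (intro allI impI)
  fix X \<theta> assume \<theta>: "psh Q K X \<theta>"
  have X: "X \<in> qob Q" and \<theta>a: "\<theta> k \<in> arr Q (fst k) X" if "k \<in> cob K" for k
    using pshD(1,2)[OF \<theta>] that by auto
  note X = pshD(1)[OF \<theta>]
  define m where "m a = qjoin Q (ctyp A a) X (\<lambda>k. qcomp Q (ctyp A a) (fst k) X (\<theta> k) (ext k a)) (cob K)" for a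
  have c: "qcomp Q (ctyp A a) (fst k) X (\<theta> k) (ext k a) \<in> arr Q (ctyp A a) X"
    if "a \<in> cob A" "k \<in> cob K" for a k
    using ext_arr[OF cob_KD(1)[OF that(2)] that(1)] \<theta>a[OF that(2)] by blast
  have ma: "m a \<in> arr Q (ctyp A a) X" if "a \<in> cob A" for a
    unfolding m_def using c that X by (intro join_arr) auto
  have m_up: "leq Q (ctyp A a) X (qcomp Q (ctyp A a) (fst k) X (\<theta> k) (ext k a)) (m a)"
    if "a \<in> cob A" "k \<in> cob K" for a k
    unfolding m_def using c that by (intro join_upper[where i = k]) auto
  let ?s = "ran X m"
  have s: "?s \<in> cob K" using X ma by (rule ran_K)
  have "leq Q X (fst y) h (chom K ?s y) \<longleftrightarrow>
      (\<forall>k\<in>cob K. leq Q (fst k) (fst y) (qcomp Q (fst k) X (fst y) h (\<theta> k)) (chom K k y))" (is "?l \<longleftrightarrow> ?r")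
    if y: "y \<in> cob K" and h: "h \<in> arr Q X (fst y)" for y h
  proof
    assume l: ?l
    show ?r
    proof
      fix k assume k: "k \<in> cob K"
      have "leq Q (fst k) X (\<theta> k) (chom K k ?s)"
      proof -
        have "leq Q (ctyp B b) X (qcomp Q (ctyp B b) (fst k) X (\<theta> k) (snd k b ())) (snd ?s b ())"
          if b: "b \<in> cob B" for b
        proof (rule iffD2[OF leq_ran_iff[OF X ma b comp_arr[OF K_arr[OF k b] \<theta>a[OF k]]]], assumption, rule ballI)
          fix a assume a: "a \<in> cob A"
          show "leq Q (ctyp A a) X (qcomp Q (ctyp A a) (ctyp B b) X
              (qcomp Q (ctyp B b) (fst k) X (\<theta> k) (snd k b ())) (\<phi> a b)) (m a)"
            using leq_trans[OF comp_monoR[OF comp_leq_ext[OF k a b] \<theta>a[OF k]] m_up[OF a k]]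
              assoc[OF phi_arr[OF a b] K_arr[OF k b] \<theta>a[OF k]] by simp
        qed
        then show ?thesis
          using leq_chom_K_iff[OF k s, of "\<theta> k"] \<theta>a[OF k] by simp
      qed
      from leq_trans[OF comp_mono[OF this l]] K.hom_comp[OF k s y]
      show "leq Q (fst k) (fst y) (qcomp Q (fst k) X (fst y) h (\<theta> k)) (chom K k y)"
        by simp
    qed
  next
    assume r: ?r
    have "leq Q (ctyp A a) (fst y) (qcomp Q (ctyp A a) X (fst y) h (ext ?s a)) (ext y a)"
      if a: "a \<in> cob A" for a
    proof -
      note ya = ext_arr[OF cob_KD(1)[OF y] a]
      have "leq Q (ctyp A a) (fst y) (qcomp Q (ctyp A a) X (fst y) h
          (qcomp Q (ctyp A a) (fst k) X (\<theta> k) (ext k a))) (ext y a)" if k: "k \<in> cob K" for k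
      proof -
        note ka = ext_arr[OF cob_KD(1)[OF k] a]
        have "leq Q (ctyp A a) (fst y) (qcomp Q (ctyp A a) (fst k) (fst y) (chom K k y) (ext k a)) (ext y a)"
          using leq_chom_K_iff_ext[OF k y chom_K_arr[OF k y]] leq_refl[OF chom_K_arr[OF k y]] a by blast
        from leq_trans[OF comp_monoL[OF ka bspec[OF r k]] this] show ?thesis
          using assoc[OF ka \<theta>a[OF k] h] by simp
      qed
      then have hm: "leq Q (ctyp A a) (fst y) (qcomp Q (ctyp A a) X (fst y) h (m a)) (ext y a)"
        unfolding m_def by (subst comp_join_right_leq_iff[OF h c[OF a] ya]) auto
      have "leq Q (ctyp A a) X (ext ?s a) (m a)"
        using ma by (rule ext_ran_leq[OF X _ a])
      from leq_trans[OF comp_monoR[OF this h] hm] show ?thesis .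
    qed
    then show ?l using leq_chom_K_iff_ext[OF s y, of h] h by simp
  qed
  then show "\<exists>s. sup_of Q K X \<theta> s"
    using s by (intro exI[of _ ?s]) (simp add: sup_of_def)
qed

text \<open>Density of \<open>pp\<close> is the entrywise description of homs, since
  \<open>chom_pp\<close> makes the entries homs out of \<open>pp b\<close>. Density of
  \<open>qq\<close> is the description through \<open>ext\<close>, rotated by means of
  \<open>chom_qq\<close>.\<close>

sublocale gen: generated_category Q d K "cob A" "cob B" qq pp \<phi>
proof unfold_locales
  show "\<phi> a b \<in> arr Q (ctyp K (qq a)) (ctyp K (pp b))" if "a \<in> cob A" "b \<in> cob B" for a b
    using that by simp
  show "chom K (pp b) (qq a) = neg (ctyp K (qq a)) (ctyp K (pp b)) (\<phi> a b)"
    if "a \<in> cob A" "b \<in> cob B" for a b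
    using that by (simp add: chom_pp snd_qq)
  fix x y h
  assume x: "x \<in> cob K" and y: "y \<in> cob K" and h: "h \<in> arr Q (ctyp K x) (ctyp K y)"
  show "leq Q (ctyp K x) (ctyp K y) h (chom K x y)"
    if "\<And>b. b \<in> cob B \<Longrightarrow> leq Q (ctyp K (pp b)) (ctyp K y)
      (qcomp Q (ctyp K (pp b)) (ctyp K x) (ctyp K y) h (chom K (pp b) x)) (chom K (pp b) y)"
    using that x y h by (simp add: leq_chom_K_iff chom_pp)
  show "leq Q (ctyp K x) (ctyp K y) h (chom K x y)"
    if le: "\<And>a. a \<in> cob A \<Longrightarrow> leq Q (ctyp K x) (ctyp K (qq a))
      (qcomp Q (ctyp K x) (ctyp K y) (ctyp K (qq a)) (chom K y (qq a)) h) (chom K x (qq a))"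
  proof -
    have "leq Q (ctyp A a) (fst y) (qcomp Q (ctyp A a) (fst x) (fst y) h (ext x a)) (ext y a)"
      if a: "a \<in> cob A" for a
    proof -
      note e = ext_arr[OF cob_KD(1)[OF x] a] ext_arr[OF cob_KD(1)[OF y] a]
      show ?thesis
        using comp_leq_iff_rotate[OF e(1) _ e(2), of h] le[OF a] h by (simp add: chom_qq a x y)
    qed
    then show ?thesis
      using leq_chom_K_iff_ext[OF x y] h by simp
  qed
qed (auto simp: has_sups_K)

lemma ccd_K_iff: "ccd Q K \<longleftrightarrow> regular_dist Q A B \<phi>"
  using K.ccd_iff has_sups_K gen.has_approximation_iff_regular
    regular_dist_iff[OF A.qcat B.qcat phi] by simp

lemma op_ccd_K_iff: "op_ccd Q K \<longleftrightarrow> ccd Q K"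
  using K.ccd_iff K.op_ccd_iff gen.has_approximation_op_iff by simp

end

theorem theorem7p5:
  fixes Q :: "('o, 'a) quantaloid_data"
    and d :: "'o \<Rightarrow> 'a"
    and A :: "('o, 'a, 'x) qcat"
    and B :: "('o, 'a, 'y) qcat"
    and \<phi> :: "'x \<Rightarrow> 'y \<Rightarrow> 'a"
  assumes "girard_quantaloid Q d"
    and "is_qcat Q A"
    and "is_qcat Q B"
    and "\<phi> \<in> qdist Q A B"
  shows "(regular_dist Q A B \<phi> \<longleftrightarrow> ccd Q (KK Q A B \<phi>))
       \<and> (ccd Q (KK Q A B \<phi>) \<longleftrightarrow> op_ccd Q (KK Q A B \<phi>))"
proof -
  interpret girard_quantaloid Q d by fact
  interpret kan Q d A B \<phi> by unfold_locales fact+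
  show ?thesis using ccd_K_iff op_ccd_K_iff by simp
qed

end
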